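(* Let $m,n\ge1$, $\mathfrak g=\mathfrak{gl}(m|n)$ over $\mathbb C$, and let $\beta=\delta_s-\epsilon_t$ with $1\le s\le m$, $1\le t\le n$ be a positive odd root. Then the element $$\theta_\beta=\sum_{J\in\mathcal A}E_J\Big(\prod_{\overline s<k<t,\;k\notin J}C_k\Big)$$ is the unique element in $U(\mathfrak b^-)_{-\beta}$ which satisfies $\theta_\beta v_\lambda^+=S_{-\beta}v_\lambda^+$ in $M(\lambda)$ for any $\beta$-atypical weight $\lambda\in\mathfrak h^*$; hence it is a Shapovalov element for $\beta$.
   Context: Let $I=\{\overline m,\overline{m-1},\ldots,\overline 1,1,2,\ldots,n\}$ with total order $\overline m<\overline{m-1}<\cdots<\overline 1<1<2<\cdots<n$. The Lie superalgebra $\mathfrak g=\mathfrak{gl}(m|n)$ has standard basis of matrix units $E_{i,j}$ $(i,j\in I)$; $E_{i,j}$ is even if $i,j$ are both barred or both unbarred, and odd otherwise. $\mathfrak h$ is the Cartan subalgebra of diagonal matrices, $\mathfrak n^-$ (resp. $\mathfrak n^+$) is the subalgebra of strictly lower (resp. strictly upper) triangular matrices with respect to the order on $I$, and $\mathfrak b^-=\mathfrak n^-\oplus\mathfrak h$. $\{\delta_m,\ldots,\delta_1,\epsilon_1,\ldots,\epsilon_n\}\subset\mathfrak h^*$ is the basis dual to $\{E_{\overline m,\overline m},\ldots,E_{\overline 1,\overline 1},E_{1,1},\ldots,E_{n,n}\}$. The positive odd roots are the $\delta_i-\epsilon_p$ with $1\le i\le m$, $1\le p\le n$. $U(\mathfrak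 b^-)_{-\beta}$ is the subspace of $U(\mathfrak b^-)$ of weight $-\beta$ under the adjoint action of $\mathfrak h$. A weight $\lambda=\sum_i a_i\delta_i+\sum_j b_j\epsilon_j$ is written $(a_m,\ldots,a_1\,|\,b_1,\ldots,b_n)$; it is $\beta$-atypical for $\beta=\delta_s-\epsilon_t$ if $(\lambda+\rho,\beta)=0$ (with $\rho$ the Weyl vector and $(\cdot,\cdot)$ the invariant form), equivalently if $a_s+b_t+s-t=0$. The Verma module is $M(\lambda)=\mathrm{Ind}_{\mathfrak h\oplus\mathfrak n^+}^{\mathfrak g}\mathbb C 1_\lambda$, where $h\cdot 1_\lambda=\lambda(h)1_\lambda$ for $h\in\mathfrak h$ and $\mathfrak n^+\cdot 1_\lambda=0$; its highest weight vector is $v_\lambda^+=1\otimes1_\lambda$. A nonzero vector $v$ in a $\mathfrak g$-module is singular if $\mathfrak n^+\cdot v=0$. A Shapovalov element for $\beta$ is an element $\theta\in U(\mathfrak b^-)_{-\beta}$ such that $\theta v_\lambda^+$ is a singular vector of weight $\lambda-\beta$ in $M(\lambda)$ for any $\beta$-atypical weight $\lambda$. Let $\mathcal A$ be the set of all subsets $J=\{j_1<j_2<\cdots<j_p\}$ (including $J=\emptyset$) of $\{k\in I:\overline s<k<t\}$. For $J\in\mathcal A$ put $E_J=E_{t,j_p}E_{j_p,j_{p-1}}\cdots E_{j_1,\overline s}\in U(\mathfrak n^-)$, with $E_\emptyset=E_{t,\overline s}$. Define elements of $\mathbb C+\mathfrak h\subset U(\mathfrak h)$ by $C_{\overline k}=E_{\overline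 s,\overline s}-E_{\overline k,\overline k}+s-1-k$ for $1\le k\le s-1$ and $C_k=E_{t,t}-E_{k,k}-(t-k)$ for $1\le k\le t-1$. For a weight $\lambda=(a_m,\ldots,a_1\,|\,b_1,\ldots,b_n)$ define scalars $c_{\overline{k}}=a_s-a_k+s-1-k$ for $1\le k\le s-1$ and $c_k=b_t-b_k-(t-k)$ for $1\le k\le t-1$, put $d_J=\prod_{\overline s<k<t,\;k\notin J}c_k$ (empty product $=1$), and $S_{-\beta}=\sum_{J\in\mathcal A}d_JE_J\in U(\mathfrak n^-)$ (depending on $\lambda$).
   Formalization: Uniqueness fails as stated: with L=E_{s̄,s̄}+E_{t,t}+s−t, θ_β+E_{t,s̄}L also works. Proved instead: the elements with the property are exactly θ_β+U(b⁻)_{-β}L, and θ_β is unique if the identity is required for all λ∈h*, not only β-atypical λ. *)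

theory Defs
  imports Complex_Main "HOL-Library.Poly_Mapping" "HOL-Algebra.QuotRing"
    "HOL-Algebra.Generated_Rings" "HOL-Algebra.Generated_Groups"
begin

section \<open>The Lie superalgebra $\mathfrak{gl}(m|n)$\<close>

text \<open>
  The barred index $\bar k$ is encoded by the negative integer $-k$ and the unbarred index $k$
  by $k$ itself, so that the order on the index set is the order of the integers.
  Matrices are functions \<^typ>\<open>int \<Rightarrow> int \<Rightarrow> complex\<close> vanishing outside the index set.
\<close>

type_synonym supermatrix = "int \<Rightarrow> int \<Rightarrow> complex"

definition idx :: "nat \<Rightarrow> nat \<Rightarrow> int set" where
  "idx m n = {- int m..int n} - {0}"

definition par :: "int \<Rightarrow> nat" where
  "par i = (if i < 0 then 0 else 1)"

definition gl :: "nat \<Rightarrow> nat \<Rightarrow> supermatrix set" where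
  "gl m n = {X. \<forall>i j. X i j \<noteq> 0 \<longrightarrow> i \<in> idx m n \<and> j \<in> idx m n}"

definition gl_part :: "nat \<Rightarrow> nat \<Rightarrow> nat \<Rightarrow> supermatrix set" where
  "gl_part m n p = {X \<in> gl m n. \<forall>i j. X i j \<noteq> 0 \<longrightarrow> (par i + par j) mod 2 = p}"

definition matmul :: "nat \<Rightarrow> nat \<Rightarrow> supermatrix \<Rightarrow> supermatrix \<Rightarrow> supermatrix" where
  "matmul m n X Y = (\<lambda>i j. \<Sum>k\<in>idx m n. X i k * Y k j)"

text \<open>The superbracket of \<open>X\<close> of parity \<open>p\<close> and \<open>Y\<close> of parity \<open>q\<close>.\<close>

definition sbracket ::
    "nat \<Rightarrow> nat \<Rightarrow> nat \<Rightarrow> nat \<Rightarrow> supermatrix \<Rightarrow> supermatrix \<Rightarrow> supermatrix" where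
  "sbracket m n p q X Y =
     (\<lambda>i j. matmul m n X Y i j - (-1) ^ (p * q) * matmul m n Y X i j)"

definition munit :: "int \<Rightarrow> int \<Rightarrow> supermatrix" where
  "munit i j = (\<lambda>k l. if k = i \<and> l = j then 1 else 0)"

definition cartan :: "nat \<Rightarrow> nat \<Rightarrow> supermatrix set" where
  "cartan m n = {X \<in> gl m n. \<forall>i j. X i j \<noteq> 0 \<longrightarrow> i = j}"

definition n_plus :: "nat \<Rightarrow> nat \<Rightarrow> supermatrix set" where
  "n_plus m n = {X \<in> gl m n. \<forall>i j. X i j \<noteq> 0 \<longrightarrow> i < j}"

definition b_plus :: "nat \<Rightarrow> nat \<Rightarrow> supermatrix set" where
  "b_plus m n = {X \<in> gl m n. \<forall>i j. X i j \<noteq> 0 \<longrightarrow> i \<le> j}"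

definition b_minus :: "nat \<Rightarrow> nat \<Rightarrow> supermatrix set" where
  "b_minus m n = {X \<in> gl m n. \<forall>i j. X i j \<noteq> 0 \<longrightarrow> j \<le> i}"


section \<open>The universal enveloping algebra\<close>

datatype 'x freemon = Mon (letters: "'x list")

instantiation freemon :: (type) monoid_add
begin

definition zero_freemon :: "'a freemon" where
  "0 = Mon []"

definition plus_freemon :: "'a freemon \<Rightarrow> 'a freemon \<Rightarrow> 'a freemon" where
  "u + v = Mon (letters u @ letters v)"

instance
  by standard (simp_all add: zero_freemon_def plus_freemon_def)

end

text \<open>
  The convolution product of finitely supported functions on the free monoid makes
  \<open>'x freemon \<Rightarrow>\<^sub>0 complex\<close> the free associative unital algebra on the type \<open>'x\<close>.
\<close>

definition free_alg :: "'x set \<Rightarrow> ('x freemon \<Rightarrow>\<^sub>0 complex) ring" where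
  "free_alg A = \<lparr>carrier = {f. \<forall>w\<in>Poly_Mapping.keys f. set (letters w) \<subseteq> A},
                 mult = (*), one = 1, zero = 0, add = (+)\<rparr>"

definition gen :: "'x \<Rightarrow> 'x freemon \<Rightarrow>\<^sub>0 complex" where
  "gen x = Poly_Mapping.single (Mon [x]) 1"

definition const :: "complex \<Rightarrow> 'x freemon \<Rightarrow>\<^sub>0 complex" where
  "const c = Poly_Mapping.single (Mon []) c"

text \<open>
  Every element of the Lie superalgebra is a free generator. The first two families of relations
  turn the free algebra into the tensor algebra of the vector space \<^term>\<open>gl m n\<close>; the third one
  is the defining relation of the enveloping algebra.
\<close>

definition U_rels :: "nat \<Rightarrow> nat \<Rightarrow> (supermatrix freemon \<Rightarrow>\<^sub>0 complex) set" where
  "U_rels m n =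
     {gen (\<lambda>i j. X i j + Y i j) - gen X - gen Y | X Y. X \<in> gl m n \<and> Y \<in> gl m n} \<union>
     {gen (\<lambda>i j. c * X i j) - const c * gen X | c X. X \<in> gl m n} \<union>
     {gen X * gen Y - const ((-1) ^ (p * q)) * (gen Y * gen X) - gen (sbracket m n p q X Y)
        | p q X Y. p < 2 \<and> q < 2 \<and> X \<in> gl_part m n p \<and> Y \<in> gl_part m n q}"

definition U_ideal :: "nat \<Rightarrow> nat \<Rightarrow> (supermatrix freemon \<Rightarrow>\<^sub>0 complex) set" where
  "U_ideal m n = genideal (free_alg (gl m n)) (U_rels m n)"

type_synonym env = "(supermatrix freemon \<Rightarrow>\<^sub>0 complex) set"

definition U :: "nat \<Rightarrow> nat \<Rightarrow> env ring" where
  "U m n = free_alg (gl m n) Quot U_ideal m n"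

definition emb :: "nat \<Rightarrow> nat \<Rightarrow> supermatrix \<Rightarrow> env" where
  "emb m n X = U_ideal m n +>\<^bsub>free_alg (gl m n)\<^esub> gen X"

definition scal :: "nat \<Rightarrow> nat \<Rightarrow> complex \<Rightarrow> env" where
  "scal m n c = U_ideal m n +>\<^bsub>free_alg (gl m n)\<^esub> const c"

definition E :: "nat \<Rightarrow> nat \<Rightarrow> int \<Rightarrow> int \<Rightarrow> env" where
  "E m n i j = emb m n (munit i j)"


section \<open>Weights\<close>

text \<open>
  The weight $\sum_i a_i\delta_i + \sum_j b_j\epsilon_j$ is the function $\nu$ with
  $\nu(-i) = a_i$ and $\nu(j) = b_j$; values outside the index set are irrelevant.
\<close>

type_synonym weight = "int \<Rightarrow> complex"

definition wt_eval :: "nat \<Rightarrow> nat \<Rightarrow> weight \<Rightarrow> supermatrix \<Rightarrow> complex" where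
  "wt_eval m n \<nu> X = (\<Sum>k\<in>idx m n. \<nu> k * X k k)"

text \<open>\<open>wt_root i j\<close> is the weight of the matrix unit \<open>munit i j\<close>.\<close>

definition wt_root :: "int \<Rightarrow> int \<Rightarrow> weight" where
  "wt_root i j = (\<lambda>k. (if k = i then 1 else 0) - (if k = j then 1 else 0))"

definition odd_root :: "nat \<Rightarrow> nat \<Rightarrow> weight" where
  "odd_root s t = wt_root (- int s) (int t)"

text \<open>The form on weights dual to the supertrace form on the Cartan subalgebra.\<close>

definition wt_form :: "nat \<Rightarrow> nat \<Rightarrow> weight \<Rightarrow> weight \<Rightarrow> complex" where
  "wt_form m n \<nu> \<mu> = (\<Sum>k\<in>idx m n. (-1) ^ par k * \<nu> k * \<mu> k)"

text \<open>Half the sum of the positive even roots minus half the sum of the positive odd roots.\<close>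

definition weyl_vector :: "nat \<Rightarrow> nat \<Rightarrow> weight" where
  "weyl_vector m n k =
     (\<Sum>(i, j)\<in>{(i, j). i \<in> idx m n \<and> j \<in> idx m n \<and> i < j}.
        (-1) ^ (par i + par j) * wt_root i j k) / 2"

definition atypical :: "nat \<Rightarrow> nat \<Rightarrow> weight \<Rightarrow> weight \<Rightarrow> bool" where
  "atypical m n \<beta> \<nu> \<longleftrightarrow> wt_form m n (\<lambda>k. \<nu> k + weyl_vector m n k) \<beta> = 0"

lemma atypical_iff:
  assumes "1 \<le> s" "s \<le> m" "1 \<le> t" "t \<le> n"
  shows "atypical m n (odd_root s t) \<nu> \<longleftrightarrow> \<nu> (- int s) + \<nu> (int t) + of_nat s - of_nat t = 0"
proof -
  have fin: "finite (idx m n)" by (simp add: idx_def)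
  let ?a = "- int s" and ?b = "int t"
  have ab: "?a \<in> idx m n" "?b \<in> idx m n" "?a \<noteq> ?b" using assms by (auto simp: idx_def)
  have pairs: "{(i, j). i \<in> idx m n \<and> j \<in> idx m n \<and> i < j} =
      Sigma (idx m n) (\<lambda>i. {j \<in> idx m n. i < j})" by auto
  have wv: "weyl_vector m n k =
      ((\<Sum>j\<in>{j \<in> idx m n. k < j}. (-1) ^ (par k + par j))
        - (\<Sum>i\<in>{i \<in> idx m n. i < k}. (-1) ^ (par i + par k))) / 2" if k: "k \<in> idx m n" for k
  proof -
    let ?g = "\<lambda>i j. (-1) ^ (par i + par j) :: complex"
    have "(\<Sum>(i, j)\<in>{(i, j). i \<in> idx m n \<and> j \<in> idx m n \<and> i < j}. ?g i j * wt_root i j k) =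
       (\<Sum>i\<in>idx m n. \<Sum>j\<in>idx m n. if i < j then ?g i j * wt_root i j k else 0)"
      unfolding pairs using fin by (simp add: sum.Sigma[symmetric] sum.inter_filter)
    also have "\<dots> = (\<Sum>i\<in>idx m n. \<Sum>j\<in>idx m n.
          (if i = k then if k < j then ?g k j else 0 else 0)
          - (if j = k then if i < k then ?g i k else 0 else 0))"
      by (intro sum.cong refl) (auto simp: wt_root_def)
    also have "\<dots> = (\<Sum>i\<in>idx m n. if i = k then \<Sum>j\<in>idx m n. if k < j then ?g k j else 0 else 0)
          - (\<Sum>i\<in>idx m n. if i < k then ?g i k else 0)"
    proof -
      have "(\<Sum>j\<in>idx m n. if i = k then if k < j then ?g k j else 0 else 0)
          = (if i = k then \<Sum>j\<in>idx m n. if k < j then ?g k j else 0 else 0)" for i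
        by simp
      moreover have "(\<Sum>j\<in>idx m n. if j = k then if i < k then ?g i k else 0 else 0)
          = (if i < k then ?g i k else 0)" for i
        using fin k by (simp add: sum.delta)
      ultimately show ?thesis by (simp only: sum_subtractf)
    qed
    also have "\<dots> = (\<Sum>j\<in>{j \<in> idx m n. k < j}. ?g k j) - (\<Sum>i\<in>{i \<in> idx m n. i < k}. ?g i k)"
      using fin k by (simp add: sum.inter_filter)
    finally show ?thesis by (simp add: weyl_vector_def)
  qed
  have sets: "{j \<in> idx m n. ?a < j} = {?a<..<0} \<union> {1..int n}"
      "{i \<in> idx m n. i < ?a} = {- int m..<?a}"
      "{j \<in> idx m n. ?b < j} = {?b<..int n}"
      "{i \<in> idx m n. i < ?b} = {- int m..<0} \<union> {1..<?b}"
    using assms by (auto simp: idx_def)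
  have 1: "(\<Sum>j\<in>{?a<..<0} \<union> {1..int n}. (-1) ^ (par ?a + par j) :: complex)
      = of_nat (s - 1) - of_nat n"
    using assms by (subst sum.union_disjoint) (auto simp: par_def nat_diff_distrib)
  have 2: "(\<Sum>i\<in>{- int m..<?a}. (-1) ^ (par i + par ?a) :: complex) = of_nat (m - s)"
    using assms by (auto simp: par_def)
  have 3: "(\<Sum>j\<in>{?b<..int n}. (-1) ^ (par ?b + par j) :: complex) = of_nat (n - t)"
    using assms by (auto simp: par_def)
  have 4: "(\<Sum>i\<in>{- int m..<0} \<union> {1..<?b}. (-1) ^ (par i + par ?b) :: complex)
      = of_nat (t - 1) - of_nat m"
    using assms by (subst sum.union_disjoint) (auto simp: par_def nat_diff_distrib)
  have "wt_form m n \<mu> (odd_root s t) = \<mu> ?a + \<mu> ?b" for \<mu>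
  proof -
    have "wt_form m n \<mu> (odd_root s t) =
        (\<Sum>k\<in>idx m n. (if k = ?a then \<mu> ?a else 0) + (if k = ?b then \<mu> ?b else 0))"
      unfolding wt_form_def using assms
      by (intro sum.cong refl) (auto simp: odd_root_def wt_root_def par_def)
    then show ?thesis using ab fin by (simp add: sum.distrib)
  qed
  moreover have "weyl_vector m n ?a + weyl_vector m n ?b = of_nat s - of_nat t"
    unfolding wv[OF ab(1)] wv[OF ab(2)] sets 1 2 3 4 using assms by (simp add: of_nat_diff field_simps)
  ultimately have "wt_form m n (\<lambda>k. \<nu> k + weyl_vector m n k) (odd_root s t)
      = \<nu> ?a + \<nu> ?b + of_nat s - of_nat t"
    by (simp add: algebra_simps)
  then show ?thesis by (simp add: atypical_def)
qed

text \<open>The enveloping algebra of \<open>b_minus\<close>, as a subalgebra of \<open>U\<close>, and its weight spaces.\<close>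

definition Ub_minus :: "nat \<Rightarrow> nat \<Rightarrow> env set" where
  "Ub_minus m n = generate_ring (U m n) (range (scal m n) \<union> emb m n ` b_minus m n)"

definition Ub_minus_wt :: "nat \<Rightarrow> nat \<Rightarrow> weight \<Rightarrow> env set" where
  "Ub_minus_wt m n \<mu> = {u \<in> Ub_minus m n. \<forall>h\<in>cartan m n.
     emb m n h \<otimes>\<^bsub>U m n\<^esub> u \<ominus>\<^bsub>U m n\<^esub> u \<otimes>\<^bsub>U m n\<^esub> emb m n h
       = scal m n (wt_eval m n \<mu> h) \<otimes>\<^bsub>U m n\<^esub> u}"


section \<open>Verma modules and singular vectors\<close>

text \<open>
  The induced module $U(\mathfrak g)\otimes_{U(\mathfrak b)}\mathbb C_\nu$ for
  $\mathfrak b = \mathfrak h\oplus\mathfrak n^+$ is the quotient of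
  $U(\mathfrak g)\otimes_{\mathbb C}\mathbb C_\nu = U(\mathfrak g)$ by the span of the
  elements $ux\otimes 1_\nu - u\otimes x 1_\nu$ with $x\in\mathfrak b$. Here $x$ acts on
  $1_\nu$ by \<open>wt_eval m n \<nu> x\<close>, which only involves the diagonal of $x$. As $u$ is arbitrary,
  the additive subgroup generated by these elements is already their span.
\<close>

definition verma_rel :: "nat \<Rightarrow> nat \<Rightarrow> weight \<Rightarrow> env set" where
  "verma_rel m n \<nu> = generate (add_monoid (U m n))
     {u \<otimes>\<^bsub>U m n\<^esub> emb m n x \<ominus>\<^bsub>U m n\<^esub> u \<otimes>\<^bsub>U m n\<^esub> scal m n (wt_eval m n \<nu> x)
        | u x. u \<in> carrier (U m n) \<and> x \<in> b_plus m n}"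

text \<open>
  The additive group of the module is a factor group written multiplicatively by the library:
  its \<open>\<one>\<close> is the zero vector. The class of \<open>w\<close> stands for $w\otimes 1_\nu$.
\<close>

definition verma :: "nat \<Rightarrow> nat \<Rightarrow> weight \<Rightarrow> env set monoid" where
  "verma m n \<nu> = U m n A_Mod verma_rel m n \<nu>"

definition verma_act :: "nat \<Rightarrow> nat \<Rightarrow> weight \<Rightarrow> env \<Rightarrow> env set \<Rightarrow> env set" where
  "verma_act m n \<nu> u v = (\<Union>w\<in>v. verma_rel m n \<nu> +>\<^bsub>U m n\<^esub> (u \<otimes>\<^bsub>U m n\<^esub> w))"

definition verma_hw :: "nat \<Rightarrow> nat \<Rightarrow> weight \<Rightarrow> env set" where
  "verma_hw m n \<nu> = verma_rel m n \<nu> +>\<^bsub>U m n\<^esub> \<one>\<^bsub>U m n\<^esub>"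

definition singular :: "nat \<Rightarrow> nat \<Rightarrow> weight \<Rightarrow> env set \<Rightarrow> bool" where
  "singular m n \<nu> v \<longleftrightarrow> v \<in> carrier (verma m n \<nu>) \<and> v \<noteq> \<one>\<^bsub>verma m n \<nu>\<^esub> \<and>
     (\<forall>x\<in>n_plus m n. verma_act m n \<nu> (emb m n x) v = \<one>\<^bsub>verma m n \<nu>\<^esub>)"

definition has_weight :: "nat \<Rightarrow> nat \<Rightarrow> weight \<Rightarrow> weight \<Rightarrow> env set \<Rightarrow> bool" where
  "has_weight m n \<nu> \<mu> v \<longleftrightarrow> (\<forall>h\<in>cartan m n.
     verma_act m n \<nu> (emb m n h) v = verma_act m n \<nu> (scal m n (wt_eval m n \<mu> h)) v)"

definition shapovalov_element :: "nat \<Rightarrow> nat \<Rightarrow> weight \<Rightarrow> env \<Rightarrow> bool" where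
  "shapovalov_element m n \<beta> \<theta> \<longleftrightarrow> \<theta> \<in> Ub_minus_wt m n (\<lambda>k. - \<beta> k) \<and>
     (\<forall>\<nu>. atypical m n \<beta> \<nu> \<longrightarrow>
        singular m n \<nu> (verma_act m n \<nu> \<theta> (verma_hw m n \<nu>)) \<and>
        has_weight m n \<nu> (\<lambda>k. \<nu> k - \<beta> k) (verma_act m n \<nu> \<theta> (verma_hw m n \<nu>)))"


section \<open>The elements $\theta_\beta$ and $S_{-\beta}$ for $\beta = \delta_s - \epsilon_t$\<close>

definition between :: "nat \<Rightarrow> nat \<Rightarrow> int set" where
  "between s t = {- int s<..<int t} - {0}"

fun E_chain :: "nat \<Rightarrow> nat \<Rightarrow> int \<Rightarrow> int \<Rightarrow> int list \<Rightarrow> env" where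
  "E_chain m n b a [] = E m n b a"
| "E_chain m n b a (j # js) = E_chain m n b j js \<otimes>\<^bsub>U m n\<^esub> E m n j a"

definition E_J :: "nat \<Rightarrow> nat \<Rightarrow> nat \<Rightarrow> nat \<Rightarrow> int set \<Rightarrow> env" where
  "E_J m n s t J = E_chain m n (int t) (- int s) (sorted_list_of_set J)"

text \<open>For $k = \bar l$, encoded as $-l$, the constant $s - 1 - l$ becomes $s - 1 + k$.\<close>

definition C_elt :: "nat \<Rightarrow> nat \<Rightarrow> nat \<Rightarrow> nat \<Rightarrow> int \<Rightarrow> env" where
  "C_elt m n s t k =
     (if k < 0
      then E m n (- int s) (- int s) \<ominus>\<^bsub>U m n\<^esub> E m n k k
             \<oplus>\<^bsub>U m n\<^esub> scal m n (of_int (int s - 1 + k))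
      else E m n (int t) (int t) \<ominus>\<^bsub>U m n\<^esub> E m n k k
             \<ominus>\<^bsub>U m n\<^esub> scal m n (of_int (int t - k)))"

definition c_scal :: "weight \<Rightarrow> nat \<Rightarrow> nat \<Rightarrow> int \<Rightarrow> complex" where
  "c_scal \<nu> s t k =
     (if k < 0 then \<nu> (- int s) - \<nu> k + of_int (int s - 1 + k)
      else \<nu> (int t) - \<nu> k - of_int (int t - k))"

text \<open>The factors \<open>C_elt\<close> commute; they are multiplied in increasing order of the index.\<close>

definition C_prod :: "nat \<Rightarrow> nat \<Rightarrow> nat \<Rightarrow> nat \<Rightarrow> int set \<Rightarrow> env" where
  "C_prod m n s t K =
     foldr (\<lambda>k u. C_elt m n s t k \<otimes>\<^bsub>U m n\<^esub> u) (sorted_list_of_set K) \<one>\<^bsub>U m n\<^esub>"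

definition theta :: "nat \<Rightarrow> nat \<Rightarrow> nat \<Rightarrow> nat \<Rightarrow> env" where
  "theta m n s t =
     (\<Oplus>\<^bsub>U m n\<^esub>J\<in>Pow (between s t). E_J m n s t J \<otimes>\<^bsub>U m n\<^esub> C_prod m n s t (between s t - J))"

definition d_coeff :: "weight \<Rightarrow> nat \<Rightarrow> nat \<Rightarrow> int set \<Rightarrow> complex" where
  "d_coeff \<nu> s t J = (\<Prod>k\<in>between s t - J. c_scal \<nu> s t k)"

definition S_elt :: "nat \<Rightarrow> nat \<Rightarrow> nat \<Rightarrow> nat \<Rightarrow> weight \<Rightarrow> env" where
  "S_elt m n s t \<nu> =
     (\<Oplus>\<^bsub>U m n\<^esub>J\<in>Pow (between s t). scal m n (d_coeff \<nu> s t J) \<otimes>\<^bsub>U m n\<^esub> E_J m n s t J)"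

text \<open>
  \<open>atyp_elt\<close> acts on the highest weight vector by $(\nu+\rho,\beta)$. Hence elements of
  $U(\mathfrak b^-)\cdot\mathtt{atyp\_elt}$ annihilate the highest weight vector for every
  $\beta$-atypical $\nu$, and an element of $U(\mathfrak b^-)_{-\beta}$ can be determined by
  its action for $\beta$-atypical $\nu$ only modulo $U(\mathfrak b^-)_{-\beta}\cdot\mathtt{atyp\_elt}$.
\<close>

definition atyp_elt :: "nat \<Rightarrow> nat \<Rightarrow> nat \<Rightarrow> nat \<Rightarrow> env" where
  "atyp_elt m n s t =
     E m n (- int s) (- int s) \<oplus>\<^bsub>U m n\<^esub> E m n (int t) (int t)
       \<oplus>\<^bsub>U m n\<^esub> scal m n (of_int (int s - int t))"

end

theory Submission
  imports Defs "HOL-Library.Product_Lexorder" "HOL-Computational_Algebra.Polynomial"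
begin

text \<open>
  The weight $-\beta$ part of $U(\mathfrak b^-)$ is spanned by the products $E_J\,p_J$ with
  $p_J \in U(\mathfrak h)$, and $p_J$ acts on $v_\lambda^+$ by the scalar $p_J(\lambda)$. Uniqueness therefore
  reduces to the linear independence of the vectors $E_J v_\lambda^+$ for every $\lambda$. The full
  PBW theorem is not needed: tensor products of Fock spaces contain highest
  weight vectors, of a Zariski dense set of weights, on which the $E_J$ are visibly independent, and
  the coefficients of an element of $U(\mathfrak g)_{-\beta}$ with respect to the $E_J$, modulo
  $U(\mathfrak g)\mathfrak n^+$, depend polynomially on the highest weight.

  For singularity, $S_{-\beta}v_\lambda^+$ is the value $T_t$ of the recursion
  $T_b = \sum_{a<b} \bigl(\prod_{a<k<b} c_k\bigr) E_{b,a} T_a$ started at $T_{\bar s} = v_\lambda^+$. A simple root vector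
  $E_{k,l}$ maps $T_l$ to $\pm c_l T_k$, where $c_t = 0$, and kills every other $T_b$.
\<close>

section \<open>The free algebra and its quotient\<close>

text \<open>The obstacle is that \<open>Lv \<nu>\<close>, the lifted annihilator of the highest
  weight vector, is given only by generators. To show that something lies outside it one needs a
  module, and vacua are available only for special weights. The bridge is that the coefficients of
  an element with respect to the chains are chosen once for all vacua, as polynomials in the highest
  weight; for an element of \<open>Lv \<nu>\<close> they can be chosen to vanish at \<nu>. The
  decomposition \<open>dec_all\<close> behind this works modulo any left ideal containing all
  \<open>e i j * x\<close> with \<open>i < j\<close> and \<open>x\<close> in U(h). It is applied to
  the common annihilator of all vacua, so that the polynomials do not depend on the vacuum. The
  constants c_k are tuned for a cancellation: for \<open>l < b\<close>, the summands of T_b that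
  start with \<open>e b k\<close> and \<open>e b l\<close> both turn under \<open>e k l\<close> into
  multiples of \<open>e b l\<close> T_k, and these are opposite precisely because
  \<open>e k l\<close> maps T_l to a sign times c_l T_k. The singular vector is nonzero because the
  chain through all intermediate indices has coefficient 1.\<close>

type_synonym falg = "supermatrix freemon \<Rightarrow>\<^sub>0 complex"

lemma poly_mapping_add_induct [case_names zero add]:
  assumes "P 0"
    and "\<And>w c f. c \<noteq> 0 \<Longrightarrow> w \<notin> Poly_Mapping.keys f \<Longrightarrow> P f \<Longrightarrow> P (Poly_Mapping.single w c + f)"
  shows "P f"
proof (induction f rule: update_induct)
  case const
  then show ?case by (rule assms(1))
next
  case (update f a b)
  have "Poly_Mapping.update a b f = Poly_Mapping.single a b + f"
    using update(1)
    by (intro poly_mapping_eqI)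
      (auto simp: lookup_update lookup_add lookup_single when_def in_keys_iff)
  then show ?case using assms(2)[of b a f] update by simp
qed

lemma const_mult_comm: "const c * f = f * const c"
proof (induction f rule: poly_mapping_add_induct)
  case (add w d f)
  have "Mon [] + w = w" "w + Mon [] = w"
    using add_0_left[of w] add_0_right[of w] by (simp_all only: zero_freemon_def)
  then show ?case using add by (simp add: distrib_left distrib_right const_def mult_single mult.commute)
qed simp

lemma const_add: "const (c + d) = const c + const d"
  by (simp add: const_def single_add)

lemma const_uminus: "const (- c) = - const c"
  by (simp add: const_def single_uminus)

lemma const_diff: "const (c - d) = const c - const d"
  by (simp add: const_def single_diff)

lemma const_mult: "const (c * d) = const c * const d"
  by (simp add: const_def mult_single plus_freemon_def)

lemma const_0 [simp]: "const 0 = 0"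
  by (simp add: const_def)

lemma const_1 [simp]: "const 1 = 1"
  unfolding const_def zero_freemon_def[symmetric] by simp

lemma const_sum: "const (sum f S) = (\<Sum>x\<in>S. const (f x))"
  by (induction S rule: infinite_finite_induct) (auto simp: const_add)

lemma const_mult_left_comm: "a * (const c * b) = const c * (a * b)"
  by (metis const_mult_comm mult.assoc)

lemma keys_free_mult:
  assumes "w \<in> Poly_Mapping.keys (f * g)"
  obtains u v where "u \<in> Poly_Mapping.keys f" "v \<in> Poly_Mapping.keys g" "w = u + v"
  using keys_mult[of f g] assms by auto

lemma free_alg_add_closed:
  "a \<in> carrier (free_alg A) \<Longrightarrow> b \<in> carrier (free_alg A) \<Longrightarrow> a + b \<in> carrier (free_alg A)"
  using Poly_Mapping.keys_add[of a b] by (auto simp: free_alg_def)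

lemma free_alg_uminus_closed: "a \<in> carrier (free_alg A) \<Longrightarrow> - a \<in> carrier (free_alg A)"
  by (auto simp: free_alg_def in_keys_iff)

lemma free_alg_diff_closed:
  "a \<in> carrier (free_alg A) \<Longrightarrow> b \<in> carrier (free_alg A) \<Longrightarrow> a - b \<in> carrier (free_alg A)"
  using free_alg_add_closed[of a A "- b"] free_alg_uminus_closed[of b A] by simp

lemma free_alg_mult_closed:
  "a \<in> carrier (free_alg A) \<Longrightarrow> b \<in> carrier (free_alg A) \<Longrightarrow> a * b \<in> carrier (free_alg A)"
  by (fastforce simp: free_alg_def plus_freemon_def elim: keys_free_mult)

lemma free_alg_const_closed: "const c \<in> carrier (free_alg A)"
  by (auto simp: free_alg_def const_def)

lemma free_alg_0_closed: "0 \<in> carrier (free_alg A)"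
  by (auto simp: free_alg_def)

lemma free_alg_1_closed: "1 \<in> carrier (free_alg A)"
  using free_alg_const_closed[of 1] by simp

lemma free_alg_gen_closed: "x \<in> A \<Longrightarrow> gen x \<in> carrier (free_alg A)"
  by (auto simp: free_alg_def gen_def)

lemma free_alg_sum_closed:
  "(\<And>x. x \<in> S \<Longrightarrow> f x \<in> carrier (free_alg A)) \<Longrightarrow> sum f S \<in> carrier (free_alg A)"
  by (induction S rule: infinite_finite_induct) (auto intro: free_alg_add_closed free_alg_0_closed)

lemmas free_alg_closed = free_alg_add_closed free_alg_uminus_closed free_alg_diff_closed
  free_alg_mult_closed free_alg_const_closed free_alg_0_closed free_alg_1_closed
  free_alg_gen_closed free_alg_sum_closed

lemma free_alg_ops [simp]:
  "monoid.mult (free_alg A) = (*)" "one (free_alg A) = 1" "zero (free_alg A) = 0" "add (free_alg A) = (+)"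
  by (simp_all add: free_alg_def)

lemma ring_free_alg: "ring (free_alg A)"
proof (rule ringI)
  show "abelian_group (free_alg A)"
  proof (rule abelian_groupI)
    show "\<exists>y\<in>carrier (free_alg A). y \<oplus>\<^bsub>free_alg A\<^esub> x = \<zero>\<^bsub>free_alg A\<^esub>" if "x \<in> carrier (free_alg A)" for x
      using that by (intro bexI[of _ "- x"]) (auto intro: free_alg_closed)
  qed (auto intro: free_alg_closed simp: algebra_simps)
  show "Group.monoid (free_alg A)"
    by (rule monoidI) (auto intro: free_alg_closed simp: algebra_simps)
qed (auto simp: algebra_simps)

lemma free_alg_a_inv:
  assumes "a \<in> carrier (free_alg A)"
  shows "\<ominus>\<^bsub>free_alg A\<^esub> a = - a"
proof -
  interpret ring "free_alg A" by (rule ring_free_alg)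
  have "- a \<in> carrier (free_alg A)" using assms by (rule free_alg_uminus_closed)
  then show ?thesis using minus_equality[of "- a" a] assms by simp
qed

lemma free_alg_a_minus:
  "a \<in> carrier (free_alg A) \<Longrightarrow> b \<in> carrier (free_alg A) \<Longrightarrow> a \<ominus>\<^bsub>free_alg A\<^esub> b = a - b"
  by (simp add: a_minus_def free_alg_a_inv)

text \<open>Words grow at the left end, which is the form that fits left ideals and left
  modules.\<close>

lemma free_alg_induct [consumes 1, case_names const add gen]:
  assumes "a \<in> carrier (free_alg A)"
    and "\<And>c. P (const c)"
    and "\<And>a b. a \<in> carrier (free_alg A) \<Longrightarrow> b \<in> carrier (free_alg A) \<Longrightarrow> P a \<Longrightarrow> P b \<Longrightarrow> P (a + b)"
    and "\<And>x a. x \<in> A \<Longrightarrow> a \<in> carrier (free_alg A) \<Longrightarrow> P a \<Longrightarrow> P (gen x * a)"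
  shows "P a"
proof -
  have word: "Poly_Mapping.single (Mon w) c \<in> carrier (free_alg A) \<and> P (Poly_Mapping.single (Mon w) c)"
    if "set w \<subseteq> A" for w c
    using that
  proof (induction w)
    case Nil
    then show ?case using assms(2)[of c] free_alg_const_closed by (auto simp: const_def)
  next
    case (Cons x w)
    have eq: "Poly_Mapping.single (Mon (x # w)) c = gen x * Poly_Mapping.single (Mon w) c"
      by (simp add: gen_def mult_single plus_freemon_def)
    show ?case unfolding eq using Cons assms(4) by (auto intro: free_alg_closed)
  qed
  show ?thesis using assms(1)
  proof (induction a rule: poly_mapping_add_induct)
    case zero
    then show ?case using assms(2)[of 0] by simp
  next
    case (add w c f)
    have k: "Poly_Mapping.keys (Poly_Mapping.single w c + f) = insert w (Poly_Mapping.keys f)"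
      using add(1,2) by (auto simp: in_keys_iff lookup_add lookup_single when_def split: if_splits)
    have "f \<in> carrier (free_alg A)" "set (letters w) \<subseteq> A"
      using add.prems by (simp_all add: free_alg_def k)
    then show ?case using word[of "letters w" c] add.IH by (auto intro: assms(3))
  qed
qed

section \<open>The enveloping algebra\<close>

locale super_gl = fixes m n :: nat
begin

abbreviation "Cf \<equiv> carrier (free_alg (gl m n))"
abbreviation "Uid \<equiv> U_ideal m n"
abbreviation "Ix \<equiv> idx m n"

definition e :: "int \<Rightarrow> int \<Rightarrow> falg" where "e i j = gen (munit i j)"

abbreviation cls :: "falg \<Rightarrow> env" where "cls a \<equiv> Uid +>\<^bsub>free_alg (gl m n)\<^esub> a"

lemma finite_Ix [simp]: "finite Ix"
  by (simp add: idx_def)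

lemma gl_0: "(\<lambda>i j. 0) \<in> gl m n"
  by (simp add: gl_def)

lemma gl_add: "X \<in> gl m n \<Longrightarrow> Y \<in> gl m n \<Longrightarrow> (\<lambda>i j. X i j + Y i j) \<in> gl m n"
  unfolding gl_def mem_Collect_eq by (metis add.right_neutral)

lemma gl_scale: "X \<in> gl m n \<Longrightarrow> (\<lambda>i j. c * X i j) \<in> gl m n"
  by (auto simp: gl_def)

lemma gl_munit: "i \<in> Ix \<Longrightarrow> j \<in> Ix \<Longrightarrow> munit i j \<in> gl m n"
  by (auto simp: gl_def munit_def)

lemma gl_part_munit: "i \<in> Ix \<Longrightarrow> j \<in> Ix \<Longrightarrow> munit i j \<in> gl_part m n ((par i + par j) mod 2)"
  by (auto simp: gl_part_def gl_munit) (auto simp: munit_def split: if_splits)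

lemma matmul_gl: "X \<in> gl m n \<Longrightarrow> Y \<in> gl m n \<Longrightarrow> matmul m n X Y \<in> gl m n"
proof -
  assume X: "X \<in> gl m n" and Y: "Y \<in> gl m n"
  have "matmul m n X Y i j = 0" if "i \<notin> Ix \<or> j \<notin> Ix" for i j
    unfolding matmul_def using X Y that by (intro sum.neutral) (auto simp: gl_def)
  then show ?thesis unfolding gl_def by blast
qed

lemma sbracket_gl: "X \<in> gl m n \<Longrightarrow> Y \<in> gl m n \<Longrightarrow> sbracket m n p q X Y \<in> gl m n"
  using gl_add[OF matmul_gl[of X Y] gl_scale[OF matmul_gl[of Y X], of "- ((-1)^(p*q))"]]
  by (simp add: sbracket_def)

lemma U_rels_closed: "U_rels m n \<subseteq> Cf"
  unfolding U_rels_def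
  by (auto simp: gl_part_def intro!: free_alg_closed gl_add gl_scale sbracket_gl)

lemma ideal_Uid: "ideal Uid (free_alg (gl m n))"
  unfolding U_ideal_def by (rule ring.genideal_ideal[OF ring_free_alg U_rels_closed])

lemma U_rels_Uid: "x \<in> U_rels m n \<Longrightarrow> x \<in> Uid"
  unfolding U_ideal_def using ring.genideal_self[OF ring_free_alg U_rels_closed] by blast

lemma Uid_Cf: "x \<in> Uid \<Longrightarrow> x \<in> Cf"
  using additive_subgroup.a_Hcarr[OF ideal.axioms(1)[OF ideal_Uid]] by blast

lemma Uid_0: "0 \<in> Uid"
  using additive_subgroup.zero_closed[OF ideal.axioms(1)[OF ideal_Uid]] by simp

lemma Uid_add: "x \<in> Uid \<Longrightarrow> y \<in> Uid \<Longrightarrow> x + y \<in> Uid"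
  using additive_subgroup.a_closed[OF ideal.axioms(1)[OF ideal_Uid], of x y] by simp

lemma Uid_uminus: "x \<in> Uid \<Longrightarrow> - x \<in> Uid"
  using ideal.I_l_closed[OF ideal_Uid, of x "- 1"] free_alg_uminus_closed[OF free_alg_1_closed, of "gl m n"] by simp

lemma Uid_diff: "x \<in> Uid \<Longrightarrow> y \<in> Uid \<Longrightarrow> x - y \<in> Uid"
  using Uid_add[OF _ Uid_uminus, of x y] by simp

lemma Uid_lmult: "x \<in> Uid \<Longrightarrow> c \<in> Cf \<Longrightarrow> c * x \<in> Uid"
  using ideal.I_l_closed[OF ideal_Uid, of x c] by simp

lemma Uid_rmult: "x \<in> Uid \<Longrightarrow> c \<in> Cf \<Longrightarrow> x * c \<in> Uid"
  using ideal.I_r_closed[OF ideal_Uid, of x c] by simp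

lemma e_Cf [simp]: "i \<in> Ix \<Longrightarrow> j \<in> Ix \<Longrightarrow> e i j \<in> Cf"
  by (simp add: e_def free_alg_gen_closed gl_munit)

lemma gen_add: "X \<in> gl m n \<Longrightarrow> Y \<in> gl m n \<Longrightarrow> gen (\<lambda>i j. X i j + Y i j) - gen X - gen Y \<in> Uid"
  by (rule U_rels_Uid) (auto simp: U_rels_def)

lemma gen_scale: "X \<in> gl m n \<Longrightarrow> gen (\<lambda>i j. c * X i j) - const c * gen X \<in> Uid"
  by (rule U_rels_Uid) (auto simp: U_rels_def)

lemma gen_bracket:
  "p < 2 \<Longrightarrow> q < 2 \<Longrightarrow> X \<in> gl_part m n p \<Longrightarrow> Y \<in> gl_part m n q \<Longrightarrow>
    gen X * gen Y - const ((-1) ^ (p * q)) * (gen Y * gen X) - gen (sbracket m n p q X Y) \<in> Uid"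
  by (rule U_rels_Uid) (unfold U_rels_def, blast)

lemma gen_0: "gen (\<lambda>i j. 0) \<in> Uid"
  using gen_scale[OF gl_0, of 0] by simp

lemma gl_sum: "(\<And>a. a \<in> S \<Longrightarrow> F a \<in> gl m n) \<Longrightarrow> (\<lambda>i j. \<Sum>a\<in>S. F a i j) \<in> gl m n"
  by (induction S rule: infinite_finite_induct) (auto intro: gl_0 gl_add)

lemma gen_sum:
  assumes "finite S" "\<And>a. a \<in> S \<Longrightarrow> F a \<in> gl m n"
  shows "gen (\<lambda>i j. \<Sum>a\<in>S. F a i j) - (\<Sum>a\<in>S. gen (F a)) \<in> Uid"
  using assms
proof (induction S rule: finite_induct)
  case empty
  then show ?case using gen_0 by simp
next
  case (insert x S)
  have "gen (\<lambda>i j. F x i j + (\<Sum>a\<in>S. F a i j)) - gen (F x) - gen (\<lambda>i j. \<Sum>a\<in>S. F a i j) \<in> Uid"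
    using insert.prems by (intro gen_add gl_sum) auto
  then have "(gen (\<lambda>i j. F x i j + (\<Sum>a\<in>S. F a i j)) - gen (F x) - gen (\<lambda>i j. \<Sum>a\<in>S. F a i j))
      + (gen (\<lambda>i j. \<Sum>a\<in>S. F a i j) - (\<Sum>a\<in>S. gen (F a))) \<in> Uid"
    using insert by (intro Uid_add) auto
  then show ?case using insert.hyps by (simp add: algebra_simps)
qed

lemma Uid_sum: "(\<And>x. x \<in> S \<Longrightarrow> f x \<in> Uid) \<Longrightarrow> sum f S \<in> Uid"
  by (induction S rule: infinite_finite_induct) (auto intro: Uid_0 Uid_add)

text \<open>Every matrix is a free generator; this congruence reduces all computations to the matrix
  units.\<close>

lemma gen_expand:
  assumes "X \<in> gl m n"
  shows "gen X - (\<Sum>i\<in>Ix. \<Sum>j\<in>Ix. const (X i j) * e i j) \<in> Uid"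
proof -
  let ?S = "Ix \<times> Ix"
  let ?F = "\<lambda>(k, l) i j. X k l * munit k l i j"
  have F: "?F a \<in> gl m n" if "a \<in> ?S" for a
    using that by (auto intro!: gl_scale gl_munit)
  have "(\<Sum>a\<in>?S. ?F a i j) = X i j" for i j
  proof (cases "i \<in> Ix \<and> j \<in> Ix")
    case True
    have "(\<Sum>a\<in>?S. ?F a i j) = (\<Sum>a\<in>?S. if a = (i, j) then X i j else 0)"
      by (rule sum.cong) (auto simp: munit_def split: if_splits)
    then show ?thesis using True by (simp add: sum.delta)
  next
    case False
    then have "X i j = 0" using assms by (auto simp: gl_def)
    moreover have "?F a i j = 0" if "a \<in> ?S" for a
      using False that by (auto simp: munit_def)
    ultimately show ?thesis by simp
  qed
  then have "X = (\<lambda>i j. \<Sum>a\<in>?S. ?F a i j)" by (simp add: fun_eq_iff)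
  then have 1: "gen X - (\<Sum>a\<in>?S. gen (?F a)) \<in> Uid"
    using gen_sum[of ?S ?F] F by simp
  have "(\<Sum>a\<in>?S. gen (?F a)) - (\<Sum>(i, j)\<in>?S. const (X i j) * e i j) \<in> Uid"
    unfolding sum_subtractf[symmetric] e_def
    by (rule Uid_sum) (auto intro!: gen_scale gl_munit)
  from Uid_add[OF 1 this] show ?thesis
    by (simp add: sum.cartesian_product algebra_simps)
qed

definition par2 :: "int \<Rightarrow> int \<Rightarrow> nat" where "par2 i j = (par i + par j) mod 2"

text \<open>The Koszul sign of a pair of matrix units.\<close>

definition sgn2 :: "int \<Rightarrow> int \<Rightarrow> int \<Rightarrow> int \<Rightarrow> complex" where
  "sgn2 i j k l = (-1) ^ (par2 i j * par2 k l)"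

lemma e_bracket:
  assumes "i \<in> Ix" "j \<in> Ix" "k \<in> Ix" "l \<in> Ix"
  shows "e i j * e k l - const (sgn2 i j k l) * (e k l * e i j)
     - ((if j = k then e i l else 0) - (if i = l then const (sgn2 i j k l) * e k j else 0)) \<in> Uid"
proof -
  let ?s = "sgn2 i j k l"
  have m1: "matmul m n (munit i j) (munit k l) = (\<lambda>a b. if j = k then munit i l a b else 0)"
    if "j \<in> Ix" "k \<in> Ix" for i j k l
  proof (intro ext)
    fix a b
    have "matmul m n (munit i j) (munit k l) a b
        = (\<Sum>x\<in>Ix. if x = j then (if j = k then munit i l a b else 0) else 0)"
      unfolding matmul_def by (rule sum.cong) (auto simp: munit_def)
    then show "matmul m n (munit i j) (munit k l) a b = (if j = k then munit i l a b else 0)"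
      using that by (simp add: sum.delta)
  qed
  let ?A = "\<lambda>a b. if j = k then munit i l a b else 0"
  let ?B = "\<lambda>a b. if i = l then munit k j a b else 0"
  have A: "?A \<in> gl m n" and B: "?B \<in> gl m n"
    by (cases "j = k"; cases "i = l"; use assms in \<open>simp add: gl_0 gl_munit\<close>)+
  have br: "sbracket m n (par2 i j) (par2 k l) (munit i j) (munit k l) = (\<lambda>a b. ?A a b + (- ?s) * ?B a b)"
    unfolding sbracket_def m1[OF assms(2,3)] m1[OF assms(4,1)] by (auto simp: sgn2_def fun_eq_iff)
  have gA: "gen ?A - (if j = k then e i l else 0) \<in> Uid"
    using gen_0 Uid_0 by (auto simp: e_def)
  have gB: "gen ?B - (if i = l then e k j else 0) \<in> Uid"
    using gen_0 Uid_0 by (auto simp: e_def)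
  have "gen (\<lambda>a b. ?A a b + (- ?s) * ?B a b) - gen ?A - gen (\<lambda>a b. (- ?s) * ?B a b) \<in> Uid"
    by (intro gen_add A gl_scale B)
  moreover have "gen (\<lambda>a b. (- ?s) * ?B a b) - const (- ?s) * gen ?B \<in> Uid"
    by (intro gen_scale B)
  moreover have "const (- ?s) * (gen ?B - (if i = l then e k j else 0)) \<in> Uid"
    by (intro Uid_lmult gB free_alg_closed)
  moreover have "e i j * e k l - const ?s * (e k l * e i j) - gen (\<lambda>a b. ?A a b + (- ?s) * ?B a b) \<in> Uid"
    using gen_bracket[of "par2 i j" "par2 k l" "munit i j" "munit k l"] assms
    unfolding br by (simp add: par2_def gl_part_munit sgn2_def e_def)
  ultimately have "(e i j * e k l - const ?s * (e k l * e i j) - gen (\<lambda>a b. ?A a b + (- ?s) * ?B a b)) +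
     ((gen (\<lambda>a b. ?A a b + (- ?s) * ?B a b) - gen ?A - gen (\<lambda>a b. (- ?s) * ?B a b)) +
      ((gen (\<lambda>a b. (- ?s) * ?B a b) - const (- ?s) * gen ?B) +
       (const (- ?s) * (gen ?B - (if i = l then e k j else 0)) +
       (gen ?A - (if j = k then e i l else 0))))) \<in> Uid"
    using gA by (intro Uid_add)
  moreover have "const ?s * (if i = l then e k j else 0) = (if i = l then const ?s * e k j else 0)" by simp
  ultimately show ?thesis by (simp add: algebra_simps const_uminus)
qed

end

section \<open>A Fock space representation\<close>

definition lin :: "(('s \<Rightarrow> complex) \<Rightarrow> 's \<Rightarrow> complex) \<Rightarrow> bool" where
  "lin F \<longleftrightarrow> (\<forall>f g. F (\<lambda>S. f S + g S) = (\<lambda>S. F f S + F g S)) \<and> (\<forall>c f. F (\<lambda>S. c * f S) = (\<lambda>S. c * F f S))"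

lemma lin_add: "lin F \<Longrightarrow> F (\<lambda>S. f S + g S) = (\<lambda>S. F f S + F g S)"
  and lin_scale: "lin F \<Longrightarrow> F (\<lambda>S. c * f S) = (\<lambda>S. c * F f S)"
  by (simp_all add: lin_def)

lemma lin_zero: "lin F \<Longrightarrow> F (\<lambda>S. 0) = (\<lambda>S. 0)"
  using lin_scale[of F 0 "\<lambda>S. 0"] by simp

lemma lin_sum: "lin F \<Longrightarrow> F (\<lambda>S. \<Sum>x\<in>A. f x S) = (\<lambda>S. \<Sum>x\<in>A. F (f x) S)"
proof (induction A rule: infinite_finite_induct)
  case (insert x A)
  then show ?case using lin_add[of F "f x" "\<lambda>S. \<Sum>x\<in>A. f x S"] by simp
qed (simp_all add: lin_zero)

lemma lin_comp: "lin F \<Longrightarrow> lin G \<Longrightarrow> lin (\<lambda>f. F (G f))"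
  by (simp add: lin_def)

lemma lin_sumI: "(\<And>x. x \<in> A \<Longrightarrow> lin (F x)) \<Longrightarrow> lin (\<lambda>f S. \<Sum>x\<in>A. F x f S)"
  by (auto simp: lin_def sum.distrib sum_distrib_left)

lemma lin_scaleI: "lin F \<Longrightarrow> lin (\<lambda>f S. c * F f S)"
  by (auto simp: lin_def algebra_simps)

text \<open>A mode \<open>((l, r), i)\<close> is the basis vector of index \<open>i\<close> in the \<open>r\<close>-th copy of the colour \<open>l\<close>.
  A colour with \<open>l < 0\<close> has fermionic barred and bosonic unbarred modes, a colour with \<open>l > 0\<close> the
  opposite statistics.\<close>

type_synonym mode = "(int \<times> nat) \<times> int"
type_synonym cfg = "mode \<Rightarrow> nat"

definition ferm :: "mode \<Rightarrow> bool" where "ferm p \<longleftrightarrow> (fst (fst p) < 0) = (snd p < 0)"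

definition fsgn :: "mode \<Rightarrow> mode \<Rightarrow> complex" where "fsgn p q = (if ferm p \<and> ferm q then -1 else 1)"

text \<open>Fermionic occupation numbers are read modulo 2, so that both statistics can share the
  type \<open>nat\<close>. Toggling the parity in this way is an involution of all of
  \<open>nat\<close>.\<close>

definition flip :: "nat \<Rightarrow> nat" where "flip k = (if even k then Suc k else k - 1)"

lemma odd_flip [simp]: "odd (flip k) = even k" "even (flip k) = odd k"
  by (auto simp: flip_def)

lemma flip_flip [simp]: "flip (flip k) = k"
  by (auto simp: flip_def)

text \<open>For \<open>l < 0\<close> the bosonic modes carry multiplication by and derivation with respect to a
  variable; for \<open>l > 0\<close> these are exchanged up to sign, so that all creation operators of
  bosonic modes annihilate the constants.\<close>

definition ua :: "mode \<Rightarrow> nat \<Rightarrow> complex" where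
  "ua p k = (if ferm p then of_bool (odd k) else if fst (fst p) < 0 then of_bool (0 < k) else of_nat (Suc k))"
definition ug :: "mode \<Rightarrow> nat \<Rightarrow> nat" where
  "ug p k = (if ferm p then flip k else if fst (fst p) < 0 then k - 1 else Suc k)"
definition da :: "mode \<Rightarrow> nat \<Rightarrow> complex" where
  "da p k = (if ferm p then of_bool (even k) else if fst (fst p) < 0 then of_nat (Suc k) else - of_bool (0 < k))"
definition dg :: "mode \<Rightarrow> nat \<Rightarrow> nat" where
  "dg p k = (if ferm p then flip k else if fst (fst p) < 0 then Suc k else k - 1)"

text \<open>The vector space consists of all functions on configurations, so that every ladder operator is
  a weighted pull-back. \<open>N l\<close> is the number of copies of the colour \<open>l\<close>.\<close>

locale fock = super_gl +
  fixes N :: "int \<Rightarrow> nat"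
begin

definition colours :: "(int \<times> nat) set" where "colours = (SIGMA l:Ix. {..<N l})"

definition modes :: "mode set" where "modes = colours \<times> Ix"

lemma finite_colours [simp]: "finite colours"
  by (simp add: colours_def)

lemma finite_modes [simp]: "finite modes"
  by (simp add: modes_def)

text \<open>Jordan--Wigner sign, which makes the fermionic operators of different modes anticommute.\<close>

definition jw :: "cfg \<Rightarrow> mode \<Rightarrow> complex" where
  "jw S p = (\<Prod>q\<in>{q \<in> modes. ferm q \<and> q < p}. (-1) ^ S q)"

lemma jw_sq: "jw S p * jw S p = 1"
  unfolding jw_def prod.distrib[symmetric] by (simp add: power_mult_distrib[symmetric])

lemma jw_sq_left: "jw S p * (jw S p * x) = x"
  using jw_sq[of S p] by (simp add: mult.assoc[symmetric])

lemma jw_upd: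
  "jw (S(p := k)) q = (if p \<in> modes \<and> ferm p \<and> p < q \<and> odd (k + S p) then - jw S q else jw S q)"
proof (cases "p \<in> modes \<and> ferm p \<and> p < q")
  case True
  let ?A = "{q' \<in> modes. ferm q' \<and> q' < q}"
  have pA: "p \<in> ?A" using True by simp
  have "jw (S(p := k)) q = (-1) ^ k * (\<Prod>q'\<in>?A - {p}. (-1) ^ S q')"
    unfolding jw_def by (subst prod.remove[OF _ pA]) (auto intro!: prod.cong)
  moreover have "jw S q = (-1) ^ S p * (\<Prod>q'\<in>?A - {p}. (-1) ^ S q')"
    unfolding jw_def by (subst prod.remove[OF _ pA]) auto
  ultimately show ?thesis using True by (auto simp: uminus_power_if)
next
  case False
  then have "jw (S(p := k)) q = jw S q"
    unfolding jw_def by (intro prod.cong) auto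
  then show ?thesis using False by auto
qed

definition mop :: "mode \<Rightarrow> (nat \<Rightarrow> complex) \<Rightarrow> (nat \<Rightarrow> nat) \<Rightarrow> (cfg \<Rightarrow> complex) \<Rightarrow> cfg \<Rightarrow> complex" where
  "mop p a g f S = (if ferm p then jw S p else 1) * (a (S p) * f (S(p := g (S p))))"

lemma lin_mop: "lin (mop p a g)"
  by (auto simp: lin_def mop_def algebra_simps)

text \<open>The two pull-backs change different coordinates and hence commute. Exactly one of
  \<open>p < q\<close> and \<open>q < p\<close> holds, so for two fermions exactly one of the two
  Jordan--Wigner signs is reversed by the other operator; this uses that \<open>flip\<close> changes
  the parity.\<close>

lemma mop_swap:
  assumes "p \<noteq> q" "p \<in> modes" "q \<in> modes"
    and "ferm p \<Longrightarrow> g = flip" and "ferm q \<Longrightarrow> h = flip"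
  shows "mop p a g (mop q b h f) S = fsgn p q * mop q b h (mop p a g f) S"
proof -
  have upd: "S(p := x, q := y) = S(q := y, p := x)" for x y
    using assms(1) by (auto simp: fun_eq_iff)
  have "odd (flip k + k)" for k by simp
  moreover have "p < q \<or> q < p" using assms(1) by auto
  ultimately show ?thesis
    using assms unfolding mop_def fsgn_def by (auto simp: jw_upd upd)
qed

definition up :: "mode \<Rightarrow> (cfg \<Rightarrow> complex) \<Rightarrow> cfg \<Rightarrow> complex" where "up p = mop p (ua p) (ug p)"
definition dn :: "mode \<Rightarrow> (cfg \<Rightarrow> complex) \<Rightarrow> cfg \<Rightarrow> complex" where "dn p = mop p (da p) (dg p)"

lemma lin_up: "lin (up p)" and lin_dn: "lin (dn p)"
  by (simp_all add: up_def dn_def lin_mop)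

lemma flip_ud: "ferm p \<Longrightarrow> ug p = flip" "ferm p \<Longrightarrow> dg p = flip"
  by (auto simp: ug_def dg_def)

lemma up_up:
  assumes "p \<in> modes" "q \<in> modes"
  shows "up p (up q f) = (\<lambda>S. fsgn p q * up q (up p f) S)"
proof (cases "p = q")
  case True
  \<comment> \<open>For a fermion the square is zero, because \<open>flip\<close> reverses the
    parity tested by \<open>ua\<close>; for a boson the sign is 1.\<close>
  show ?thesis
    by (cases "ferm q") (auto simp: True up_def mop_def fsgn_def ua_def ug_def)
next
  case False
  then show ?thesis unfolding up_def using assms by (auto intro!: mop_swap flip_ud)
qed

lemma dn_dn:
  assumes "p \<in> modes" "q \<in> modes"
  shows "dn p (dn q f) = (\<lambda>S. fsgn p q * dn q (dn p f) S)"
proof (cases "p = q")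
  case True
  show ?thesis
    by (cases "ferm q") (auto simp: True dn_def mop_def fsgn_def da_def dg_def)
next
  case False
  then show ?thesis unfolding dn_def using assms by (auto intro!: mop_swap flip_ud)
qed

text \<open>The canonical commutation relations for bosons and anticommutation relations for
  fermions.\<close>

lemma dn_up:
  assumes "p \<in> modes" "q \<in> modes"
  shows "dn p (up q f) = (\<lambda>S. of_bool (p = q) * f S + fsgn p q * up q (dn p f) S)"
proof (cases "p = q")
  case True
  show ?thesis
  proof (rule ext)
    fix S
    show "dn p (up q f) S = of_bool (p = q) * f S + fsgn p q * up q (dn p f) S"
    proof (cases "ferm q")
      case f: True
      have "jw (S(q := k)) q = jw S q" for k by (simp add: jw_upd)
      then show ?thesis
        unfolding True dn_def up_def mop_def fsgn_def ua_def ug_def da_def dg_def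
        using f by (cases "even (S q)") (simp_all add: jw_sq_left)
    next
      case f: False
      then show ?thesis
        unfolding True dn_def up_def mop_def fsgn_def ua_def ug_def da_def dg_def
        \<comment> \<open>The configuration value 0 is separate because the shift
          \<open>k - 1\<close> is truncated there.\<close>
        by (cases "S q") (simp_all add: fun_upd_idem algebra_simps)
    qed
  qed
next
  case False
  then show ?thesis unfolding up_def dn_def using assms by (auto intro!: mop_swap flip_ud)
qed

definition T :: "mode \<Rightarrow> mode \<Rightarrow> (cfg \<Rightarrow> complex) \<Rightarrow> cfg \<Rightarrow> complex" where "T p q f = up p (dn q f)"

lemma lin_T: "lin (T p q)"
  unfolding T_def[abs_def] using lin_comp[OF lin_up[of p] lin_dn[of q]] .

lemma T_T:
  assumes "p \<in> modes" "q \<in> modes" "r \<in> modes" "s \<in> modes"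
  shows "T p q (T r s f) S = of_bool (q = r) * T p s f S + fsgn q r * up p (up r (dn q (dn s f))) S"
  unfolding T_def dn_up[OF assms(2,3)]
  by (simp add: lin_add[OF lin_up] lin_scale[OF lin_up])

text \<open>After normal ordering by \<open>T_T\<close>, the two quartic terms agree up to the sign
  \<epsilon>, by \<open>up_up\<close> and \<open>dn_dn\<close>. They cancel, and the contractions
  remain.\<close>

lemma T_bracket:
  assumes "p \<in> modes" "q \<in> modes" "r \<in> modes" "s \<in> modes"
    and "\<epsilon> = (if ferm p \<noteq> ferm q \<and> ferm r \<noteq> ferm s then -1 else 1)"
  shows "T p q (T r s f) S - \<epsilon> * T r s (T p q f) S
    = of_bool (q = r) * T p s f S - \<epsilon> * (of_bool (s = p) * T r q f S)"
proof -
  have "up r (up p (dn s (dn q f))) S = fsgn r p * (fsgn s q * up p (up r (dn q (dn s f))) S)"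
    unfolding dn_dn[OF assms(4,2)] up_up[OF assms(3,1)] by (simp add: lin_scale[OF lin_up])
  then show ?thesis
    unfolding T_T[OF assms(1-4)] T_T[OF assms(3,4,1,2)] using assms(5)
    by (cases "ferm p"; cases "ferm q"; cases "ferm r"; cases "ferm s") (simp_all add: fsgn_def algebra_simps)
qed

text \<open>The oscillator realization of a matrix unit, added up over all tensor factors.\<close>

definition Op :: "int \<Rightarrow> int \<Rightarrow> (cfg \<Rightarrow> complex) \<Rightarrow> cfg \<Rightarrow> complex" where
  "Op i j f S = (\<Sum>c\<in>colours. T (c, i) (c, j) f S)"

lemma lin_Op: "lin (Op i j)"
  unfolding Op_def[abs_def] by (intro lin_sumI lin_T)

lemma par2_eq: "par2 i j = (if (i < 0) = (j < 0) then 0 else 1)"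
  by (simp add: par2_def par_def)

text \<open>For every colour, \<open>ferm\<close> differs at the indices \<open>i\<close> and
  \<open>j\<close> exactly when one of them is barred and the other is not. The sign in
  \<open>T_bracket\<close> is therefore the same for all colours, and only pairs of equal colours
  leave a contraction.\<close>

lemma Op_bracket:
  assumes "i \<in> Ix" "j \<in> Ix" "k \<in> Ix" "l \<in> Ix"
  shows "Op i j (Op k l f) S - sgn2 i j k l * Op k l (Op i j f) S
    = of_bool (j = k) * Op i l f S - sgn2 i j k l * (of_bool (i = l) * Op k j f S)"
proof -
  let ?s = "sgn2 i j k l"
  have "Op i j (Op k l f) S = (\<Sum>c\<in>colours. \<Sum>d\<in>colours. T (c, i) (c, j) (T (d, k) (d, l) f) S)"
    unfolding Op_def[abs_def] lin_sum[OF lin_T] ..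
  moreover have "Op k l (Op i j f) S = (\<Sum>c\<in>colours. \<Sum>d\<in>colours. T (d, k) (d, l) (T (c, i) (c, j) f) S)"
    unfolding Op_def[abs_def] lin_sum[OF lin_T] by (rule sum.swap)
  ultimately have "Op i j (Op k l f) S - ?s * Op k l (Op i j f) S
     = (\<Sum>c\<in>colours. \<Sum>d\<in>colours. T (c, i) (c, j) (T (d, k) (d, l) f) S - ?s * T (d, k) (d, l) (T (c, i) (c, j) f) S)"
    by (simp add: sum_subtractf sum_distrib_left)
  also have "\<dots> = (\<Sum>c\<in>colours. \<Sum>d\<in>colours. of_bool ((c, j) = (d, k)) * T (c, i) (d, l) f S
      - ?s * (of_bool ((d, l) = (c, i)) * T (d, k) (c, j) f S))"
    using assms
    by (intro sum.cong refl T_bracket) (auto simp: modes_def sgn2_def par2_eq ferm_def)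
  also have "\<dots> = (\<Sum>c\<in>colours. \<Sum>d\<in>colours. if c = d then of_bool (j = k) * T (c, i) (c, l) f S
      - ?s * (of_bool (i = l) * T (c, k) (c, j) f S) else 0)"
    by (intro sum.cong refl) auto
  also have "\<dots> = (\<Sum>c\<in>colours. of_bool (j = k) * T (c, i) (c, l) f S
      - ?s * (of_bool (i = l) * T (c, k) (c, j) f S))"
    by (intro sum.cong refl) (simp add: sum.delta)
  finally show ?thesis by (simp add: Op_def sum_subtractf sum_distrib_left)
qed

section \<open>Extension of the oscillator action to the free algebra\<close>

definition opm :: "supermatrix \<Rightarrow> (cfg \<Rightarrow> complex) \<Rightarrow> cfg \<Rightarrow> complex" where
  "opm X f S = (\<Sum>i\<in>Ix. \<Sum>j\<in>Ix. X i j * Op i j f S)"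

lemma lin_opm: "lin (opm X)"
  unfolding opm_def[abs_def] by (intro lin_sumI lin_scaleI lin_Op)

definition act :: "falg \<Rightarrow> (cfg \<Rightarrow> complex) \<Rightarrow> cfg \<Rightarrow> complex" where
  "act a f S = (\<Sum>w\<in>Poly_Mapping.keys a. Poly_Mapping.lookup a w * foldr opm (letters w) f S)"

lemma lin_foldr: "lin (foldr opm ws)"
proof (induction ws)
  case (Cons w ws)
  then show ?case using lin_comp[OF lin_opm[of w] Cons] by (simp add: comp_def)
qed (simp add: lin_def)

lemma lin_act: "lin (act a)"
  unfolding act_def[abs_def] by (intro lin_sumI lin_scaleI lin_foldr)

lemma act_add: "act (a + b) f S = act a f S + act b f S"
proof -
  let ?K = "Poly_Mapping.keys a \<union> Poly_Mapping.keys b"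
  have ext: "act c f S = (\<Sum>w\<in>?K. Poly_Mapping.lookup c w * foldr opm (letters w) f S)"
    if "Poly_Mapping.keys c \<subseteq> ?K" for c
    unfolding act_def by (rule sum.mono_neutral_left) (use that in \<open>auto simp: in_keys_iff\<close>)
  show ?thesis
    using Poly_Mapping.keys_add[of a b]
    by (simp add: ext lookup_add sum.distrib[symmetric] distrib_right)
qed

lemma act_0 [simp]: "act 0 f S = 0"
  by (simp add: act_def)

lemma act_uminus: "act (- a) f S = - act a f S"
  using act_add[of a "- a" f S] by (simp add: eq_neg_iff_add_eq_0 add.commute)

lemma act_diff: "act (a - b) f S = act a f S - act b f S"
  using act_add[of a "- b" f S] act_uminus[of b f S] by simp

lemma act_sum: "act (sum a A) f S = (\<Sum>x\<in>A. act (a x) f S)"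
  by (induction A rule: infinite_finite_induct) (simp_all add: act_add)

lemma act_single: "act (Poly_Mapping.single w c) f S = c * foldr opm (letters w) f S"
  by (cases "c = 0") (simp_all add: act_def)

lemma act_mult: "act (a * b) f = act a (act b f)"
proof -
  have 1: "act (Poly_Mapping.single w c * b) f S = c * foldr opm (letters w) (act b f) S" for w c S
  proof (induction b rule: poly_mapping_add_induct)
    case zero
    then show ?case by (simp add: lin_zero[OF lin_foldr] act_def[abs_def])
  next
    case (add v d b)
    have "act (Poly_Mapping.single v d + b) f = (\<lambda>S. d * foldr opm (letters v) f S + act b f S)"
      by (simp add: fun_eq_iff act_add act_single)
    then show ?case using add.IH
      by (simp add: distrib_left act_add mult_single act_single plus_freemon_def
          lin_add[OF lin_foldr] lin_scale[OF lin_foldr])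
  qed
  show ?thesis
  proof (rule ext, induction a rule: poly_mapping_add_induct)
    case (add w c a)
    then show ?case by (simp add: distrib_right act_add 1 act_single)
  qed simp
qed

lemma act_const [simp]: "act (const c) f S = c * f S"
  by (simp add: const_def act_single)

lemma act_gen: "act (gen X) f = opm X f"
  by (simp add: gen_def act_single fun_eq_iff)

lemma act_e: "i \<in> Ix \<Longrightarrow> j \<in> Ix \<Longrightarrow> act (e i j) f = Op i j f"
proof (rule ext)
  fix S assume i: "i \<in> Ix" and j: "j \<in> Ix"
  have "opm (munit i j) f S = (\<Sum>k\<in>Ix. if k = i then \<Sum>l\<in>Ix. if l = j then Op i j f S else 0 else 0)"
    unfolding opm_def
    by (rule sum.cong) (auto simp: munit_def if_distrib[of "\<lambda>x. x * _"] cong: if_cong)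
  then show "act (e i j) f S = Op i j f S"
    using i j by (simp add: e_def act_gen)
qed

text \<open>Bilinear extension of \<open>Op_bracket\<close>. Homogeneity of \<open>X\<close> and
  \<open>Y\<close> makes the sign constant where the product of coefficients is nonzero; elsewhere
  the summand vanishes.\<close>

lemma opm_sbracket:
  assumes p: "p < 2" "q < 2" and X: "X \<in> gl_part m n p" and Y: "Y \<in> gl_part m n q"
  shows "opm (sbracket m n p q X Y) f S = opm X (opm Y f) S - (-1) ^ (p * q) * opm Y (opm X f) S"
proof -
  let ?s = "(-1) ^ (p * q) :: complex"
  define B where "B i j k l = X i j * Y k l" for i j k l
  have XY: "opm X (opm Y f) S = (\<Sum>i\<in>Ix. \<Sum>j\<in>Ix. \<Sum>k\<in>Ix. \<Sum>l\<in>Ix. B i j k l * Op i j (Op k l f) S)"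
    if "\<And>i j k l. B i j k l = X i j * Y k l" for X Y B
    unfolding opm_def[abs_def] lin_sum[OF lin_Op] lin_scale[OF lin_Op] sum_distrib_left
    by (simp add: that mult.assoc)
  have 1: "opm X (opm Y f) S = (\<Sum>i\<in>Ix. \<Sum>j\<in>Ix. \<Sum>k\<in>Ix. \<Sum>l\<in>Ix. B i j k l * Op i j (Op k l f) S)"
    by (rule XY) (simp add: B_def)
  have "opm Y (opm X f) S = (\<Sum>k\<in>Ix. \<Sum>l\<in>Ix. \<Sum>i\<in>Ix. \<Sum>j\<in>Ix. B i j k l * Op k l (Op i j f) S)"
    by (rule XY) (simp add: B_def mult.commute)
  also have "\<dots> = (\<Sum>k\<in>Ix. \<Sum>i\<in>Ix. \<Sum>l\<in>Ix. \<Sum>j\<in>Ix. B i j k l * Op k l (Op i j f) S)"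
    by (intro sum.cong refl sum.swap)
  also have "\<dots> = (\<Sum>i\<in>Ix. \<Sum>k\<in>Ix. \<Sum>l\<in>Ix. \<Sum>j\<in>Ix. B i j k l * Op k l (Op i j f) S)"
    by (rule sum.swap)
  also have "\<dots> = (\<Sum>i\<in>Ix. \<Sum>k\<in>Ix. \<Sum>j\<in>Ix. \<Sum>l\<in>Ix. B i j k l * Op k l (Op i j f) S)"
    by (intro sum.cong refl sum.swap)
  also have "\<dots> = (\<Sum>i\<in>Ix. \<Sum>j\<in>Ix. \<Sum>k\<in>Ix. \<Sum>l\<in>Ix. B i j k l * Op k l (Op i j f) S)"
    by (intro sum.cong refl sum.swap)
  finally have 2: "opm Y (opm X f) S = (\<Sum>i\<in>Ix. \<Sum>j\<in>Ix. \<Sum>k\<in>Ix. \<Sum>l\<in>Ix. B i j k l * Op k l (Op i j f) S)" .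
  have sgn: "B i j k l \<noteq> 0 \<Longrightarrow> ?s = sgn2 i j k l" for i j k l
    using X Y p by (auto simp: B_def gl_part_def sgn2_def par2_def)
  have "opm X (opm Y f) S - ?s * opm Y (opm X f) S
     = (\<Sum>i\<in>Ix. \<Sum>j\<in>Ix. \<Sum>k\<in>Ix. \<Sum>l\<in>Ix. B i j k l * (Op i j (Op k l f) S - ?s * Op k l (Op i j f) S))"
    unfolding 1 2 by (simp add: sum_subtractf sum_distrib_left algebra_simps)
  also have "\<dots> = (\<Sum>i\<in>Ix. \<Sum>j\<in>Ix. \<Sum>k\<in>Ix. \<Sum>l\<in>Ix. B i j k l * (of_bool (j = k) * Op i l f S
       - ?s * (of_bool (i = l) * Op k j f S)))"
    by (intro sum.cong refl) (metis sgn Op_bracket mult_zero_left)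
  also have "\<dots> = (\<Sum>i\<in>Ix. \<Sum>j\<in>Ix. \<Sum>k\<in>Ix. \<Sum>l\<in>Ix. B i j k l * (of_bool (j = k) * Op i l f S))
     - (\<Sum>i\<in>Ix. \<Sum>j\<in>Ix. \<Sum>k\<in>Ix. \<Sum>l\<in>Ix. B i j k l * (?s * (of_bool (i = l) * Op k j f S)))"
    by (simp add: sum_subtractf right_diff_distrib)
  also have "(\<Sum>i\<in>Ix. \<Sum>j\<in>Ix. \<Sum>k\<in>Ix. \<Sum>l\<in>Ix. B i j k l * (of_bool (j = k) * Op i l f S))
     = (\<Sum>i\<in>Ix. \<Sum>l\<in>Ix. matmul m n X Y i l * Op i l f S)"
  proof (rule sum.cong[OF refl])
    fix i assume i: "i \<in> Ix"
    have "(\<Sum>j\<in>Ix. \<Sum>k\<in>Ix. \<Sum>l\<in>Ix. B i j k l * (of_bool (j = k) * Op i l f S))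
      = (\<Sum>j\<in>Ix. \<Sum>k\<in>Ix. if k = j then \<Sum>l\<in>Ix. B i j j l * Op i l f S else 0)"
      by (rule sum.cong[OF refl], rule sum.cong[OF refl]) auto
    also have "\<dots> = (\<Sum>j\<in>Ix. \<Sum>l\<in>Ix. B i j j l * Op i l f S)"
      by (rule sum.cong[OF refl]) simp
    also have "\<dots> = (\<Sum>l\<in>Ix. \<Sum>j\<in>Ix. B i j j l * Op i l f S)" by (rule sum.swap)
    finally show "(\<Sum>j\<in>Ix. \<Sum>k\<in>Ix. \<Sum>l\<in>Ix. B i j k l * (of_bool (j = k) * Op i l f S))
      = (\<Sum>l\<in>Ix. matmul m n X Y i l * Op i l f S)"
      by (simp add: matmul_def B_def sum_distrib_right)
  qed
  also have "(\<Sum>i\<in>Ix. \<Sum>j\<in>Ix. \<Sum>k\<in>Ix. \<Sum>l\<in>Ix. B i j k l * (?s * (of_bool (i = l) * Op k j f S)))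
     = (\<Sum>k\<in>Ix. \<Sum>j\<in>Ix. ?s * matmul m n Y X k j * Op k j f S)"
  proof -
    have "(\<Sum>i\<in>Ix. \<Sum>j\<in>Ix. \<Sum>k\<in>Ix. \<Sum>l\<in>Ix. B i j k l * (?s * (of_bool (i = l) * Op k j f S)))
      = (\<Sum>i\<in>Ix. \<Sum>j\<in>Ix. \<Sum>k\<in>Ix. \<Sum>l\<in>Ix. if l = i then B i j k i * (?s * Op k j f S) else 0)"
      by (intro sum.cong refl) auto
    also have "\<dots> = (\<Sum>i\<in>Ix. \<Sum>j\<in>Ix. \<Sum>k\<in>Ix. B i j k i * (?s * Op k j f S))"
      by (intro sum.cong refl) simp
    also have "\<dots> = (\<Sum>i\<in>Ix. \<Sum>k\<in>Ix. \<Sum>j\<in>Ix. B i j k i * (?s * Op k j f S))"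
      by (intro sum.cong refl sum.swap)
    also have "\<dots> = (\<Sum>k\<in>Ix. \<Sum>i\<in>Ix. \<Sum>j\<in>Ix. B i j k i * (?s * Op k j f S))" by (rule sum.swap)
    also have "\<dots> = (\<Sum>k\<in>Ix. \<Sum>j\<in>Ix. \<Sum>i\<in>Ix. B i j k i * (?s * Op k j f S))"
      by (intro sum.cong refl sum.swap)
    finally show ?thesis
      by (simp add: matmul_def B_def sum_distrib_right sum_distrib_left algebra_simps)
  qed
  also have "(\<Sum>i\<in>Ix. \<Sum>l\<in>Ix. matmul m n X Y i l * Op i l f S)
      - (\<Sum>k\<in>Ix. \<Sum>j\<in>Ix. ?s * matmul m n Y X k j * Op k j f S) = opm (sbracket m n p q X Y) f S"
    unfolding opm_def[of "sbracket m n p q X Y"]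
    by (simp add: sbracket_def sum_subtractf left_diff_distrib)
  finally show ?thesis by (rule sym)
qed

text \<open>The elements acting by zero form a two-sided ideal, and it contains the defining
  relations.\<close>

lemma act_Uid:
  assumes "a \<in> Uid"
  shows "act a f S = 0"
proof -
  let ?K = "{a \<in> Cf. \<forall>f S. act a f S = 0}"
  interpret R: ring "free_alg (gl m n)" by (rule ring_free_alg)
  have "ideal ?K (free_alg (gl m n))"
  proof (rule idealI)
    show "subgroup ?K (add_monoid (free_alg (gl m n)))"
    proof (rule R.add.subgroupI)
      show "?K \<noteq> {}" using free_alg_0_closed by fastforce
    next
      fix a assume a: "a \<in> ?K"
      then show "\<ominus>\<^bsub>free_alg (gl m n)\<^esub> a \<in> ?K"
        by (simp add: free_alg_a_inv free_alg_uminus_closed act_uminus)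
    qed (auto simp: free_alg_add_closed act_add)
  next
    show "ring (free_alg (gl m n))" by (rule ring_free_alg)
  next
    have z: "act c (act a f) S = 0" if "a \<in> ?K" for a c f S
    proof -
      have "act a f = (\<lambda>S. 0)" using that by (simp add: fun_eq_iff)
      then show ?thesis by (simp add: lin_zero[OF lin_act])
    qed
    fix a x assume "a \<in> ?K" "x \<in> Cf"
    then show "x \<otimes>\<^bsub>free_alg (gl m n)\<^esub> a \<in> ?K"
      using z by (simp add: free_alg_mult_closed act_mult)
  next
    fix a x assume "a \<in> ?K" "x \<in> Cf"
    then show "a \<otimes>\<^bsub>free_alg (gl m n)\<^esub> x \<in> ?K"
      by (simp add: free_alg_mult_closed act_mult)
  qed
  moreover have "U_rels m n \<subseteq> ?K"
  proof
    fix r assume r: "r \<in> U_rels m n"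
    then consider (add) X Y where "r = gen (\<lambda>i j. X i j + Y i j) - gen X - gen Y"
      | (scale) c X where "r = gen (\<lambda>i j. c * X i j) - const c * gen X"
      | (br) p q X Y where "r = gen X * gen Y - const ((-1) ^ (p * q)) * (gen Y * gen X) - gen (sbracket m n p q X Y)"
        "p < 2" "q < 2" "X \<in> gl_part m n p" "Y \<in> gl_part m n q"
      unfolding U_rels_def by blast
    then have "act r f S = 0" for f S
    proof cases
      case add
      then show ?thesis
        by (simp add: act_diff act_gen opm_def sum.distrib[symmetric] sum_subtractf[symmetric] distrib_right)
    next
      case scale
      then show ?thesis
        by (simp add: act_diff act_gen act_mult opm_def sum_distrib_left mult.assoc)
    next
      case br
      then show ?thesis
        by (simp add: act_diff act_gen act_mult opm_sbracket)
    qed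
    then show "r \<in> ?K" using r U_rels_closed by auto
  qed
  ultimately have "Uid \<subseteq> ?K"
    unfolding U_ideal_def by (intro R.genideal_minimal)
  then show ?thesis using assms by auto
qed

end

section \<open>Words of lowering operators attached to chains\<close>

context super_gl begin

fun ech :: "int \<Rightarrow> int \<Rightarrow> int list \<Rightarrow> falg" where
  "ech b a [] = e b a"
| "ech b a (j # js) = ech b j js * e j a"

fun chw :: "int \<Rightarrow> int \<Rightarrow> int list \<Rightarrow> (int \<times> int) list" where
  "chw b a [] = [(b, a)]"
| "chw b a (j # js) = chw b j js @ [(j, a)]"

lemma tails_chw: "snd ` set (chw b a js) = insert a (set js)"
  by (induction js arbitrary: a) auto

text \<open>Distinct tails are what allows every factor of the word to be given a colour of its
  own.\<close>

fun okw :: "(int \<times> int) list \<Rightarrow> bool" where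
  "okw [] = True"
| "okw ((b, a) # ps) \<longleftrightarrow> a \<notin> snd ` set ps \<and> a < b \<and> a \<in> Ix \<and> b \<in> Ix \<and> okw ps"

lemma okw_snoc:
  "okw (ps @ [(b, a)]) \<longleftrightarrow> okw ps \<and> a \<notin> snd ` set ps \<and> a < b \<and> a \<in> Ix \<and> b \<in> Ix"
  by (induction ps rule: okw.induct) auto

lemma okw_chw:
  "sorted_wrt (<) (a # js @ [b]) \<Longrightarrow> a \<in> Ix \<Longrightarrow> b \<in> Ix \<Longrightarrow> set js \<subseteq> Ix \<Longrightarrow> okw (chw b a js)"
  by (induction js arbitrary: a) (auto simp: okw_snoc tails_chw)

end

text \<open>The eigenvalue of \<open>T p p\<close>, see \<open>T_diag\<close>. For a bosonic mode
  with \<open>l > 0\<close>, \<open>T p p\<close> is minus the derivation after the multiplication,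
  whence the value \<open>- (k + 1)\<close>.\<close>

definition occ :: "mode \<Rightarrow> nat \<Rightarrow> complex" where
  "occ p k = (if ferm p then of_bool (odd k) else if fst (fst p) < 0 then of_nat k else - of_nat (Suc k))"

text \<open>In the vacuum of the colour \<open>l\<close> the fermionic modes of index at most \<open>l\<close> are filled; this makes it a
  highest weight vector of weight \<open>om l\<close>.\<close>

definition v0 :: cfg where "v0 p = of_bool (ferm p \<and> snd p \<le> fst (fst p))"

definition vac :: "cfg \<Rightarrow> complex" where "vac S = of_bool (S = v0)"

text \<open>Filled fermionic modes contribute 1. Bosonic modes at occupation number 0 contribute 0
  for \<open>l < 0\<close> and -1 for \<open>l > 0\<close>, in accordance with
  \<open>occ\<close>.\<close>

definition om :: "int \<Rightarrow> int \<Rightarrow> complex" where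
  "om l k = (if (l < 0) = (k < 0) then of_bool (k \<le> l) else if l < 0 then 0 else -1)"

section \<open>Weights of configurations and the action of words on the vacuum\<close>

context fock begin

definition cwt :: "cfg \<Rightarrow> int \<Rightarrow> complex" where "cwt S k = (\<Sum>c\<in>colours. occ (c, k) (S (c, k)))"

definition nuN :: "int \<Rightarrow> complex" where "nuN k = (\<Sum>l\<in>Ix. of_nat (N l) * om l k)"

lemma T_diag: "T p p f S = occ p (S p) * f S"
proof (cases "ferm p")
  case True
  have "jw (S(p := k)) p = jw S p" for k by (simp add: jw_upd)
  then show ?thesis
    using True by (auto simp: T_def up_def dn_def mop_def ua_def ug_def da_def dg_def occ_def jw_sq_left)
next
  case False
  then show ?thesis
    by (cases "S p") (auto simp: T_def up_def dn_def mop_def ua_def ug_def da_def dg_def occ_def fun_upd_idem)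
qed

lemma Op_diag: "Op k k f S = cwt S k * f S"
  by (simp add: Op_def T_diag cwt_def sum_distrib_right)

lemma cwt_v0: "cwt v0 k = nuN k"
proof -
  have "cwt v0 k = (\<Sum>l\<in>Ix. \<Sum>r\<in>{..<N l}. occ ((l, r), k) (v0 ((l, r), k)))"
    unfolding cwt_def colours_def by (subst sum.Sigma) (auto simp: case_prod_unfold)
  also have "\<dots> = (\<Sum>l\<in>Ix. \<Sum>r\<in>{..<N l}. om l k)"
    by (intro sum.cong refl) (auto simp: occ_def v0_def om_def ferm_def)
  finally show ?thesis by (simp add: nuN_def)
qed

lemma Op_diag_vac: "Op k k vac = (\<lambda>S. nuN k * vac S)"
  by (rule ext) (auto simp: Op_diag vac_def cwt_v0)

lemma upd_neq_v0: "k \<noteq> v0 p \<Longrightarrow> S(p := k) \<noteq> v0"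
  by (metis fun_upd_same)

text \<open>Either the fermionic mode is empty in \<open>v0\<close>, or the operator is a derivation
  applied to a constant.\<close>

lemma dn_vac:
  assumes "ferm q \<and> fst (fst q) < snd q \<or> \<not> ferm q \<and> fst (fst q) < 0"
  shows "dn q vac = (\<lambda>S. 0)"
proof (rule ext)
  fix S
  have "even (S q) \<Longrightarrow> S(q := flip (S q)) \<noteq> v0" if "ferm q" "fst (fst q) < snd q"
    using that by (intro upd_neq_v0) (auto simp: v0_def flip_def)
  moreover have "S(q := Suc (S q)) \<noteq> v0" if "\<not> ferm q"
    using that by (intro upd_neq_v0) (auto simp: v0_def)
  ultimately show "dn q vac S = 0"
    using assms by (auto simp: dn_def mop_def vac_def da_def dg_def)
qed

text \<open>Either the fermionic mode is already filled in \<open>v0\<close>, or the creation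
  operator is a derivation applied to a constant.\<close>

lemma up_vac:
  assumes "ferm p \<and> snd p \<le> fst (fst p) \<or> \<not> ferm p \<and> \<not> fst (fst p) < 0"
  shows "up p vac = (\<lambda>S. 0)"
proof (rule ext)
  fix S
  have "odd (S p) \<Longrightarrow> S(p := flip (S p)) \<noteq> v0" if "ferm p" "snd p \<le> fst (fst p)"
    using that by (intro upd_neq_v0) (metis odd_flip(2) odd_one of_bool_eq(2) v0_def)
  moreover have "S(p := Suc (S p)) \<noteq> v0" if "\<not> ferm p"
    using that by (intro upd_neq_v0) (auto simp: v0_def)
  ultimately show "up p vac S = 0"
    using assms by (auto simp: up_def mop_def vac_def ua_def ug_def)
qed

text \<open>In each colour either \<open>dn\<close> at \<open>j\<close> kills the vacuum or
  \<open>up\<close> at \<open>i\<close> does. In the second case the two operators belong to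
  different modes, so \<open>up\<close> can be moved next to the vacuum at the cost of a
  sign.\<close>

lemma Op_raise_vac:
  assumes "i \<in> Ix" "j \<in> Ix" "i < j"
  shows "Op i j vac = (\<lambda>S. 0)"
proof -
  have "T (c, i) (c, j) vac S = 0" if c: "c \<in> colours" for c S
  proof -
    let ?p = "(c, i)" and ?q = "(c, j)"
    have pq: "?p \<in> modes" "?q \<in> modes" using c assms by (auto simp: modes_def)
    have "0 \<notin> Ix" by (simp add: idx_def)
    then have "i \<noteq> 0" "j \<noteq> 0" "fst c \<noteq> 0" using assms c by (auto simp: colours_def)
    then consider "dn ?q vac = (\<lambda>S. 0)" | "up ?p vac = (\<lambda>S. 0)"
      using dn_vac[of ?q] up_vac[of ?p] assms(3) by (force simp: ferm_def)
    then show ?thesis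
    proof cases
      case 1
      then show ?thesis by (simp add: T_def lin_zero[OF lin_up])
    next
      case 2
      have "dn ?q (up ?p vac) S = fsgn ?q ?p * up ?p (dn ?q vac) S"
        using dn_up[OF pq(2,1), of vac] assms(3) by simp
      then show ?thesis unfolding 2 lin_zero[OF lin_dn] by (simp add: T_def fsgn_def split: if_splits)
    qed
  qed
  then show ?thesis by (simp add: Op_def fun_eq_iff)
qed

definition Wact :: "(int \<times> int) list \<Rightarrow> cfg \<Rightarrow> complex" where
  "Wact ps = foldr (\<lambda>(b, a). Op b a) ps vac"

lemma Wact_simps [simp]: "Wact [] = vac" "Wact ((b, a) # ps) = Op b a (Wact ps)"
  by (simp_all add: Wact_def)

lemma act_ech:
  assumes "a \<in> Ix" "b \<in> Ix" "set js \<subseteq> Ix"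
  shows "act (ech b a js) vac = Wact (chw b a js)"
proof -
  have "act (ech b a js) f = foldr (\<lambda>(b, a). Op b a) (chw b a js) f" for f
    using assms by (induction js arbitrary: a f) (auto simp: act_e act_mult)
  then show ?thesis by (simp add: Wact_def)
qed

text \<open>A crude form of the action for support arguments: the value at one configuration reads
  the argument at one other configuration, which differs at most in the modes \<open>p\<close> and
  \<open>q\<close>, and a creation cannot leave a fermionic mode empty.\<close>

lemma T_eval: "\<exists>x k k'. T p q f S = x * f (S(p := k, q := k')) \<and> (ferm p \<and> even (S p) \<longrightarrow> x = 0)"
proof -
  let ?S = "S(p := ug p (S p))"
  have "T p q f S = ((if ferm p then jw S p else 1) * ua p (S p) * ((if ferm q then jw ?S q else 1) * da q (?S q)))
     * f (S(p := ug p (S p), q := dg q (?S q)))"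
    by (simp add: T_def up_def dn_def mop_def)
  then show ?thesis by (intro exI conjI) (auto simp: ua_def)
qed

text \<open>A factor of a word can empty the mode \<open>a0\<close> of a colour \<open>(a0, r)\<close> only if its tail
  is \<open>a0\<close>.\<close>

lemma Wact_tails:
  assumes "a0 \<notin> snd ` set ps" "even (S ((a0, r), a0))"
  shows "Wact ps S = 0"
  using assms
proof (induction ps arbitrary: S)
  case Nil
  then have "S \<noteq> v0" by (auto simp: v0_def ferm_def)
  then show ?case by (simp add: vac_def)
next
  case (Cons x ps)
  obtain b a where x: "x = (b, a)" by force
  have "T (c, b) (c, a) (Wact ps) S = 0" for c
  proof -
    let ?q = "((a0, r), a0)"
    obtain y k k' where y: "T (c, b) (c, a) (Wact ps) S = y * Wact ps (S((c, b) := k, (c, a) := k'))"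
      "ferm (c, b) \<and> even (S (c, b)) \<longrightarrow> y = 0"
      using T_eval[of "(c, b)" "(c, a)" "Wact ps" S] by blast
    show ?thesis
    proof (cases "(c, b) = ?q")
      case True
      then have "y = 0" using y(2) Cons.prems by (auto simp: ferm_def)
      then show ?thesis using y by simp
    next
      case False
      have "a \<noteq> a0" using Cons.prems x by auto
      then have "even ((S((c, b) := k, (c, a) := k')) ?q)"
        using Cons.prems False by auto
      then show ?thesis using Cons y by auto
    qed
  qed
  then show ?case by (simp add: x Op_def)
qed

text \<open>The factor \<open>(b, a)\<close> moves a particle from \<open>a\<close> to \<open>b\<close> within the colour \<open>(a, 0)\<close>, so different
  factors of a chain use different colours.\<close>

fun Sc :: "(int \<times> int) list \<Rightarrow> cfg" where
  "Sc [] = v0"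
| "Sc ((b, a) # ps) = (Sc ps)(((a, 0), a) := 0, ((a, 0), b) := 1)"

lemma Sc_unused: "fst c \<notin> snd ` set ps \<Longrightarrow> Sc ps (c, k) = v0 (c, k)"
  by (induction ps) auto

lemma Sc_used: "okw ps \<Longrightarrow> a \<in> snd ` set ps \<Longrightarrow> Sc ps ((a, 0), a) = 0"
  by (induction ps rule: okw.induct) auto

text \<open>Evaluated at \<open>Sc\<close>, the first factor acts only through the colour
  \<open>(a, 0)\<close>: any other colour leaves the mode \<open>((a, 0), a)\<close> empty, and by
  \<open>Wact_tails\<close> the rest of the word vanishes there, as \<open>a\<close> is not among
  its tails. The surviving term undoes the two updates of \<open>Sc\<close> with a coefficient that
  is a product of signs.\<close>

lemma Wact_Sc:
  assumes "okw ps" "\<And>l. l \<in> Ix \<Longrightarrow> 1 \<le> N l"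
  shows "Wact ps (Sc ps) \<noteq> 0"
  using assms(1)
proof (induction ps rule: okw.induct)
  case 1
  then show ?case by (simp add: vac_def)
next
  case (2 b a ps)
  let ?c = "(a, 0::nat)"
  let ?p = "(?c, b)" and ?q = "(?c, a)" and ?S = "Sc ((b, a) # ps)"
  have ab: "a < b" "a \<in> Ix" "b \<in> Ix" "a \<notin> snd ` set ps" "okw ps" using 2 by auto
  have c: "?c \<in> colours" using ab assms(2) by (force simp: colours_def)
  have "0 \<notin> Ix" by (simp add: idx_def)
  then have nz: "a \<noteq> 0" "b \<noteq> 0" using ab by auto
  have fq: "ferm ?q" by (simp add: ferm_def)
  have Sp: "?S ?p = 1" and Sq: "?S ?q = 0" using ab by auto
  have v: "v0 ?p = 0" "v0 ?q = 1" using ab by (auto simp: v0_def ferm_def)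
  have other: "T (d, b) (d, a) (Wact ps) ?S = 0" if "d \<noteq> ?c" for d
  proof -
    obtain y k k' where y: "T (d, b) (d, a) (Wact ps) ?S = y * Wact ps (?S((d, b) := k, (d, a) := k'))"
      using T_eval[of "(d, b)" "(d, a)" "Wact ps" ?S] by blast
    have "even ((?S((d, b) := k, (d, a) := k')) ?q)" using that Sq by auto
    then show ?thesis using Wact_tails[OF ab(4)] y by auto
  qed
  \<comment> \<open>The colour \<open>(a, 0)\<close> is untouched in \<open>Sc ps\<close>, so its
    two modes have their vacuum values there.\<close>
  have restore: "?S(?p := 0, ?q := 1) = Sc ps"
    using Sc_unused[of ?c ps] ab v by (auto simp: fun_eq_iff)
  have "T ?p ?q (Wact ps) ?S = (if ferm ?p then jw ?S ?p else 1) * jw (?S(?p := 0)) ?q * Wact ps (Sc ps)"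
    using fq Sp Sq ab(1) nz unfolding restore[symmetric]
    by (auto simp: T_def up_def dn_def mop_def ua_def ug_def da_def dg_def ferm_def flip_def simp del: Sc.simps)
  moreover have "jw S x \<noteq> 0" for S x using jw_sq[of S x] by auto
  ultimately have "T ?p ?q (Wact ps) ?S \<noteq> 0" using 2(1) ab by auto
  moreover have "Wact ((b, a) # ps) ?S = (\<Sum>d\<in>{?c}. T (d, b) (d, a) (Wact ps) ?S)"
    unfolding Wact_simps Op_def by (rule sum.mono_neutral_right) (use c other in auto)
  ultimately show ?case by (simp del: Sc.simps Wact_simps)
qed

end

section \<open>Congruences\<close>

context super_gl begin

definition eqU :: "falg \<Rightarrow> falg \<Rightarrow> bool" (infix "\<approx>" 50) where "a \<approx> b \<longleftrightarrow> a - b \<in> Uid"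

lemma eqU_refl [simp, intro]: "a \<approx> a"
  by (simp add: eqU_def Uid_0)

lemma eqU_sym: "a \<approx> b \<Longrightarrow> b \<approx> a"
  unfolding eqU_def using Uid_uminus by fastforce

lemma eqU_trans [trans]: "a \<approx> b \<Longrightarrow> b \<approx> c \<Longrightarrow> a \<approx> c"
  unfolding eqU_def using Uid_add by fastforce

lemma eqU_add: "a \<approx> b \<Longrightarrow> c \<approx> d \<Longrightarrow> a + c \<approx> b + d"
  unfolding eqU_def using Uid_add[of "a - b" "c - d"] by (simp add: algebra_simps)

lemma eqU_diff: "a \<approx> b \<Longrightarrow> c \<approx> d \<Longrightarrow> a - c \<approx> b - d"
  unfolding eqU_def using Uid_diff[of "a - b" "c - d"] by (simp add: algebra_simps)

lemma eqU_lmult: "a \<approx> b \<Longrightarrow> c \<in> Cf \<Longrightarrow> c * a \<approx> c * b"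
  unfolding eqU_def using Uid_lmult[of "a - b" c] by (simp add: algebra_simps)

lemma eqU_rmult: "a \<approx> b \<Longrightarrow> c \<in> Cf \<Longrightarrow> a * c \<approx> b * c"
  unfolding eqU_def using Uid_rmult[of "a - b" c] by (simp add: algebra_simps)

lemma eqU_sum: "(\<And>x. x \<in> S \<Longrightarrow> f x \<approx> g x) \<Longrightarrow> sum f S \<approx> sum g S"
  unfolding eqU_def sum_subtractf[symmetric] by (rule Uid_sum)

lemma eqU_0: "a \<approx> 0 \<longleftrightarrow> a \<in> Uid"
  by (simp add: eqU_def)

lemmas Cf_closed = free_alg_add_closed[where A = "gl m n"] free_alg_uminus_closed[where A = "gl m n"]
  free_alg_diff_closed[where A = "gl m n"] free_alg_mult_closed[where A = "gl m n"]
  free_alg_const_closed[where A = "gl m n"] free_alg_0_closed[where A = "gl m n"]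
  free_alg_1_closed[where A = "gl m n"] free_alg_sum_closed[where A = "gl m n"]

lemma e_swap:
  assumes "i \<in> Ix" "j \<in> Ix" "k \<in> Ix" "l \<in> Ix"
  shows "e i j * e k l \<approx> const (sgn2 i j k l) * (e k l * e i j)
     + ((if j = k then e i l else 0) - (if i = l then const (sgn2 i j k l) * e k j else 0))"
  using e_bracket[OF assms] by (simp add: eqU_def algebra_simps)

section \<open>The enveloping algebra of the Cartan subalgebra\<close>

text \<open>\<open>hrel K x f\<close>: \<open>x\<close> is a polynomial in the \<open>e k k\<close> with \<open>k \<in> K\<close>, and \<open>f\<close> is the corresponding polynomial
  function on weights.\<close>

inductive hrel :: "int set \<Rightarrow> falg \<Rightarrow> (weight \<Rightarrow> complex) \<Rightarrow> bool" for K where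
  hrel_const: "hrel K (const c) (\<lambda>\<nu>. c)"
| hrel_add: "hrel K x f \<Longrightarrow> hrel K y g \<Longrightarrow> hrel K (x + y) (\<lambda>\<nu>. f \<nu> + g \<nu>)"
| hrel_e: "k \<in> K \<Longrightarrow> hrel K x f \<Longrightarrow> hrel K (e k k * x) (\<lambda>\<nu>. \<nu> k * f \<nu>)"

lemma hrel_0: "hrel K 0 (\<lambda>\<nu>. 0)"
  using hrel_const[of K 0] by simp

lemma hrel_1: "hrel K 1 (\<lambda>\<nu>. 1)"
  using hrel_const[of K 1] by simp

lemma hrel_gen: "k \<in> K \<Longrightarrow> hrel K (e k k) (\<lambda>\<nu>. \<nu> k)"
  using hrel_e[OF _ hrel_1] by simp

lemma hrel_mono: "hrel K x f \<Longrightarrow> K \<subseteq> K' \<Longrightarrow> hrel K' x f"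
  by (induction rule: hrel.induct) (auto intro: hrel.intros)

lemma hrel_const_mult: "hrel K x f \<Longrightarrow> hrel K (const c * x) (\<lambda>\<nu>. c * f \<nu>)"
proof (induction rule: hrel.induct)
  case (hrel_const d)
  then show ?case using hrel.hrel_const[of K "c * d"] by (simp add: const_mult)
next
  case (hrel_add x f y g)
  then show ?case using hrel.hrel_add by (fastforce simp: distrib_left)
next
  case (hrel_e k x f)
  then show ?case using hrel.hrel_e[OF hrel_e(1,3)]
    by (simp add: const_mult_left_comm mult.left_commute)
qed

lemma hrel_mult: "hrel K x f \<Longrightarrow> hrel K y g \<Longrightarrow> hrel K (x * y) (\<lambda>\<nu>. f \<nu> * g \<nu>)"
proof (induction rule: hrel.induct)
  case (hrel_const d)
  then show ?case by (rule hrel_const_mult)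
next
  case (hrel_add x f y' g')
  then show ?case using hrel.hrel_add by (fastforce simp: distrib_right)
next
  case (hrel_e k x f)
  then show ?case using hrel.hrel_e[of k K "x * y"] by (simp add: mult.assoc)
qed

lemma hrel_uminus: "hrel K x f \<Longrightarrow> hrel K (- x) (\<lambda>\<nu>. - f \<nu>)"
  using hrel_const_mult[of K x f "-1"] by (simp add: const_uminus)

lemma hrel_diff: "hrel K x f \<Longrightarrow> hrel K y g \<Longrightarrow> hrel K (x - y) (\<lambda>\<nu>. f \<nu> - g \<nu>)"
  using hrel_add[OF _ hrel_uminus, of K x f y g] by simp

lemma hrel_Cf: "hrel K x f \<Longrightarrow> K \<subseteq> Ix \<Longrightarrow> x \<in> Cf"
  by (induction rule: hrel.induct) (auto intro: Cf_closed e_Cf)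

lemma e_diag_comm: "k \<in> Ix \<Longrightarrow> l \<in> Ix \<Longrightarrow> e k k * e l l \<approx> e l l * e k k"
proof -
  assume k: "k \<in> Ix" "l \<in> Ix"
  have "sgn2 k k l l = 1" by (simp add: sgn2_def par2_def)
  then show ?thesis using e_swap[of k k l l] k by (cases "k = l") auto
qed

lemma hrel_comm_e:
  assumes "hrel K x f" "K \<subseteq> Ix" "k \<in> Ix"
  shows "e k k * x \<approx> x * e k k"
  using assms(1)
proof (induction rule: hrel.induct)
  case (hrel_const c)
  then show ?case by (simp add: const_mult_comm)
next
  case (hrel_add x f y g)
  then show ?case by (simp add: distrib_left distrib_right eqU_add)
next
  case (hrel_e l x f)
  have l: "l \<in> Ix" and x: "x \<in> Cf" using hrel_e assms hrel_Cf by auto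
  have "e k k * (e l l * x) = (e k k * e l l) * x" by (simp add: mult.assoc)
  also have "\<dots> \<approx> (e l l * e k k) * x" using assms(3) l x by (intro eqU_rmult e_diag_comm)
  also have "\<dots> = e l l * (e k k * x)" by (simp add: mult.assoc)
  also have "\<dots> \<approx> e l l * (x * e k k)" using l by (intro eqU_lmult hrel_e) auto
  finally show ?case by (simp add: mult.assoc)
qed

lemma hrel_comm:
  assumes "hrel K x f" "hrel K y g" "K \<subseteq> Ix"
  shows "x * y \<approx> y * x"
  using assms(1)
proof (induction rule: hrel.induct)
  case (hrel_const c)
  then show ?case by (simp add: const_mult_comm)
next
  case (hrel_add x f x' f')
  then show ?case by (simp add: distrib_left distrib_right eqU_add)
next
  case (hrel_e l x f)
  have l: "l \<in> Ix" and x: "x \<in> Cf" "y \<in> Cf" using hrel_e assms hrel_Cf by auto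
  have "(e l l * x) * y = e l l * (x * y)" by (simp add: mult.assoc)
  also have "\<dots> \<approx> e l l * (y * x)" using l by (intro eqU_lmult hrel_e) auto
  also have "\<dots> = (e l l * y) * x" by (simp add: mult.assoc)
  also have "\<dots> \<approx> (y * e l l) * x" using x by (intro eqU_rmult hrel_comm_e[OF assms(2,3) l])
  finally show ?case by (simp add: mult.assoc)
qed

text \<open>Division with remainder by a monic linear polynomial in \<open>e k k\<close>, the
  remainder not involving \<open>k\<close>. It later splits the atypicality factor off polynomials
  that vanish on the atypical hyperplane.\<close>

lemma hrel_div:
  assumes "hrel (insert k K) x f" "K \<subseteq> Ix" "k \<in> Ix" and y: "hrel K y g"
  shows "\<exists>x1 f1 x0 f0. hrel (insert k K) x1 f1 \<and> hrel K x0 f0 \<and>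
    x \<approx> x1 * (e k k - y) + x0 \<and> (\<forall>\<nu>. f \<nu> = f1 \<nu> * (\<nu> k - g \<nu>) + f0 \<nu>)"
  using assms(1)
proof (induction rule: hrel.induct)
  case (hrel_const c)
  show ?case
    by (intro exI[of _ 0] exI[of _ "\<lambda>_. 0"] exI[of _ "const c"] exI[of _ "\<lambda>_. c"])
      (auto intro: hrel_0 hrel.hrel_const)
next
  case (hrel_add x f x' f')
  then obtain x1 f1 x0 f0 x1' f1' x0' f0' where
    *: "hrel (insert k K) x1 f1" "hrel K x0 f0" "x \<approx> x1 * (e k k - y) + x0"
      "\<And>\<nu>. f \<nu> = f1 \<nu> * (\<nu> k - g \<nu>) + f0 \<nu>"
    and **: "hrel (insert k K) x1' f1'" "hrel K x0' f0'" "x' \<approx> x1' * (e k k - y) + x0'"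
      "\<And>\<nu>. f' \<nu> = f1' \<nu> * (\<nu> k - g \<nu>) + f0' \<nu>"
    by blast
  show ?case
  proof (intro exI conjI)
    show "hrel (insert k K) (x1 + x1') (\<lambda>\<nu>. f1 \<nu> + f1' \<nu>)" "hrel K (x0 + x0') (\<lambda>\<nu>. f0 \<nu> + f0' \<nu>)"
      using * ** by (auto intro: hrel.hrel_add)
    show "x + x' \<approx> (x1 + x1') * (e k k - y) + (x0 + x0')"
      using eqU_add[OF *(3) **(3)] by (simp add: algebra_simps)
  qed (simp add: * ** algebra_simps)
next
  case (hrel_e l x f)
  then obtain x1 f1 x0 f0 where
    *: "hrel (insert k K) x1 f1" "hrel K x0 f0" "x \<approx> x1 * (e k k - y) + x0"
      "\<And>\<nu>. f \<nu> = f1 \<nu> * (\<nu> k - g \<nu>) + f0 \<nu>"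
    by blast
  have kK: "insert k K \<subseteq> Ix" using assms by auto
  have l: "l \<in> Ix" using hrel_e kK by auto
  have mult: "z * x \<approx> (z * x1) * (e k k - y) + z * x0" if "z \<in> Cf" for z
    using eqU_lmult[OF *(3) that] by (simp add: distrib_left mult.assoc)
  show ?case
  proof (cases "l = k")
    case False
    show ?thesis
    proof (intro exI conjI)
      show "hrel (insert k K) (e l l * x1) (\<lambda>\<nu>. \<nu> l * f1 \<nu>)" "hrel K (e l l * x0) (\<lambda>\<nu>. \<nu> l * f0 \<nu>)"
        using * hrel_e False by (auto intro: hrel.hrel_e)
      show "e l l * x \<approx> (e l l * x1) * (e k k - y) + e l l * x0"
        using l by (intro mult) auto
    qed (simp add: * algebra_simps)
  next
    case True
    have y': "hrel (insert k K) y g" using y by (rule hrel_mono) auto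
    have A: "hrel (insert k K) (e k k - y) (\<lambda>\<nu>. \<nu> k - g \<nu>)"
      by (intro hrel_diff hrel_gen y') auto
    \<comment> \<open>The first summand is divisible after commuting; the second is handled by the
      division already known for \<open>x\<close>, because \<open>y\<close> does not involve
      \<open>k\<close>.\<close>
    have "e k k * x = (e k k - y) * x + y * x" by (simp add: algebra_simps)
    also have "\<dots> \<approx> x * (e k k - y) + ((y * x1) * (e k k - y) + y * x0)"
      by (intro eqU_add mult hrel_comm[OF A hrel_e(2) kK] hrel_Cf[OF y' kK])
    also have "\<dots> = (x + y * x1) * (e k k - y) + y * x0" by (simp add: algebra_simps)
    finally have "e l l * x \<approx> (x + y * x1) * (e k k - y) + y * x0" using True by simp
    moreover have "hrel (insert k K) (x + y * x1) (\<lambda>\<nu>. f \<nu> + g \<nu> * f1 \<nu>)"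
      by (intro hrel.hrel_add hrel_mult hrel_e y' *)
    moreover have "hrel K (y * x0) (\<lambda>\<nu>. g \<nu> * f0 \<nu>)"
      by (intro hrel_mult y *)
    moreover have "\<nu> l * f \<nu> = (f \<nu> + g \<nu> * f1 \<nu>) * (\<nu> k - g \<nu>) + g \<nu> * f0 \<nu>" for \<nu>
      unfolding True *(4) by (simp add: algebra_simps)
    ultimately show ?thesis by blast
  qed
qed

text \<open>Polynomiality along every affine line replaces multivariate polynomials: density
  arguments proceed one direction at a time.\<close>

definition linepoly :: "(weight \<Rightarrow> complex) \<Rightarrow> bool" where
  "linepoly f \<longleftrightarrow> (\<forall>\<nu> \<delta>. \<exists>q. \<forall>w. f (\<lambda>k. \<nu> k + w * \<delta> k) = poly q w)"

lemma linepoly_const: "linepoly (\<lambda>\<nu>. c)"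
  unfolding linepoly_def by (intro allI exI[of _ "[:c:]"]) simp

lemma linepoly_coord: "linepoly (\<lambda>\<nu>. \<nu> k)"
  unfolding linepoly_def
proof (intro allI)
  fix \<nu> \<delta> :: weight
  show "\<exists>q. \<forall>w. \<nu> k + w * \<delta> k = poly q w" by (intro exI[of _ "[:\<nu> k, \<delta> k:]"]) simp
qed

lemma linepoly_add: "linepoly f \<Longrightarrow> linepoly g \<Longrightarrow> linepoly (\<lambda>\<nu>. f \<nu> + g \<nu>)"
  unfolding linepoly_def by (metis poly_add)

lemma linepoly_mult: "linepoly f \<Longrightarrow> linepoly g \<Longrightarrow> linepoly (\<lambda>\<nu>. f \<nu> * g \<nu>)"
  unfolding linepoly_def by (metis poly_mult)

lemma hrel_linepoly: "hrel K x f \<Longrightarrow> linepoly f"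
  by (induction rule: hrel.induct) (auto intro: linepoly_const linepoly_coord linepoly_add linepoly_mult)

lemma linepoly_zero:
  assumes "linepoly f" "infinite W" "\<And>w. w \<in> W \<Longrightarrow> f (\<lambda>k. \<nu> k + w * \<delta> k) = 0"
  shows "f (\<lambda>k. \<nu> k + w * \<delta> k) = 0"
proof -
  obtain q where q: "\<And>w. f (\<lambda>k. \<nu> k + w * \<delta> k) = poly q w"
    using assms(1) unfolding linepoly_def by metis
  have "W \<subseteq> {w. poly q w = 0}" using assms(3) q by auto
  then have "q = 0" using assms(2) poly_roots_finite finite_subset by blast
  then show ?thesis by (simp add: q)
qed

lemma hrel_indep: "hrel K x f \<Longrightarrow> (\<And>k. k \<in> K \<Longrightarrow> \<nu> k = \<nu>' k) \<Longrightarrow> f \<nu> = f \<nu>'"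
  by (induction rule: hrel.induct) auto

text \<open>Horner form with respect to \<open>e k k\<close>, which drives the induction in \<open>hrel_zero\<close>.\<close>

inductive nf :: "int set \<Rightarrow> int \<Rightarrow> falg \<Rightarrow> (weight \<Rightarrow> complex) \<Rightarrow> bool" for K k where
  nf_base: "hrel K x f \<Longrightarrow> nf K k x f"
| nf_step: "nf K k x f \<Longrightarrow> hrel K x0 f0 \<Longrightarrow> nf K k (x * e k k + x0) (\<lambda>\<nu>. f \<nu> * \<nu> k + f0 \<nu>)"
| nf_eq: "nf K k x f \<Longrightarrow> x' \<approx> x \<Longrightarrow> nf K k x' f"

lemma nf_add:
  assumes "nf K k x f" "nf K k y g"
  shows "nf K k (x + y) (\<lambda>\<nu>. f \<nu> + g \<nu>)"
  using assms
proof (induction arbitrary: y g rule: nf.induct)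
  case (nf_base x f)
  from nf_base(2,1) show ?case
  proof (induction rule: nf.induct)
    case (nf_base y g)
    then show ?case by (intro nf.nf_base hrel_add)
  next
    case (nf_step y g y0 g0)
    have "nf K k (y * e k k + (x + y0)) (\<lambda>\<nu>. g \<nu> * \<nu> k + (f \<nu> + g0 \<nu>))"
      using nf_step by (intro nf.nf_step hrel_add)
    then show ?case by (simp add: algebra_simps)
  next
    case (nf_eq y g y')
    then show ?case by (intro nf.nf_eq[of K k "x + y" _ "x + y'"] eqU_add) auto
  qed
next
  case (nf_step x f x0 f0)
  from nf_step(4,2,3) show ?case
  proof (induction rule: nf.induct)
    case (nf_base y g)
    have "nf K k (x * e k k + (x0 + y)) (\<lambda>\<nu>. f \<nu> * \<nu> k + (f0 \<nu> + g \<nu>))"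
      using nf_step.hyps nf_base by (intro nf.nf_step hrel_add)
    then show ?case by (simp add: algebra_simps)
  next
    case (nf_step y g y0 g0)
    have "nf K k ((x + y) * e k k + (x0 + y0)) (\<lambda>\<nu>. (f \<nu> + g \<nu>) * \<nu> k + (f0 \<nu> + g0 \<nu>))"
      using nf_step by (intro nf.nf_step hrel_add) auto
    then show ?case by (simp add: algebra_simps)
  next
    case (nf_eq y g y')
    then show ?case by (intro nf.nf_eq[of K k "x * e k k + x0 + y" _ "x * e k k + x0 + y'"] eqU_add) auto
  qed
next
  case (nf_eq x f x')
  then show ?case by (intro nf.nf_eq[of K k "x + y" _ "x' + y"] eqU_add) auto
qed

lemma nf_e:
  assumes "nf K k x f" "l \<in> K" "K \<subseteq> Ix"
  shows "nf K k (e l l * x) (\<lambda>\<nu>. \<nu> l * f \<nu>)"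
  using assms(1)
proof (induction rule: nf.induct)
  case (nf_base x f)
  then show ?case using assms by (intro nf.nf_base hrel_e)
next
  case (nf_step x f x0 f0)
  have "nf K k ((e l l * x) * e k k + e l l * x0) (\<lambda>\<nu>. (\<nu> l * f \<nu>) * \<nu> k + \<nu> l * f0 \<nu>)"
    using nf_step assms by (intro nf.nf_step hrel_e)
  then show ?case by (simp add: algebra_simps)
next
  case (nf_eq x f x')
  have "e l l * x' \<approx> e l l * x" using nf_eq assms by (intro eqU_lmult) auto
  with nf_eq show ?case by (rule_tac nf.nf_eq)
qed

lemma hrel_nf:
  assumes "hrel (insert k K) x f" "insert k K \<subseteq> Ix"
  shows "nf K k x f"
  using assms(1)
proof (induction rule: hrel.induct)
  case (hrel_const c)
  then show ?case by (intro nf_base hrel.hrel_const)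
next
  case (hrel_add x f y g)
  then show ?case by (intro nf_add)
next
  case (hrel_e l x f)
  show ?case
  proof (cases "l = k")
    case True
    have "nf K k (x * e k k + 0) (\<lambda>\<nu>. f \<nu> * \<nu> k + 0)"
      using hrel_e by (intro nf_step hrel_0)
    then show ?thesis
      using hrel_comm_e[OF hrel_e(2) assms(2), of k] assms(2) True
      by (intro nf_eq[of K k "x * e k k" _ "e l l * x"]) (auto simp: mult.commute)
  next
    case False
    then show ?thesis using hrel_e assms by (intro nf_e) auto
  qed
qed

text \<open>A polynomial is determined modulo \<open>Uid\<close> by its function. Setting the
  coordinate \<open>k\<close> to 0 in the Horner form isolates \<open>f0\<close>, which therefore
  vanishes. Then \<open>f\<close> vanishes wherever this coordinate is nonzero, and along lines also
  where it is zero.\<close>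

lemma hrel_zero:
  assumes "hrel K x f" "finite K" "K \<subseteq> Ix" "\<And>\<nu>. f \<nu> = 0"
  shows "x \<approx> 0"
  using assms(2,1,3,4)
proof (induction K arbitrary: x f rule: finite_induct)
  case empty
  have "x = const (f (\<lambda>_. 0))"
    using empty(1) by (induction rule: hrel.induct) (auto simp: const_add)
  then show ?case using empty by simp
next
  case (insert k K)
  have kIx: "k \<in> Ix" "K \<subseteq> Ix" using insert by auto
  \<comment> \<open>\<open>nf\<close> keeps no \<open>hrel\<close> derivation for \<open>f\<close>,
    so polynomiality on lines is carried through the induction.\<close>
  have "linepoly f \<and> ((\<forall>\<nu>. f \<nu> = 0) \<longrightarrow> x \<approx> 0)"
    using hrel_nf[OF insert.prems(1,2)]
  proof (induction rule: nf.induct)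
    case (nf_base x f)
    then show ?case using insert.IH kIx hrel_linepoly by blast
  next
    case (nf_step x f x0 f0)
    have lp: "linepoly (\<lambda>\<nu>. f \<nu> * \<nu> k + f0 \<nu>)"
      using nf_step hrel_linepoly by (intro linepoly_add linepoly_mult linepoly_coord) auto
    have "x * e k k + x0 \<approx> 0" if z: "\<forall>\<nu>. f \<nu> * \<nu> k + f0 \<nu> = 0"
    proof -
      have f0: "f0 \<nu> = 0" for \<nu>
      proof -
        have "f0 \<nu> = f0 (\<nu>(k := 0))"
          by (rule hrel_indep[OF nf_step(2)]) (use insert.hyps in auto)
        then show ?thesis using z[rule_format, of "\<nu>(k := 0)"] by simp
      qed
      then have x0: "x0 \<approx> 0" using insert.IH nf_step(2) kIx by blast
      have nz: "f \<nu> = 0" if "\<nu> k \<noteq> 0" for \<nu>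
        using z[rule_format, of \<nu>] f0 that by simp
      have "f \<nu> = 0" for \<nu>
      proof (cases "\<nu> k = 0")
        case True
        let ?d = "\<lambda>j. if j = k then 1 else 0 :: complex"
        have inf: "infinite (UNIV - {0 :: complex})" by (simp add: infinite_UNIV_char_0)
        have "f (\<lambda>j. \<nu> j + 0 * ?d j) = 0"
          by (rule linepoly_zero[OF _ inf]) (use nf_step.IH nz True in auto)
        then show ?thesis by simp
      qed (rule nz)
      then have x: "x \<approx> 0" using nf_step.IH by blast
      have "x * e k k + x0 \<approx> 0 * e k k + 0" using x x0 kIx by (intro eqU_add eqU_rmult) auto
      then show ?thesis by simp
    qed
    with lp show ?case by blast
  next
    case (nf_eq x f x')
    then show ?case using eqU_trans by blast
  qed
  then show ?case using insert.prems by blast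
qed

end

section \<open>Weight decomposition\<close>

text \<open>The integral form of \<open>wt_root\<close>: integer values make it possible to count
  factors and to compute heights.\<close>

definition rt :: "int \<Rightarrow> int \<Rightarrow> int \<Rightarrow> int" where "rt i j k = of_bool (k = i) - of_bool (k = j)"

lemma rt_add: "rt i j k + rt j l k = rt i l k"
  by (simp add: rt_def)

fun wtw :: "(int \<times> int) list \<Rightarrow> int \<Rightarrow> int" where
  "wtw [] k = 0"
| "wtw ((b, a) # ps) k = rt b a k + wtw ps k"

lemma wtw_append: "wtw (ps @ qs) k = wtw ps k + wtw qs k"
  by (induction ps k rule: wtw.induct) auto

context super_gl begin

definition wtv :: "(int \<Rightarrow> int) \<Rightarrow> falg \<Rightarrow> bool" where
  "wtv \<gamma> a \<longleftrightarrow> (\<forall>k\<in>Ix. e k k * a - a * e k k \<approx> const (of_int (\<gamma> k)) * a)"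

lemma wtv_eq: "wtv \<gamma> a \<Longrightarrow> a' \<approx> a \<Longrightarrow> wtv \<gamma> a'"
  unfolding wtv_def
proof
  fix k assume *: "\<forall>k\<in>Ix. e k k * a - a * e k k \<approx> const (of_int (\<gamma> k)) * a" "a' \<approx> a" "k \<in> Ix"
  have "e k k * a' - a' * e k k \<approx> e k k * a - a * e k k"
    using * by (intro eqU_diff eqU_lmult eqU_rmult) auto
  also have "\<dots> \<approx> const (of_int (\<gamma> k)) * a" using * by blast
  also have "\<dots> \<approx> const (of_int (\<gamma> k)) * a'" using * by (intro eqU_lmult eqU_sym[OF *(2)] Cf_closed)
  finally show "e k k * a' - a' * e k k \<approx> const (of_int (\<gamma> k)) * a'" .
qed

lemma wtv_0: "wtv \<gamma> 0"
  by (simp add: wtv_def)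

lemma wtv_add: "wtv \<gamma> a \<Longrightarrow> wtv \<gamma> b \<Longrightarrow> wtv \<gamma> (a + b)"
  unfolding wtv_def
proof
  fix k assume *: "\<forall>k\<in>Ix. e k k * a - a * e k k \<approx> const (of_int (\<gamma> k)) * a"
    "\<forall>k\<in>Ix. e k k * b - b * e k k \<approx> const (of_int (\<gamma> k)) * b" "k \<in> Ix"
  then show "e k k * (a + b) - (a + b) * e k k \<approx> const (of_int (\<gamma> k)) * (a + b)"
    using eqU_add[OF *(1)[rule_format, OF *(3)] *(2)[rule_format, OF *(3)]] by (simp add: algebra_simps)
qed

lemma wtv_const: "wtv \<gamma> a \<Longrightarrow> wtv \<gamma> (const c * a)"
  unfolding wtv_def
proof
  fix k assume *: "\<forall>k\<in>Ix. e k k * a - a * e k k \<approx> const (of_int (\<gamma> k)) * a" "k \<in> Ix"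
  have "const c * (e k k * a - a * e k k) \<approx> const c * (const (of_int (\<gamma> k)) * a)"
    using * by (intro eqU_lmult Cf_closed) auto
  then show "e k k * (const c * a) - const c * a * e k k \<approx> const (of_int (\<gamma> k)) * (const c * a)"
    by (simp add: right_diff_distrib mult.assoc const_mult_left_comm[of "e k k" c] const_mult_left_comm[of "const (of_int (\<gamma> k))" c])
qed

lemma wtv_diff: "wtv \<gamma> a \<Longrightarrow> wtv \<gamma> b \<Longrightarrow> wtv \<gamma> (a - b)"
  using wtv_add[OF _ wtv_const[of \<gamma> b "-1"], of a] by (simp add: const_uminus)

lemma wtv_sum: "(\<And>x. x \<in> S \<Longrightarrow> wtv \<gamma> (f x)) \<Longrightarrow> wtv \<gamma> (sum f S)"
  by (induction S rule: infinite_finite_induct) (auto intro: wtv_0 wtv_add)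

lemma wtv_mult:
  assumes "wtv \<gamma> a" "wtv \<gamma>' b" "a \<in> Cf" "b \<in> Cf"
  shows "wtv (\<lambda>k. \<gamma> k + \<gamma>' k) (a * b)"
  unfolding wtv_def
proof
  fix k assume k: "k \<in> Ix"
  have "e k k * (a * b) - a * b * e k k = (e k k * a - a * e k k) * b + a * (e k k * b - b * e k k)"
    by (simp add: algebra_simps)
  also have "\<dots> \<approx> (const (of_int (\<gamma> k)) * a) * b + a * (const (of_int (\<gamma>' k)) * b)"
    using assms k unfolding wtv_def by (intro eqU_add eqU_lmult eqU_rmult) auto
  also have "\<dots> = const (of_int (\<gamma> k + \<gamma>' k)) * (a * b)"
    by (simp add: const_add distrib_right const_mult_left_comm mult.assoc)
  finally show "e k k * (a * b) - a * b * e k k \<approx> const (of_int (\<gamma> k + \<gamma>' k)) * (a * b)" .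
qed

lemma wtv_e:
  assumes "i \<in> Ix" "j \<in> Ix"
  shows "wtv (rt i j) (e i j)"
  unfolding wtv_def
proof
  fix k assume k: "k \<in> Ix"
  have s: "sgn2 k k i j = 1" by (simp add: sgn2_def par2_def)
  have "e k k * e i j \<approx> e i j * e k k + ((if k = i then e k j else 0) - (if k = j then e i k else 0))"
    using e_swap[OF k k assms] s by (cases "k = i"; cases "k = j") auto
  then have "e k k * e i j - e i j * e k k \<approx> (if k = i then e k j else 0) - (if k = j then e i k else 0)"
    by (simp add: eqU_def algebra_simps)
  then show "e k k * e i j - e i j * e k k \<approx> const (of_int (rt i j k)) * e i j"
    by (cases "k = i"; cases "k = j") (auto simp: rt_def const_uminus)
qed

lemma wtv_hrel: "hrel Ix x f \<Longrightarrow> wtv (\<lambda>k. 0) x"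
  unfolding wtv_def using hrel_comm_e[of Ix x f] by (simp add: eqU_def)

definition wd :: "(int \<times> int) list \<Rightarrow> falg" where "wd ps = prod_list (map (\<lambda>(b, a). e b a) ps)"

lemma wd_simps [simp]: "wd [] = 1" "wd ((b, a) # ps) = e b a * wd ps" "wd (ps @ qs) = wd ps * wd qs"
  by (simp_all add: wd_def)

definition negw :: "(int \<times> int) list \<Rightarrow> bool" where
  "negw ps \<longleftrightarrow> (\<forall>(b, a)\<in>set ps. a < b \<and> a \<in> Ix \<and> b \<in> Ix)"

lemma negw_simps [simp]:
  "negw []" "negw ((b, a) # ps) \<longleftrightarrow> a < b \<and> a \<in> Ix \<and> b \<in> Ix \<and> negw ps"
  "negw (ps @ qs) \<longleftrightarrow> negw ps \<and> negw qs"
  by (auto simp: negw_def)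

lemma wd_Cf: "negw ps \<Longrightarrow> wd ps \<in> Cf"
  by (induction ps) (auto intro!: Cf_closed)

lemma wtv_wd: "negw ps \<Longrightarrow> wtv (wtw ps) (wd ps)"
proof (induction ps)
  case Nil
  then show ?case using wtv_hrel[OF hrel_1] by (simp add: wtv_def)
next
  case (Cons x ps)
  then obtain b a where x: "x = (b, a)" by force
  have "wtv (\<lambda>k. rt b a k + wtw ps k) (e b a * wd ps)"
    using Cons x by (intro wtv_mult wtv_e wd_Cf) auto
  then show ?case by (simp add: x wtv_def)
qed

text \<open>The part of weight \<open>\<gamma>\<close> of $U(\mathfrak n^-)U(\mathfrak h)$, lifted to the free algebra.\<close>

inductive Z :: "(int \<Rightarrow> int) \<Rightarrow> falg \<Rightarrow> bool" for \<gamma> where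
  Z_base: "negw ps \<Longrightarrow> wtw ps = \<gamma> \<Longrightarrow> hrel Ix x f \<Longrightarrow> Z \<gamma> (wd ps * x)"
| Z_0: "Z \<gamma> 0"
| Z_add: "Z \<gamma> a \<Longrightarrow> Z \<gamma> b \<Longrightarrow> Z \<gamma> (a + b)"
| Z_eq: "Z \<gamma> a \<Longrightarrow> a' \<in> Cf \<Longrightarrow> a' \<approx> a \<Longrightarrow> Z \<gamma> a'"

lemma Z_Cf: "Z \<gamma> a \<Longrightarrow> a \<in> Cf"
proof (induction rule: Z.induct)
  case (Z_base ps x f)
  then show ?case by (intro Cf_closed wd_Cf hrel_Cf[OF Z_base(3)]) auto
qed (auto intro: Cf_closed)

lemma Z_wtv: "Z \<gamma> a \<Longrightarrow> wtv \<gamma> a"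
proof (induction rule: Z.induct)
  case (Z_base ps x f)
  then have "wtv (\<lambda>k. wtw ps k + 0) (wd ps * x)"
    by (intro wtv_mult wtv_wd wtv_hrel wd_Cf hrel_Cf[of Ix]) auto
  then show ?case using Z_base by (simp add: wtv_def)
qed (auto intro: wtv_0 wtv_add wtv_eq)

lemma Z_lower:
  assumes "Z \<gamma> a" "j < i" "i \<in> Ix" "j \<in> Ix"
  shows "Z (\<lambda>k. rt i j k + \<gamma> k) (e i j * a)"
  using assms(1)
proof (induction rule: Z.induct)
  case (Z_base ps x f)
  have "Z (\<lambda>k. rt i j k + \<gamma> k) (wd ((i, j) # ps) * x)"
    using assms Z_base by (intro Z.Z_base) auto
  then show ?case by (simp add: mult.assoc)
next
  case (Z_eq a a')
  then have "e i j * a' \<in> Cf" "e i j * a' \<approx> e i j * a"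
    using assms by (auto intro!: Cf_closed eqU_lmult)
  with Z_eq show ?case by (rule_tac Z.Z_eq)
qed (auto intro: Z.intros simp: distrib_left)

lemma Z_const: "Z \<gamma> a \<Longrightarrow> Z \<gamma> (const c * a)"
proof (induction rule: Z.induct)
  case (Z_base ps x f)
  have "Z \<gamma> (wd ps * (const c * x))"
    using Z_base(1,2) by (rule Z.Z_base[OF _ _ hrel_const_mult[OF Z_base(3)]])
  then show ?case by (simp add: const_mult_left_comm)
next
  case (Z_eq a a')
  then have "const c * a' \<in> Cf" "const c * a' \<approx> const c * a"
    by (auto intro!: Cf_closed eqU_lmult)
  with Z_eq show ?case by (rule_tac Z.Z_eq)
qed (auto intro: Z.intros simp: distrib_left)

lemma Z_diag:
  assumes "Z \<gamma> a" "i \<in> Ix"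
  shows "Z \<gamma> (e i i * a)"
  using assms(1)
proof (induction rule: Z.induct)
  case (Z_base ps x f)
  have cf: "wd ps \<in> Cf" "x \<in> Cf" using Z_base wd_Cf hrel_Cf by auto
  have "e i i * wd ps - wd ps * e i i \<approx> const (of_int (wtw ps i)) * wd ps"
    using wtv_wd[OF Z_base(1)] assms(2) by (simp add: wtv_def)
  then have "e i i * wd ps \<approx> wd ps * e i i + const (of_int (wtw ps i)) * wd ps"
    by (simp add: eqU_def algebra_simps)
  from eqU_rmult[OF this cf(2)]
  have "e i i * (wd ps * x) \<approx> wd ps * (e i i * x) + const (of_int (wtw ps i)) * (wd ps * x)"
    by (simp add: distrib_right mult.assoc)
  moreover have "Z \<gamma> (wd ps * (e i i * x) + const (of_int (wtw ps i)) * (wd ps * x))"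
    by (intro Z_add Z_const Z.Z_base[OF Z_base(1,2) hrel_e[OF assms(2) Z_base(3)]] Z.Z_base[OF Z_base])
  moreover have "e i i * (wd ps * x) \<in> Cf" using cf assms(2) by (auto intro!: Cf_closed)
  ultimately show ?case by (rule_tac Z_eq)
next
  case (Z_eq a a')
  then have "e i i * a' \<in> Cf" "e i i * a' \<approx> e i i * a"
    using assms by (auto intro!: Cf_closed eqU_lmult)
  with Z_eq show ?case by (rule_tac Z.Z_eq)
qed (auto intro: Z.intros simp: distrib_left)

text \<open>Eigenvectors of different weights are independent. At an index \<open>k\<close> where
  \<gamma> and \<delta> differ, applying \<open>ad (e k k) - \<delta> k\<close> to the sum removes
  the component of weight \<delta> and multiplies that of weight \<gamma> by a nonzero
  scalar.\<close>

lemma wtv_indep: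
  assumes "finite G" "\<And>\<gamma>. \<gamma> \<in> G \<Longrightarrow> wtv \<gamma> (u \<gamma>) \<and> u \<gamma> \<in> Cf" "(\<Sum>\<gamma>\<in>G. u \<gamma>) \<approx> 0"
    and "\<And>\<gamma> \<gamma>'. \<gamma> \<in> G \<Longrightarrow> \<gamma>' \<in> G \<Longrightarrow> (\<And>k. k \<in> Ix \<Longrightarrow> \<gamma> k = \<gamma>' k) \<Longrightarrow> \<gamma> = \<gamma>'"
    and "\<gamma> \<in> G"
  shows "u \<gamma> \<approx> 0"
  using assms
proof (induction G arbitrary: u \<gamma> rule: finite_induct)
  case (insert \<delta> G)
  have *: "u \<gamma> \<approx> 0" if g: "\<gamma> \<in> G" for \<gamma>
  proof -
    obtain k where k: "k \<in> Ix" "\<gamma> k \<noteq> \<delta> k" using insert.prems(3)[of \<gamma> \<delta>] insert.hyps g by blast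
    let ?v = "\<lambda>\<gamma>. const (of_int (\<gamma> k - \<delta> k)) * u \<gamma>"
    let ?S = "\<Sum>\<gamma>\<in>insert \<delta> G. u \<gamma>"
    have cfS: "?S \<in> Cf" using insert.prems(1) by (intro Cf_closed) auto
    have "(\<Sum>\<gamma>\<in>insert \<delta> G. const (of_int (\<gamma> k)) * u \<gamma>) \<approx> (\<Sum>\<gamma>\<in>insert \<delta> G. e k k * u \<gamma> - u \<gamma> * e k k)"
      using insert.prems(1) k by (intro eqU_sum eqU_sym[of "e k k * _ - _"]) (auto simp: wtv_def)
    also have "\<dots> = e k k * ?S - ?S * e k k"
      by (simp only: sum_subtractf sum_distrib_left sum_distrib_right)
    also have "\<dots> \<approx> e k k * 0 - 0 * e k k"
      using insert.prems(2) k by (intro eqU_diff eqU_lmult eqU_rmult) auto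
    finally have 1: "(\<Sum>\<gamma>\<in>insert \<delta> G. const (of_int (\<gamma> k)) * u \<gamma>) \<approx> 0" by simp
    have "const (of_int (\<delta> k)) * ?S \<approx> const (of_int (\<delta> k)) * 0"
      using insert.prems(2) by (intro eqU_lmult Cf_closed)
    from eqU_diff[OF 1 this]
    have "(\<Sum>\<gamma>\<in>insert \<delta> G. const (of_int (\<gamma> k)) * u \<gamma>) - const (of_int (\<delta> k)) * ?S \<approx> 0"
      by simp
    moreover have "(\<Sum>\<gamma>\<in>insert \<delta> G. const (of_int (\<gamma> k)) * u \<gamma>) - const (of_int (\<delta> k)) * ?S = (\<Sum>\<gamma>\<in>G. ?v \<gamma>)"
      using insert.hyps by (simp add: sum_distrib_left distrib_left sum_subtractf[symmetric] const_diff left_diff_distrib)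
    ultimately have "(\<Sum>\<gamma>\<in>G. ?v \<gamma>) \<approx> 0" by simp
    then have "?v \<gamma> \<approx> 0"
    proof (rule_tac insert.IH[OF _ _ _ g])
      show "wtv \<gamma> (?v \<gamma>) \<and> ?v \<gamma> \<in> Cf" if "\<gamma> \<in> G" for \<gamma>
        using insert.prems(1)[of \<gamma>] that by (auto intro: wtv_const Cf_closed)
    qed (use insert.prems(3) in auto)
    then have "const (1 / of_int (\<gamma> k - \<delta> k)) * ?v \<gamma> \<approx> const (1 / of_int (\<gamma> k - \<delta> k)) * 0"
      by (intro eqU_lmult Cf_closed)
    then have "const (1 / of_int (\<gamma> k - \<delta> k) * of_int (\<gamma> k - \<delta> k)) * u \<gamma> \<approx> 0"
      by (simp only: const_mult mult.assoc mult_zero_right)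
    then show ?thesis using k by simp
  qed
  have "(\<Sum>\<gamma>\<in>insert \<delta> G. u \<gamma>) - (\<Sum>\<gamma>\<in>G. u \<gamma>) \<approx> 0 - (\<Sum>\<gamma>\<in>G. 0)"
    by (intro eqU_diff insert.prems eqU_sum *)
  then have "u \<delta> \<approx> 0" using insert.hyps by simp
  then show ?case using * insert.prems by auto
qed simp

section \<open>Triangular decomposition modulo a left ideal\<close>

definition left_ideal :: "falg set \<Rightarrow> bool" where
  "left_ideal L \<longleftrightarrow> Uid \<subseteq> L \<and> L \<subseteq> Cf \<and> (\<forall>a\<in>L. \<forall>b\<in>L. a - b \<in> L) \<and> (\<forall>c\<in>Cf. \<forall>a\<in>L. c * a \<in> L)"

lemma left_ideal_Uid: "left_ideal Uid"
  by (auto simp: left_ideal_def intro: Uid_Cf Uid_diff Uid_lmult)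

lemma left_ideal_D:
  assumes "left_ideal L"
  shows "a \<in> Uid \<Longrightarrow> a \<in> L" "a \<in> L \<Longrightarrow> a \<in> Cf" "a \<in> L \<Longrightarrow> b \<in> L \<Longrightarrow> a - b \<in> L"
    "c \<in> Cf \<Longrightarrow> a \<in> L \<Longrightarrow> c * a \<in> L" "0 \<in> L" "a \<in> L \<Longrightarrow> b \<in> L \<Longrightarrow> a + b \<in> L"
proof -
  show *: "a \<in> Uid \<Longrightarrow> a \<in> L" "a \<in> L \<Longrightarrow> a \<in> Cf" "c \<in> Cf \<Longrightarrow> a \<in> L \<Longrightarrow> c * a \<in> L"
    using assms by (auto simp: left_ideal_def)
  show d: "a \<in> L \<Longrightarrow> b \<in> L \<Longrightarrow> a - b \<in> L" for a b
    using assms by (auto simp: left_ideal_def)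
  show z: "0 \<in> L" using assms Uid_0 by (auto simp: left_ideal_def)
  show "a \<in> L \<Longrightarrow> b \<in> L \<Longrightarrow> a + b \<in> L" using d[of a "0 - b"] d[OF z, of b] by simp
qed

lemma left_ideal_sum: "left_ideal L \<Longrightarrow> (\<And>x. x \<in> S \<Longrightarrow> f x \<in> L) \<Longrightarrow> sum f S \<in> L"
  by (induction S rule: infinite_finite_induct) (auto intro: left_ideal_D)

lemma left_ideal_eqU: "left_ideal L \<Longrightarrow> a \<approx> b \<Longrightarrow> b \<in> L \<Longrightarrow> a \<in> L"
  using left_ideal_D(6)[of L "a - b" b] left_ideal_D(1) by (auto simp: eqU_def)

text \<open>The elements that are, modulo \<open>L\<close>, finite sums of weight components of
  U(n^-)U(h). The parameter \<open>L\<close> is \<open>Uid\<close> for U(b^-) and an annihilator of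
  highest weight vectors for the whole enveloping algebra.\<close>

inductive dec :: "falg set \<Rightarrow> falg \<Rightarrow> bool" for L where
  dec_Z: "Z \<gamma> a \<Longrightarrow> dec L a"
| dec_add: "dec L a \<Longrightarrow> dec L b \<Longrightarrow> dec L (a + b)"
| dec_eq: "dec L a \<Longrightarrow> a' \<in> Cf \<Longrightarrow> a' - a \<in> L \<Longrightarrow> dec L a'"

lemma dec_Cf: "dec L a \<Longrightarrow> a \<in> Cf"
  by (induction rule: dec.induct) (auto intro: Z_Cf Cf_closed)

lemma dec_lmult:
  assumes "dec L a" "left_ideal L" "c \<in> Cf" "\<And>\<gamma> a. Z \<gamma> a \<Longrightarrow> dec L (c * a)"
  shows "dec L (c * a)"
  using assms(1)
proof (induction rule: dec.induct)
  case (dec_add a b)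
  then show ?case by (simp add: distrib_left dec.dec_add)
next
  case (dec_eq a a')
  have "c * (a' - a) \<in> L" using dec_eq assms by (intro left_ideal_D(4)) auto
  then show ?case
    using dec_eq assms by (intro dec.dec_eq[OF dec_eq.IH] Cf_closed) (auto simp: algebra_simps)
qed (rule assms(4))

text \<open>Summands of equal weight are collected, so that every weight occurs once, as
  \<open>wtv_indep\<close> requires.\<close>

lemma dec_family:
  assumes "dec L a" "left_ideal L"
  shows "\<exists>G u. finite G \<and> (\<forall>\<gamma>. Z \<gamma> (u \<gamma>)) \<and> a - (\<Sum>\<gamma>\<in>G. u \<gamma>) \<in> L"
  using assms(1)
proof (induction rule: dec.induct)
  case (dec_Z \<gamma> a)
  let ?u = "\<lambda>\<delta>. if \<delta> = \<gamma> then a else 0"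
  show ?case
    using dec_Z left_ideal_D(5)[OF assms(2)]
    by (intro exI[of _ "{\<gamma>}"] exI[of _ ?u]) (auto intro: Z_0)
next
  case (dec_add a b)
  then obtain G u G' u' where
    1: "finite G" "\<And>\<gamma>. Z \<gamma> (u \<gamma>)" "a - (\<Sum>\<gamma>\<in>G. u \<gamma>) \<in> L"
    and 2: "finite G'" "\<And>\<gamma>. Z \<gamma> (u' \<gamma>)" "b - (\<Sum>\<gamma>\<in>G'. u' \<gamma>) \<in> L"
    by blast
  define w where "w \<gamma> = (if \<gamma> \<in> G then u \<gamma> else 0) + (if \<gamma> \<in> G' then u' \<gamma> else 0)" for \<gamma>
  have "(\<Sum>\<gamma>\<in>G \<union> G'. w \<gamma>) = (\<Sum>\<gamma>\<in>G. u \<gamma>) + (\<Sum>\<gamma>\<in>G'. u' \<gamma>)"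
    using 1(1) 2(1) unfolding w_def sum.distrib
    by (simp add: sum.If_cases Int_absorb1)
  then have "a + b - (\<Sum>\<gamma>\<in>G \<union> G'. w \<gamma>) \<in> L"
    using left_ideal_D(6)[OF assms(2) 1(3) 2(3)] by (simp add: algebra_simps)
  moreover have "Z \<gamma> (w \<gamma>)" for \<gamma>
    unfolding w_def using 1(2) 2(2) by (intro Z_add) (auto intro: Z_0)
  ultimately show ?case using 1(1) 2(1) by blast
next
  case (dec_eq a a')
  then obtain G u where 1: "finite G" "\<And>\<gamma>. Z \<gamma> (u \<gamma>)" "a - (\<Sum>\<gamma>\<in>G. u \<gamma>) \<in> L"
    by blast
  have "a' - (\<Sum>\<gamma>\<in>G. u \<gamma>) \<in> L"
    using left_ideal_D(6)[OF assms(2) dec_eq(3) 1(3)] by simp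
  then show ?case using 1 by blast
qed

lemma dec_sum: "(\<And>x. x \<in> S \<Longrightarrow> dec L (f x)) \<Longrightarrow> dec L (sum f S)"
  by (induction S rule: infinite_finite_induct) (auto intro: dec_add dec_Z[OF Z_0])

lemma dec_const: "dec L a \<Longrightarrow> left_ideal L \<Longrightarrow> dec L (const c * a)"
  by (rule dec_lmult) (auto intro: Cf_closed dec_Z Z_const)

lemma dec_gen_mult:
  assumes X: "X \<in> gl m n" and L: "left_ideal L" and a: "dec L a"
    and e: "\<And>i j. i \<in> Ix \<Longrightarrow> j \<in> Ix \<Longrightarrow> X i j \<noteq> 0 \<Longrightarrow> dec L (e i j * a)"
  shows "dec L (gen X * a)"
proof -
  have "gen X * a - (\<Sum>i\<in>Ix. \<Sum>j\<in>Ix. const (X i j) * e i j) * a \<in> Uid"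
    using Uid_rmult[OF gen_expand[OF X] dec_Cf[OF a]] by (simp add: left_diff_distrib)
  then have 1: "gen X * a - (\<Sum>i\<in>Ix. \<Sum>j\<in>Ix. const (X i j) * (e i j * a)) \<in> L"
    using left_ideal_D(1)[OF L] by (simp add: sum_distrib_right mult.assoc)
  have "dec L (\<Sum>i\<in>Ix. \<Sum>j\<in>Ix. const (X i j) * (e i j * a))"
  proof (intro dec_sum)
    fix i j assume "i \<in> Ix" "j \<in> Ix"
    then show "dec L (const (X i j) * (e i j * a))"
      using e[of i j] dec_const[OF _ L] by (cases "X i j = 0") (auto intro: dec_Z[OF Z_0])
  qed
  then show ?thesis
    using 1 X dec_Cf[OF a] by (rule_tac dec_eq) (auto intro: Cf_closed free_alg_gen_closed)
qed

lemma dec_e_low: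
  assumes "left_ideal L" "dec L a" "i \<in> Ix" "j \<in> Ix" "j \<le> i"
  shows "dec L (e i j * a)"
proof (rule dec_lmult[OF assms(2,1)])
  show "dec L (e i j * b)" if "Z \<gamma> b" for \<gamma> b
    using that assms Z_diag[of \<gamma> b i] Z_lower[of \<gamma> b j i] by (cases "i = j") (auto intro: dec_Z)
qed (use assms in auto)

text \<open>The factor \<open>e i j\<close> is moved to the right through the word. Each bracket
  yields another matrix unit in front of a shorter word; since it can be of any type, the induction
  covers all \<open>i\<close> and \<open>j\<close>. At the right end a raising unit is absorbed by
  \<open>L\<close>.\<close>

lemma dec_raise_word:
  assumes L: "left_ideal L"
    and raise: "\<And>i j x f. i \<in> Ix \<Longrightarrow> j \<in> Ix \<Longrightarrow> i < j \<Longrightarrow> hrel Ix x f \<Longrightarrow> e i j * x \<in> L"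
  shows "negw ps \<Longrightarrow> hrel Ix x f \<Longrightarrow> i \<in> Ix \<Longrightarrow> j \<in> Ix \<Longrightarrow> dec L (e i j * (wd ps * x))"
proof (induction ps arbitrary: i j)
  case Nil
  have x: "dec L x" using Nil by (intro dec_Z[of "wtw []"] Z_base[of "[]", simplified]) auto
  show ?case
  proof (cases "j \<le> i")
    case True
    then show ?thesis using dec_e_low[OF L x] Nil by simp
  next
    case False
    then have "e i j * x - 0 \<in> L" using raise Nil by simp
    then show ?thesis using Nil left_ideal_D(2)[OF L] by (intro dec_eq[OF dec_Z[OF Z_0]]) auto
  qed
next
  case (Cons p ps)
  obtain b a where p: "p = (b, a)" by force
  have ba: "a < b" "a \<in> Ix" "b \<in> Ix" "negw ps" using Cons.prems p by auto
  let ?y = "wd ps * x" and ?s = "sgn2 i j b a"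
  have y: "?y \<in> Cf" using ba Cons.prems by (intro Cf_closed wd_Cf hrel_Cf[of Ix]) auto
  have "(e i j * e b a) * ?y \<approx> (const ?s * (e b a * e i j)
     + ((if j = b then e i a else 0) - (if i = a then const ?s * e b j else 0))) * ?y"
    using y ba Cons.prems by (intro eqU_rmult e_swap) auto
  then have 1: "e i j * (wd (p # ps) * x) \<approx> const ?s * (e b a * (e i j * ?y))
     + ((if j = b then e i a * ?y else 0) + const (- ?s) * (if i = a then e b j * ?y else 0))"
    by (auto simp: p algebra_simps const_uminus)
  have z: "dec L 0" by (rule dec_Z[OF Z_0])
  have "dec L (const ?s * (e b a * (e i j * ?y))
     + ((if j = b then e i a * ?y else 0) + const (- ?s) * (if i = a then e b j * ?y else 0)))"
  proof (rule dec_add[OF dec_const[OF dec_e_low[OF L] L] dec_add[OF _ dec_const[OF _ L]]])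
    show "dec L (e i j * ?y)" using Cons.IH ba Cons.prems by auto
    show "dec L (if j = b then e i a * ?y else 0)" using Cons.IH z ba Cons.prems by auto
    show "dec L (if i = a then e b j * ?y else 0)" using Cons.IH z ba Cons.prems by auto
  qed (use ba in auto)
  then show ?case
    using 1 y p ba Cons.prems left_ideal_D(1)[OF L]
    by (rule_tac dec_eq) (auto simp: eqU_def mult.assoc intro!: Cf_closed)
qed

text \<open>The decomposition of the enveloping algebra as U(n^-)U(h) plus the left ideal generated
  by n^+, in the form that survives modulo \<open>L\<close>.\<close>

lemma dec_all:
  assumes L: "left_ideal L"
    and raise: "\<And>i j x f. i \<in> Ix \<Longrightarrow> j \<in> Ix \<Longrightarrow> i < j \<Longrightarrow> hrel Ix x f \<Longrightarrow> e i j * x \<in> L"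
    and a: "a \<in> Cf"
  shows "dec L a"
  using a
proof (induction rule: free_alg_induct)
  case (const c)
  then show ?case using hrel_const by (intro dec_Z[of "wtw []"] Z_base[of "[]", simplified]) auto
next
  case (add a b)
  then show ?case by (intro dec_add)
next
  case (gen X a)
  show ?case
  proof (rule dec_gen_mult[OF gen(1) L gen(3)])
    fix i j assume ij: "i \<in> Ix" "j \<in> Ix"
    show "dec L (e i j * a)"
    proof (rule dec_lmult[OF gen(3) L])
      show "dec L (e i j * b)" if "Z \<gamma> b" for \<gamma> b
        using that
      proof (induction rule: Z.induct)
        case (Z_base ps x f)
        show ?case by (rule dec_raise_word[OF L _ Z_base(1,3) ij]) (rule raise)
      next
        case (Z_eq b b')
        have "e i j * b' - e i j * b \<in> L"
          using eqU_lmult[OF Z_eq(3) e_Cf[OF ij]] left_ideal_D(1)[OF L] by (simp add: eqU_def)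
        then show ?case using Z_eq ij by (intro dec_eq[OF Z_eq.IH] Cf_closed) auto
      qed (auto simp: distrib_left intro: dec_add dec_Z[OF Z_0])
    qed (use ij in auto)
  qed
qed

section \<open>Straightening\<close>

text \<open>The span of the chains from \<open>a\<close> to \<open>b\<close> modulo
  \<open>Uid\<close>, with chains prolonged at their lower end, which is the right end of the
  product.\<close>

inductive csp :: "int \<Rightarrow> int \<Rightarrow> falg \<Rightarrow> bool" for b where
  csp_base: "csp b a (e b a)"
| csp_step: "a < j \<Longrightarrow> j < b \<Longrightarrow> j \<in> Ix \<Longrightarrow> csp b j x \<Longrightarrow> csp b a (x * e j a)"
| csp_add: "csp b a x \<Longrightarrow> csp b a y \<Longrightarrow> csp b a (x + y)"
| csp_scal: "csp b a x \<Longrightarrow> csp b a (const c * x)"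
| csp_eq: "csp b a x \<Longrightarrow> x' \<approx> x \<Longrightarrow> csp b a x'"

lemma csp_diff: "csp b a x \<Longrightarrow> csp b a y \<Longrightarrow> csp b a (x - y)"
  using csp_add[OF _ csp_scal[of b a y "-1"], of x] by (simp add: const_uminus)

lemma csp_0: "csp b a 0"
  using csp_scal[OF csp_base[of b a], of 0] by simp

text \<open>Heads exceed their tails, so no factor has \<open>a\<close> as its head and nothing
  compensates the contributions of the tails.\<close>

lemma wtw_min:
  assumes "negw ps" "\<And>x. x \<in> snd ` set ps \<Longrightarrow> a \<le> x"
  shows "wtw ps a = - int (length (filter (\<lambda>p. snd p = a) ps))"
  using assms
proof (induction ps)
  case (Cons p ps)
  then have "wtw ps a = - int (length (filter (\<lambda>p. snd p = a) ps))" by (cases p) auto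
  moreover have "a \<le> snd p" "snd p < fst p" using Cons.prems by (cases p; auto)+
  ultimately show ?case by (cases p) (auto simp: rt_def)
qed simp

text \<open>Pairing a weight with the index itself serves as a height. It is positive on nonempty
  words, which forces \<open>j < b\<close> in \<open>straighten\<close>.\<close>

lemma ht_rt:
  assumes "a \<in> Ix" "b \<in> Ix"
  shows "(\<Sum>k\<in>Ix. k * rt b a k) = b - a"
proof -
  have "(\<Sum>k\<in>Ix. k * rt b a k) = (\<Sum>k\<in>Ix. if k = b then b else 0) - (\<Sum>k\<in>Ix. if k = a then a else 0)"
    unfolding sum_subtractf[symmetric] by (rule sum.cong) (auto simp: rt_def)
  then show ?thesis using assms by simp
qed

lemma ht_wtw:
  assumes "negw ps"
  shows "(\<Sum>k\<in>Ix. k * wtw ps k) = (\<Sum>(b, a)\<leftarrow>ps. b - a)"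
  using assms
proof (induction ps)
  case (Cons p ps)
  obtain b a where p: "p = (b, a)" by force
  then show ?case using Cons by (simp add: distrib_left sum.distrib ht_rt)
qed simp

lemma ht_pos: "negw ps \<Longrightarrow> ps \<noteq> [] \<Longrightarrow> 0 < (\<Sum>(b, a)\<leftarrow>ps. b - a)"
proof (induction ps)
  case (Cons p ps)
  then show ?case by (cases p; cases ps) force+
qed simp

text \<open>In a word of weight \<open>rt b a\<close> the smallest index \<open>a\<close> occurs in exactly one factor, and only as its tail.
  Moving this factor to the right produces shorter words of the same weight; once it is the last
  factor, the remaining word has weight \<open>rt b j\<close>.\<close>

lemma straighten:
  assumes "negw ps" "wtw ps = rt b a" "a \<in> Ix" "b \<in> Ix" "a < b"
  shows "csp b a (wd ps)"
  using assms
proof (induction "length ps" arbitrary: ps a rule: less_induct)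
  case less
  have inner: "csp b a (wd (ps1 @ (j, a) # ps2))"
    if "length (ps1 @ (j, a) # ps2) = length ps" "negw (ps1 @ (j, a) # ps2)"
      "wtw (ps1 @ (j, a) # ps2) = rt b a" "\<And>x. x \<in> snd ` set (ps1 @ ps2) \<Longrightarrow> a < x"
    for ps1 j ps2
    using that
  proof (induction ps2 arbitrary: ps1 j)
    case Nil
    have w: "wtw ps1 = rt b j"
    proof
      fix k
      have "wtw ps1 k + rt j a k = rt b a k" using fun_cong[OF Nil(3), of k] by (simp add: wtw_append)
      then show "wtw ps1 k = rt b j k" using rt_add[of b j k a] by simp
    qed
    have n: "negw ps1" and j: "a < j" "j \<in> Ix" using Nil by auto
    \<comment> \<open>The height decides between an empty and a nonempty remaining word.\<close>
    have ht: "(\<Sum>(b, a)\<leftarrow>ps1. b - a) = b - j"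
      using ht_wtw[OF n] ht_rt[OF j(2) less.prems(4)] w by simp
    show ?case
    proof (cases "ps1 = []")
      case True
      then have "b = j" using ht by simp
      then show ?thesis using True csp_base by simp
    next
      case False
      then have "j < b" using ht ht_pos[OF n] by simp
      then show ?thesis
        using less.hyps[of ps1 j] Nil n w j less.prems by (auto intro!: csp_step)
    qed
  next
    case (Cons p ps2)
    obtain d c where p: "p = (d, c)" by force
    have ix: "j \<in> Ix" "a \<in> Ix" "d \<in> Ix" "c \<in> Ix" "a < j" "c < d" "a < c" "negw ps1" "negw ps2"
      using Cons.prems p by auto
    let ?s = "sgn2 j a d c"
    \<comment> \<open>The other contraction in \<open>e_swap\<close> would require
      \<open>a = d\<close>, which \<open>a < c < d\<close> excludes.\<close>
    have "e j a * e d c \<approx> const ?s * (e d c * e j a) - (if j = c then const ?s * e d a else 0)"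
      using e_swap[of j a d c] ix by simp
    then have "wd ps1 * (e j a * e d c) * wd ps2 \<approx>
        wd ps1 * (const ?s * (e d c * e j a) - (if j = c then const ?s * e d a else 0)) * wd ps2"
      using ix by (intro eqU_lmult eqU_rmult wd_Cf)
    then have 1: "wd (ps1 @ (j, a) # p # ps2) \<approx> const ?s * wd ((ps1 @ [p]) @ (j, a) # ps2)
        - const ?s * (if j = c then wd (ps1 @ (d, a) # ps2) else 0)"
      by (auto simp: p algebra_simps const_mult_left_comm)
    have "csp b a (wd ((ps1 @ [p]) @ (j, a) # ps2))"
    proof (rule Cons.IH)
      show "wtw ((ps1 @ [p]) @ (j, a) # ps2) = rt b a"
      proof
        fix k show "wtw ((ps1 @ [p]) @ (j, a) # ps2) k = rt b a k"
          using fun_cong[OF Cons.prems(3), of k] by (simp add: wtw_append p)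
      qed
    qed (use Cons.prems ix p in auto)
    moreover have "csp b a (wd (ps1 @ (d, a) # ps2))" if "j = c"
    proof (rule less.hyps)
      show "wtw (ps1 @ (d, a) # ps2) = rt b a"
      proof
        fix k show "wtw (ps1 @ (d, a) # ps2) k = rt b a k"
          using fun_cong[OF Cons.prems(3), of k] rt_add[of d j k a] that by (simp add: wtw_append p)
      qed
    qed (use Cons.prems(1,2) less.prems ix that p in auto)
    ultimately have "csp b a (const ?s * wd ((ps1 @ [p]) @ (j, a) # ps2)
        - const ?s * (if j = c then wd (ps1 @ (d, a) # ps2) else 0))"
      by (intro csp_diff csp_scal) (auto intro: csp_0 simp del: wd_simps)
    then show ?case using 1 by (rule csp_eq)
  qed
  have "wtw ps b = 1" using less.prems(2,5) by (simp add: rt_def)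
  then have ne: "ps \<noteq> []" by auto
  define mn where "mn = Min (snd ` set ps)"
  have mn: "mn \<in> snd ` set ps" "\<And>x. x \<in> snd ` set ps \<Longrightarrow> mn \<le> x"
    using ne unfolding mn_def by auto
  have cnt: "rt b a mn = - int (length (filter (\<lambda>p. snd p = mn) ps))"
    using wtw_min[OF less.prems(1) mn(2)] less.prems(2) by simp
  obtain ps1 p ps2 where split: "ps = ps1 @ p # ps2" "snd p = mn"
    using mn(1) by (auto dest: split_list)
  then have "rt b a mn < 0" using cnt by simp
  \<comment> \<open>The root \<open>rt b a\<close> is negative at \<open>a\<close> only.\<close>
  then have a: "mn = a" using less.prems(5) by (auto simp: rt_def split: if_splits)
  have "length (filter (\<lambda>p. snd p = a) ps) = 1" using cnt a less.prems(5) by (simp add: rt_def)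
  then have "filter (\<lambda>p. snd p = a) (ps1 @ ps2) = []" using split a by auto
  then have tails: "a < x" if x: "x \<in> snd ` set (ps1 @ ps2)" for x
  proof -
    obtain y where y: "y \<in> set (ps1 @ ps2)" "x = snd y" using x by blast
    then have "snd y \<noteq> a" using \<open>filter _ _ = []\<close> unfolding filter_empty_conv by blast
    moreover have "y \<in> set ps" using y split(1) by auto
    ultimately show ?thesis using mn(2)[of "snd y"] a y by auto
  qed
  have ps: "ps = ps1 @ (fst p, a) # ps2" using split a by (cases p) auto
  have "csp b a (wd (ps1 @ (fst p, a) # ps2))"
    by (rule inner) (use ps less.prems tails in \<open>simp_all del: set_append\<close>)
  then show ?case using ps by simp
qed

lemma csp_sum:
  assumes "csp b a x" "a \<in> Ix" "b \<in> Ix"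
  shows "\<exists>c. x \<approx> (\<Sum>J\<in>Pow {k \<in> Ix. a < k \<and> k < b}. const (c J) * ech b a (sorted_list_of_set J))"
  using assms(1,2)
proof (induction rule: csp.induct)
  case (csp_base a)
  have "(\<Sum>J\<in>Pow {k \<in> Ix. a < k \<and> k < b}. const (of_bool (J = {})) * ech b a (sorted_list_of_set J))
      = (\<Sum>J\<in>Pow {k \<in> Ix. a < k \<and> k < b}. if J = {} then e b a else 0)"
    by (rule sum.cong) auto
  then show ?case by (intro exI[of _ "\<lambda>J. of_bool (J = {})"]) (simp add: sum.delta)
next
  case (csp_step a j x)
  let ?P = "\<lambda>a. Pow {k \<in> Ix. a < k \<and> k < b}"
  from csp_step obtain c where c: "x \<approx> (\<Sum>J\<in>?P j. const (c J) * ech b j (sorted_list_of_set J))"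
    by blast
  \<comment> \<open>The coefficients are transported to the sets whose least element is
    \<open>j\<close>.\<close>
  define c' where "c' J = (if j \<in> J \<and> J - {j} \<subseteq> {j<..} then c (J - {j}) else 0)" for J
  have "x * e j a \<approx> (\<Sum>J\<in>?P j. const (c J) * ech b j (sorted_list_of_set J)) * e j a"
    using csp_step by (intro eqU_rmult c) auto
  also have "\<dots> = (\<Sum>J\<in>?P j. const (c' (insert j J)) * ech b a (sorted_list_of_set (insert j J)))"
    unfolding sum_distrib_right
  proof (rule sum.cong[OF refl])
    fix J assume J: "J \<in> ?P j"
    then have fin: "finite J" by (auto intro: finite_subset[OF _ finite_Ix])
    have "j \<notin> J" using J by auto
    then have "sorted_list_of_set (insert j J) = j # sorted_list_of_set J"
      using J fin by (intro sorted_list_of_set_unique[THEN iffD1])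
        (auto simp: sorted_list_of_set.sorted_key_list_of_set_inject)
    moreover have "insert j J - {j} = J" using J by auto
    ultimately show "const (c J) * ech b j (sorted_list_of_set J) * e j a
        = const (c' (insert j J)) * ech b a (sorted_list_of_set (insert j J))"
      using J by (auto simp: c'_def mult.assoc)
  qed
  also have "\<dots> = (\<Sum>J\<in>insert j ` ?P j. const (c' J) * ech b a (sorted_list_of_set J))"
    by (subst sum.reindex) (auto simp: inj_on_def)
  also have "\<dots> = (\<Sum>J\<in>?P a. const (c' J) * ech b a (sorted_list_of_set J))"
  proof (rule sum.mono_neutral_left)
    show "\<forall>J\<in>?P a - insert j ` ?P j. const (c' J) * ech b a (sorted_list_of_set J) = 0"
    proof
      fix J assume J: "J \<in> ?P a - insert j ` ?P j"
      have "c' J = 0"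
      proof (rule ccontr)
        assume "c' J \<noteq> 0"
        then have "j \<in> J" "J - {j} \<in> ?P j" using J by (auto simp: c'_def split: if_splits)
        then have "J = insert j (J - {j})" by auto
        then show False using J \<open>J - {j} \<in> ?P j\<close> by blast
      qed
      then show "const (c' J) * ech b a (sorted_list_of_set J) = 0" by simp
    qed
  qed (use csp_step in \<open>auto\<close>)
  finally show ?case by blast
next
  case (csp_add a x y)
  then obtain c d where
    "x \<approx> (\<Sum>J\<in>Pow {k \<in> Ix. a < k \<and> k < b}. const (c J) * ech b a (sorted_list_of_set J))"
    "y \<approx> (\<Sum>J\<in>Pow {k \<in> Ix. a < k \<and> k < b}. const (d J) * ech b a (sorted_list_of_set J))"
    by blast
  from eqU_add[OF this] show ?case
    by (intro exI[of _ "\<lambda>J. c J + d J"]) (simp add: const_add distrib_right sum.distrib)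
next
  case (csp_scal a x d)
  then obtain c where
    "x \<approx> (\<Sum>J\<in>Pow {k \<in> Ix. a < k \<and> k < b}. const (c J) * ech b a (sorted_list_of_set J))"
    by blast
  from eqU_lmult[OF this, of "const d"] show ?case
    by (intro exI[of _ "\<lambda>J. d * c J"]) (simp add: const_mult mult.assoc sum_distrib_left Cf_closed)
next
  case (csp_eq a x x')
  then show ?case using eqU_trans by blast
qed

end

section \<open>Verma modules as quotients of the free algebra\<close>

context super_gl begin

lemma ring_U: "ring (U m n)"
  unfolding U_def by (rule ideal.quotient_is_ring[OF ideal_Uid])

lemma U_cls_hom: "(\<lambda>a. cls a) \<in> ring_hom (free_alg (gl m n)) (U m n)"
  unfolding U_def by (rule ideal.rcos_ring_hom[OF ideal_Uid])

lemma cls_closed: "a \<in> Cf \<Longrightarrow> cls a \<in> carrier (U m n)"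
  using ring_hom_closed[OF U_cls_hom] .

lemma U_cases:
  assumes "X \<in> carrier (U m n)"
  obtains a where "a \<in> Cf" "X = cls a"
proof -
  have "X \<in> a_rcosets\<^bsub>free_alg (gl m n)\<^esub> Uid" using assms by (simp add: U_def FactRing_def)
  then show ?thesis using that unfolding A_RCOSETS_def' by blast
qed

lemma cls_mult: "a \<in> Cf \<Longrightarrow> b \<in> Cf \<Longrightarrow> cls a \<otimes>\<^bsub>U m n\<^esub> cls b = cls (a * b)"
  using ring_hom_mult[OF U_cls_hom, of a b] by simp

lemma cls_add: "a \<in> Cf \<Longrightarrow> b \<in> Cf \<Longrightarrow> cls a \<oplus>\<^bsub>U m n\<^esub> cls b = cls (a + b)"
  using ring_hom_add[OF U_cls_hom, of a b] by simp

lemma cls_one: "\<one>\<^bsub>U m n\<^esub> = cls 1"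
  using ring_hom_one[OF U_cls_hom] by simp

lemma cls_zero: "\<zero>\<^bsub>U m n\<^esub> = cls 0"
  using ring_hom_zero[OF U_cls_hom ring_free_alg ring_U] by simp

lemma cls_uminus:
  assumes "a \<in> Cf"
  shows "\<ominus>\<^bsub>U m n\<^esub> cls a = cls (- a)"
proof -
  interpret ring "U m n" by (rule ring_U)
  have "- a \<in> Cf" using assms by (rule Cf_closed)
  then have "cls (- a) \<oplus>\<^bsub>U m n\<^esub> cls a = \<zero>\<^bsub>U m n\<^esub>"
    using assms by (simp add: cls_add cls_zero)
  then show ?thesis using minus_equality cls_closed assms \<open>- a \<in> Cf\<close> by blast
qed

lemma cls_minus: "a \<in> Cf \<Longrightarrow> b \<in> Cf \<Longrightarrow> cls a \<ominus>\<^bsub>U m n\<^esub> cls b = cls (a - b)"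
  by (simp add: a_minus_def cls_uminus cls_add Cf_closed)

lemma cls_eq: "a \<in> Cf \<Longrightarrow> b \<in> Cf \<Longrightarrow> cls a = cls b \<longleftrightarrow> a \<approx> b"
  using ring.quotient_eq_iff_same_a_r_cos[OF ring_free_alg ideal_Uid, of a b]
  by (simp add: eqU_def free_alg_a_minus)

lemma cls_finsum:
  assumes "finite S" "\<And>x. x \<in> S \<Longrightarrow> f x \<in> Cf"
  shows "(\<Oplus>\<^bsub>U m n\<^esub>x\<in>S. cls (f x)) = cls (\<Sum>x\<in>S. f x)"
proof -
  interpret ring "U m n" by (rule ring_U)
  show ?thesis
    using assms
  proof (induction S rule: finite_induct)
    case (insert x S)
    have "(\<Oplus>\<^bsub>U m n\<^esub>x\<in>insert x S. cls (f x)) = cls (f x) \<oplus>\<^bsub>U m n\<^esub> (\<Oplus>\<^bsub>U m n\<^esub>x\<in>S. cls (f x))"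
      using insert by (intro finsum_insert) (auto simp: cls_closed)
    then show ?case using insert by (simp add: cls_add Cf_closed)
  qed (simp add: cls_zero)
qed

lemma emb_cls: "emb m n X = cls (gen X)" and scal_cls: "scal m n c = cls (const c)"
  and E_cls: "E m n i j = cls (e i j)"
  by (simp_all add: emb_def scal_def E_def e_def)

lemma b_plus_gl: "X \<in> b_plus m n \<Longrightarrow> X \<in> gl m n"
  and b_minus_gl: "X \<in> b_minus m n \<Longrightarrow> X \<in> gl m n"
  and n_plus_gl: "X \<in> n_plus m n \<Longrightarrow> X \<in> gl m n"
  and cartan_gl: "X \<in> cartan m n \<Longrightarrow> X \<in> gl m n"
  by (auto simp: b_plus_def b_minus_def n_plus_def cartan_def)

lemma gen_Cf: "X \<in> gl m n \<Longrightarrow> gen X \<in> Cf"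
  by (rule free_alg_gen_closed)

text \<open>The preimage in the free algebra of the annihilator of the highest weight vector.\<close>

definition Lv :: "weight \<Rightarrow> falg set" where "Lv \<nu> = {a \<in> Cf. cls a \<in> verma_rel m n \<nu>}"

definition verma_gens :: "weight \<Rightarrow> env set" where
  "verma_gens \<nu> = {u \<otimes>\<^bsub>U m n\<^esub> emb m n x \<ominus>\<^bsub>U m n\<^esub> u \<otimes>\<^bsub>U m n\<^esub> scal m n (wt_eval m n \<nu> x)
        | u x. u \<in> carrier (U m n) \<and> x \<in> b_plus m n}"

lemma verma_rel_eq: "verma_rel m n \<nu> = generate (add_monoid (U m n)) (verma_gens \<nu>)"
  by (simp add: verma_rel_def verma_gens_def)

lemma verma_gen_cls:
  "a \<in> Cf \<Longrightarrow> x \<in> b_plus m n \<Longrightarrow>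
   cls a \<otimes>\<^bsub>U m n\<^esub> emb m n x \<ominus>\<^bsub>U m n\<^esub> cls a \<otimes>\<^bsub>U m n\<^esub> scal m n (wt_eval m n \<nu> x)
   = cls (a * (gen x - const (wt_eval m n \<nu> x)))"
  by (simp add: emb_cls scal_cls cls_mult cls_minus gen_Cf b_plus_gl Cf_closed right_diff_distrib)

lemma verma_gens_cls:
  "verma_gens \<nu> = {cls (a * (gen x - const (wt_eval m n \<nu> x))) | a x. a \<in> Cf \<and> x \<in> b_plus m n}"
proof (intro equalityI subsetI)
  fix X assume "X \<in> verma_gens \<nu>"
  then obtain u x where *: "u \<in> carrier (U m n)" "x \<in> b_plus m n"
    "X = u \<otimes>\<^bsub>U m n\<^esub> emb m n x \<ominus>\<^bsub>U m n\<^esub> u \<otimes>\<^bsub>U m n\<^esub> scal m n (wt_eval m n \<nu> x)"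
    by (auto simp: verma_gens_def)
  obtain a where "a \<in> Cf" "u = cls a" using *(1) by (rule U_cases)
  then show "X \<in> {cls (a * (gen x - const (wt_eval m n \<nu> x))) | a x. a \<in> Cf \<and> x \<in> b_plus m n}"
    using * verma_gen_cls by blast
next
  fix X assume "X \<in> {cls (a * (gen x - const (wt_eval m n \<nu> x))) | a x. a \<in> Cf \<and> x \<in> b_plus m n}"
  then show "X \<in> verma_gens \<nu>"
    unfolding verma_gens_def using verma_gen_cls[symmetric] cls_closed by blast
qed

lemma verma_gens_closed: "verma_gens \<nu> \<subseteq> carrier (U m n)"
  unfolding verma_gens_cls by (auto intro!: cls_closed Cf_closed gen_Cf b_plus_gl)

lemma verma_rel_subgroup: "subgroup (verma_rel m n \<nu>) (add_monoid (U m n))"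
  unfolding verma_rel_eq
  using group.generate_is_subgroup[OF abelian_group.a_group[OF ring.is_abelian_group[OF ring_U]]]
    verma_gens_closed by simp

lemma abelian_subgroup_verma_rel: "abelian_subgroup (verma_rel m n \<nu>) (U m n)"
  by (intro abelian_subgroupI3 additive_subgroupI verma_rel_subgroup ring.is_abelian_group[OF ring_U])

text \<open>The inverse case of \<open>generate\<close> is absorbed: minus a generator is the
  generator belonging to \<open>- a\<close>.\<close>

lemma verma_rel_induct [consumes 1, case_names zero gen add]:
  assumes "X \<in> verma_rel m n \<nu>"
    and "P (cls 0)"
    and "\<And>a x. a \<in> Cf \<Longrightarrow> x \<in> b_plus m n \<Longrightarrow> P (cls (a * (gen x - const (wt_eval m n \<nu> x))))"
    and "\<And>a b. a \<in> Cf \<Longrightarrow> b \<in> Cf \<Longrightarrow> P (cls a) \<Longrightarrow> P (cls b) \<Longrightarrow> P (cls (a + b))"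
  shows "P X"
proof -
  have "X \<in> carrier (U m n) \<and> P X"
    using assms(1) unfolding verma_rel_eq
  proof (induction rule: generate.induct)
    case one
    then show ?case using assms(2) cls_zero cls_closed[OF Cf_closed(6)] by simp
  next
    case (incl h)
    then show ?case using assms(3) verma_gens_closed unfolding verma_gens_cls by blast
  next
    case (inv h)
    then obtain a x where h: "h = cls (a * (gen x - const (wt_eval m n \<nu> x)))" "a \<in> Cf" "x \<in> b_plus m n"
      unfolding verma_gens_cls by blast
    have cf: "a * (gen x - const (wt_eval m n \<nu> x)) \<in> Cf"
      using h by (auto intro!: Cf_closed gen_Cf b_plus_gl)
    have "inv\<^bsub>add_monoid (U m n)\<^esub> h = cls ((- a) * (gen x - const (wt_eval m n \<nu> x)))"
      using cls_uminus[OF cf] h(1) by (simp add: a_inv_def)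
    then show ?case using assms(3)[of "- a" x] h cf by (auto intro!: cls_closed Cf_closed gen_Cf b_plus_gl)
  next
    case (eng h1 h2)
    then obtain a b where ab: "a \<in> Cf" "h1 = cls a" "b \<in> Cf" "h2 = cls b" by (metis U_cases)
    then show ?case using eng assms(4)[of a b] by (auto simp: cls_add intro!: cls_closed Cf_closed)
  qed
  then show ?thesis by simp
qed

lemma verma_rel_add: "X \<in> verma_rel m n \<nu> \<Longrightarrow> Y \<in> verma_rel m n \<nu> \<Longrightarrow> X \<oplus>\<^bsub>U m n\<^esub> Y \<in> verma_rel m n \<nu>"
  using subgroup.m_closed[OF verma_rel_subgroup] by simp

lemma verma_rel_uminus: "X \<in> verma_rel m n \<nu> \<Longrightarrow> \<ominus>\<^bsub>U m n\<^esub> X \<in> verma_rel m n \<nu>"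
  using subgroup.m_inv_closed[OF verma_rel_subgroup] by (simp add: a_inv_def)

lemma Lv_Cf: "a \<in> Lv \<nu> \<Longrightarrow> a \<in> Cf"
  by (simp add: Lv_def)

lemma Lv_gen: "a \<in> Cf \<Longrightarrow> x \<in> b_plus m n \<Longrightarrow> a * (gen x - const (wt_eval m n \<nu> x)) \<in> Lv \<nu>"
  unfolding Lv_def verma_rel_eq
  by (auto intro!: generate.incl Cf_closed gen_Cf b_plus_gl) (auto simp: verma_gens_cls)

text \<open>The relations are generated as an additive group only, but the set of generators is
  stable under left multiplication.\<close>

lemma left_ideal_Lv: "left_ideal (Lv \<nu>)"
  unfolding left_ideal_def
proof (intro conjI ballI subsetI)
  show "a \<in> Lv \<nu>" if "a \<in> Uid" for a
  proof -
    have "cls a = \<zero>\<^bsub>U m n\<^esub>" using that Uid_Cf by (simp add: cls_zero cls_eq eqU_0 Cf_closed)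
    then show ?thesis using that Uid_Cf subgroup.one_closed[OF verma_rel_subgroup[of \<nu>]]
      by (simp add: Lv_def)
  qed
  show "a - b \<in> Lv \<nu>" if "a \<in> Lv \<nu>" "b \<in> Lv \<nu>" for a b
    using that verma_rel_add[of "cls a" \<nu> "\<ominus>\<^bsub>U m n\<^esub> cls b"] verma_rel_uminus[of "cls b" \<nu>]
    by (auto simp: Lv_def cls_uminus cls_add Cf_closed)
  show "c * a \<in> Lv \<nu>" if c: "c \<in> Cf" and a: "a \<in> Lv \<nu>" for c a
  proof -
    interpret ring "U m n" by (rule ring_U)
    have "cls c \<otimes>\<^bsub>U m n\<^esub> X \<in> verma_rel m n \<nu>" if "X \<in> verma_rel m n \<nu>" for X
      using that
    proof (induction rule: verma_rel_induct)
      case zero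
      then show ?case using c subgroup.one_closed[OF verma_rel_subgroup[of \<nu>]]
        using cls_closed[OF c] by (simp add: cls_zero[symmetric])
    next
      case (gen a x)
      then show ?case using Lv_gen[of "c * a" x \<nu>] c
        by (simp add: cls_mult Cf_closed gen_Cf b_plus_gl mult.assoc Lv_def)
    next
      case (add a b)
      then show ?case using c verma_rel_add[of "cls c \<otimes>\<^bsub>U m n\<^esub> cls a" \<nu> "cls c \<otimes>\<^bsub>U m n\<^esub> cls b"]
        by (simp add: cls_mult cls_add Cf_closed distrib_left)
    qed
    then show ?thesis using a c by (auto simp: Lv_def cls_mult[symmetric] intro!: Cf_closed)
  qed
qed (rule Lv_Cf)

text \<open>An induction principle for \<open>Lv\<close>. The set \<open>Q\<close> has to be
  saturated under congruence because membership in \<open>Lv\<close> is tested on classes.\<close>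

lemma Lv_minimal:
  assumes "a \<in> Lv \<nu>" "0 \<in> Q" "Q \<subseteq> Cf"
    and "\<And>a x. a \<in> Cf \<Longrightarrow> x \<in> b_plus m n \<Longrightarrow> a * (gen x - const (wt_eval m n \<nu> x)) \<in> Q"
    and "\<And>a b. a \<in> Q \<Longrightarrow> b \<in> Q \<Longrightarrow> a + b \<in> Q"
    and eq: "\<And>a b. a \<in> Q \<Longrightarrow> b \<in> Cf \<Longrightarrow> b \<approx> a \<Longrightarrow> b \<in> Q"
  shows "a \<in> Q"
proof -
  have "\<exists>b\<in>Q. X = cls b" if "X \<in> verma_rel m n \<nu>" for X
    using that
  proof (induction rule: verma_rel_induct)
    case (add a b)
    then obtain a' b' where ab: "a' \<in> Q" "cls a = cls a'" "b' \<in> Q" "cls b = cls b'" by blast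
    then have "a' \<in> Cf" "b' \<in> Cf" using assms(3) by auto
    then have "cls (a + b) = cls (a' + b')"
      using ab cls_add[OF add(1,2)] cls_add[of a' b'] by simp
    then show ?case using ab assms(5) by blast
  qed (use assms in blast)+
  then obtain b where b: "b \<in> Q" "cls a = cls b" using assms(1) by (auto simp: Lv_def)
  moreover have "a \<in> Cf" using assms(1) by (rule Lv_Cf)
  ultimately show ?thesis using cls_eq[of a b] eq assms(3) by blast
qed

abbreviation vcls :: "weight \<Rightarrow> falg \<Rightarrow> env set" where
  "vcls \<nu> a \<equiv> verma_rel m n \<nu> +>\<^bsub>U m n\<^esub> cls a"

lemma vcls_eq:
  assumes "a \<in> Cf" "b \<in> Cf"
  shows "vcls \<nu> a = vcls \<nu> b \<longleftrightarrow> a - b \<in> Lv \<nu>"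
proof -
  interpret abelian_subgroup "verma_rel m n \<nu>" "U m n" by (rule abelian_subgroup_verma_rel)
  have "vcls \<nu> a = vcls \<nu> b \<longleftrightarrow> cls a \<in> vcls \<nu> b"
    using a_repr_independence'[of "cls a" "cls b"] a_rcos_self cls_closed assms by metis
  also have "\<dots> \<longleftrightarrow> cls (a - b) \<in> verma_rel m n \<nu>"
    using a_rcos_module_minus[OF ring_U, of "cls b" "cls a"] assms
    by (simp add: cls_closed cls_minus)
  finally show ?thesis using assms by (simp add: Lv_def Cf_closed)
qed

lemma verma_one: "\<one>\<^bsub>verma m n \<nu>\<^esub> = vcls \<nu> 0"
proof -
  interpret abelian_subgroup "verma_rel m n \<nu>" "U m n" by (rule abelian_subgroup_verma_rel)
  interpret ring "U m n" by (rule ring_U)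
  show ?thesis
    unfolding verma_def cls_zero[symmetric]
    by (simp add: A_FactGroup_def' a_subset)
qed

lemma verma_carrier: "a \<in> Cf \<Longrightarrow> vcls \<nu> a \<in> carrier (verma m n \<nu>)"
  unfolding verma_def A_FactGroup_def' A_RCOSETS_def' using cls_closed by auto

text \<open>All cosets in the union defining \<open>verma_act\<close> coincide, because
  \<open>Lv \<nu>\<close> is a left ideal.\<close>

lemma verma_act_vcls:
  assumes "a \<in> Cf" "b \<in> Cf"
  shows "verma_act m n \<nu> (cls a) (vcls \<nu> b) = vcls \<nu> (a * b)"
proof -
  interpret abelian_subgroup "verma_rel m n \<nu>" "U m n" by (rule abelian_subgroup_verma_rel)
  have "verma_rel m n \<nu> +>\<^bsub>U m n\<^esub> (cls a \<otimes>\<^bsub>U m n\<^esub> w) = vcls \<nu> (a * b)" if w: "w \<in> vcls \<nu> b" for w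
  proof -
    have "w \<in> carrier (U m n)"
      using a_elemrcos_carrier[OF cls_closed[OF assms(2)] w] .
    then obtain c where c: "c \<in> Cf" "w = cls c" by (rule U_cases)
    have "vcls \<nu> b = vcls \<nu> c"
      using a_repr_independence'[OF w cls_closed[OF assms(2)]] c by simp
    then have "b - c \<in> Lv \<nu>" using vcls_eq assms c by blast
    then have "a * b - a * c \<in> Lv \<nu>"
      using left_ideal_D(4)[OF left_ideal_Lv assms(1)] by (metis right_diff_distrib)
    then have "vcls \<nu> (a * b) = vcls \<nu> (a * c)"
      using vcls_eq[of "a * b" "a * c"] assms c by (simp add: Cf_closed)
    then show ?thesis using c assms by (simp add: cls_mult)
  qed
  moreover have "vcls \<nu> b \<noteq> {}" using a_rcos_self[OF cls_closed[OF assms(2)]] by blast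
  ultimately show ?thesis unfolding verma_act_def by blast
qed

lemma verma_act_hw: "a \<in> Cf \<Longrightarrow> verma_act m n \<nu> (cls a) (verma_hw m n \<nu>) = vcls \<nu> a"
  unfolding verma_hw_def cls_one using verma_act_vcls[OF _ Cf_closed(7)] by simp

lemma wt_eval_munit: "k \<in> Ix \<Longrightarrow> wt_eval m n \<mu> (munit k k) = \<mu> k"
proof -
  assume k: "k \<in> Ix"
  have "wt_eval m n \<mu> (munit k k) = (\<Sum>l\<in>Ix. if l = k then \<mu> l else 0)"
    unfolding wt_eval_def by (rule sum.cong) (auto simp: munit_def)
  then show ?thesis using k by simp
qed

lemma Lv_raise:
  assumes "i \<in> Ix" "j \<in> Ix" "i < j"
  shows "e i j \<in> Lv \<nu>"
proof -
  have "munit i j \<in> b_plus m n" using assms by (auto simp: b_plus_def gl_munit) (auto simp: munit_def split: if_splits)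
  moreover have "wt_eval m n \<nu> (munit i j) = 0"
    unfolding wt_eval_def using assms by (intro sum.neutral) (auto simp: munit_def)
  ultimately show ?thesis using Lv_gen[OF Cf_closed(7), of "munit i j" \<nu>] by (simp add: e_def)
qed

lemma Lv_diag:
  assumes "i \<in> Ix"
  shows "e i i - const (\<nu> i) \<in> Lv \<nu>"
proof -
  have "munit i i \<in> b_plus m n" using assms by (auto simp: b_plus_def gl_munit) (auto simp: munit_def split: if_splits)
  then show ?thesis using Lv_gen[OF Cf_closed(7), of "munit i i" \<nu>] assms by (simp add: e_def wt_eval_munit)
qed

lemma Lv_hrel:
  assumes "hrel Ix x f"
  shows "x - const (f \<nu>) \<in> Lv \<nu>"
  using assms
proof (induction rule: hrel.induct)
  case (hrel_const c)
  then show ?case using left_ideal_D(5)[OF left_ideal_Lv] by simp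
next
  case (hrel_add x f y g)
  then show ?case using left_ideal_D(6)[OF left_ideal_Lv hrel_add.IH]
    by (simp add: const_add algebra_simps)
next
  case (hrel_e k x f)
  have "e k k * (x - const (f \<nu>)) + const (f \<nu>) * (e k k - const (\<nu> k)) \<in> Lv \<nu>"
    using hrel_e by (intro left_ideal_D(4,6)[OF left_ideal_Lv] Lv_diag) (auto intro: Cf_closed)
  note * = this
  show ?case
  proof -
    have "const (\<nu> k * f \<nu>) = const (f \<nu>) * const (\<nu> k)"
      unfolding const_mult[symmetric] by (simp only: mult.commute)
    then have "e k k * x - const (\<nu> k * f \<nu>) = e k k * (x - const (f \<nu>)) + const (f \<nu>) * (e k k - const (\<nu> k))"
      unfolding right_diff_distrib const_mult_comm[of "f \<nu>" "e k k"] by simp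
    then show ?thesis using * by (simp only:)
  qed
qed

end

section \<open>Independence of the chain elements in Verma modules\<close>

lemma sum_telescope_int:
  fixes g :: "int \<Rightarrow> complex"
  assumes "a \<le> b + 1"
  shows "(\<Sum>l\<in>{a..b}. g l - g (l + 1)) = g a - g (b + 1)"
proof -
  have "(\<Sum>l\<in>{a..a + int k - 1}. g l - g (l + 1)) = g a - g (a + int k)" for k
  proof (induction k)
    case (Suc k)
    have "{a..a + int (Suc k) - 1} = insert (a + int k) {a..a + int k - 1}" by auto
    then show ?case using Suc by (simp add: algebra_simps)
  qed simp
  from this[of "nat (b + 1 - a)"] show ?thesis using assms by simp
qed

context fock begin

lemma act_cong: "a \<approx> b \<Longrightarrow> act a f S = act b f S"
  using act_Uid[of "a - b"] act_diff[of a b] by (simp add: eqU_def)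

lemma act_hrel: "hrel Ix x f \<Longrightarrow> act x vac = (\<lambda>S. f nuN * vac S)"
proof (induction rule: hrel.induct)
  case (hrel_add x f y g)
  then show ?case by (simp add: fun_eq_iff act_add distrib_right)
next
  case (hrel_e k x f)
  then show ?case
    by (simp add: act_mult act_e lin_scale[OF lin_Op] Op_diag_vac) (simp add: mult_ac)
qed (simp add: fun_eq_iff)

text \<open>An element of weight \<gamma> maps the vacuum to a function supported on the
  configurations of weight \<open>nuN + \<gamma>\<close>.\<close>

lemma act_wtv:
  assumes "wtv \<gamma> z" "k \<in> Ix"
  shows "(cwt S k - nuN k - of_int (\<gamma> k)) * act z vac S = 0"
proof -
  have "act (e k k * z - z * e k k) vac S = act (const (of_int (\<gamma> k)) * z) vac S"
    using assms by (intro act_cong) (simp add: wtv_def)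
  then have "cwt S k * act z vac S - nuN k * act z vac S = of_int (\<gamma> k) * act z vac S"
    using assms(2)
    by (simp add: act_diff act_mult act_e Op_diag_vac lin_scale[OF lin_act]) (simp add: Op_diag)
  then show ?thesis by (simp add: left_diff_distrib)
qed

end

section \<open>Polynomial functions of the weight and density of the vacuum weights\<close>

context super_gl begin

definition polyf :: "(weight \<Rightarrow> complex) \<Rightarrow> bool" where "polyf f \<longleftrightarrow> (\<exists>x. hrel Ix x f)"

lemma polyf_const: "polyf (\<lambda>\<nu>. c)"
  unfolding polyf_def using hrel_const by blast

lemma polyf_coord: "k \<in> Ix \<Longrightarrow> polyf (\<lambda>\<nu>. \<nu> k)"
  unfolding polyf_def using hrel_gen by blast

lemma polyf_add: "polyf f \<Longrightarrow> polyf g \<Longrightarrow> polyf (\<lambda>\<nu>. f \<nu> + g \<nu>)"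
  unfolding polyf_def using hrel_add by blast

lemma polyf_mult: "polyf f \<Longrightarrow> polyf g \<Longrightarrow> polyf (\<lambda>\<nu>. f \<nu> * g \<nu>)"
  unfolding polyf_def using hrel_mult by blast

lemma polyf_diff: "polyf f \<Longrightarrow> polyf g \<Longrightarrow> polyf (\<lambda>\<nu>. f \<nu> - g \<nu>)"
  unfolding polyf_def using hrel_diff by blast

lemma polyf_sum: "(\<And>x. x \<in> S \<Longrightarrow> polyf (f x)) \<Longrightarrow> polyf (\<lambda>\<nu>. \<Sum>x\<in>S. f x \<nu>)"
  by (induction S rule: infinite_finite_induct) (auto intro: polyf_const polyf_add)

text \<open>Copy 0 of every colour must exist for \<open>Wact_Sc\<close>.\<close>

definition dominant :: "(int \<Rightarrow> nat) \<Rightarrow> bool" where "dominant N \<longleftrightarrow> (\<forall>l\<in>Ix. 1 \<le> N l)"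

text \<open>The vacuum weight with the multiplicities of the colours replaced by complex
  numbers.\<close>

definition nuz :: "weight \<Rightarrow> weight" where "nuz z k = (\<Sum>l\<in>Ix. z l * om l k)"

text \<open>The system is triangular: within the barred and within the unbarred indices, the
  coordinate \<open>k\<close> collects the multiplicities of the colours from \<open>k\<close>
  upwards, so these are successive differences.\<close>

lemma nuz_surj: "\<exists>z. \<forall>k\<in>Ix. nuz z k = \<nu> k"
proof -
  define g where "g l = (if 1 \<le> l \<and> l \<le> int n then \<nu> l else 0)" for l
  \<comment> \<open>The shift by \<open>g 1\<close> compensates the positive colours, whose
    multiplicities sum to \<open>g 1\<close> and enter every barred coordinate with the sign
    -1.\<close>
  define h where "h l = (if l < 0 then \<nu> l + g 1 else 0)" for l
  define z where "z l = (if l < 0 then h l - h (l + 1) else g l - g (l + 1))" for l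
  have Ix: "Ix = {- int m..-1} \<union> {1..int n}" by (auto simp: idx_def)
  have split: "nuz z k = (\<Sum>l\<in>{- int m..-1}. z l * om l k) + (\<Sum>l\<in>{1..int n}. z l * om l k)" for k
    unfolding nuz_def Ix by (rule sum.union_disjoint) auto
  have pos: "(\<Sum>l\<in>{k..int n}. z l) = g k" if "1 \<le> k" "k \<le> int n + 1" for k
  proof -
    have "(\<Sum>l\<in>{k..int n}. z l) = (\<Sum>l\<in>{k..int n}. g l - g (l + 1))"
      using that by (intro sum.cong) (auto simp: z_def)
    then show ?thesis using that by (simp add: sum_telescope_int) (simp add: g_def)
  qed
  have neg: "(\<Sum>l\<in>{k..-1}. z l) = h k" if "k < 0" for k
  proof -
    have "(\<Sum>l\<in>{k..-1}. z l) = (\<Sum>l\<in>{k..-1}. h l - h (l + 1))"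
      by (intro sum.cong) (auto simp: z_def)
    then show ?thesis using that by (simp add: sum_telescope_int) (simp add: h_def)
  qed
  have "nuz z k = \<nu> k" if "k \<in> Ix" for k
  proof (cases "k < 0")
    case True
    have "(\<Sum>l\<in>{- int m..-1}. z l * om l k) = (\<Sum>l\<in>{k..-1}. z l)"
      using True that by (intro sum.mono_neutral_cong_right) (auto simp: om_def Ix)
    moreover have "(\<Sum>l\<in>{1..int n}. z l * om l k) = - (\<Sum>l\<in>{1..int n}. z l)"
      unfolding sum_negf[symmetric] using True by (intro sum.cong) (auto simp: om_def)
    ultimately show ?thesis using split[of k] neg[of k] pos[of 1] True by (simp add: h_def)
  next
    case False
    have "(\<Sum>l\<in>{- int m..-1}. z l * om l k) = 0"
      using False by (intro sum.neutral) (auto simp: om_def)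
    moreover have "(\<Sum>l\<in>{1..int n}. z l * om l k) = (\<Sum>l\<in>{k..int n}. z l)"
      using False that by (intro sum.mono_neutral_cong_right) (auto simp: om_def Ix)
    ultimately show ?thesis using split[of k] pos[of k] False that by (auto simp: g_def Ix)
  qed
  then show ?thesis by blast
qed

text \<open>\<open>K\<close> is the set of colours whose multiplicity may be any complex number.
  Enlarging it by one colour only moves along a line, on which \<open>f\<close> already vanishes at
  all positive integers.\<close>

lemma polyf_dense:
  assumes "polyf f" "\<And>N. dominant N \<Longrightarrow> f (fock.nuN m n N) = 0"
  shows "f \<nu> = 0"
proof -
  obtain x where x: "hrel Ix x f" using assms(1) by (auto simp: polyf_def)
  have lp: "linepoly f" using x by (rule hrel_linepoly)
  have main: "f (nuz z) = 0" if "finite K" "K \<subseteq> Ix" "\<forall>l\<in>Ix - K. \<exists>j\<ge>1. z l = of_nat j" for K z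
    using that
  proof (induction K arbitrary: z rule: finite_induct)
    case empty
    then have "\<forall>l\<in>Ix. \<exists>j. 1 \<le> j \<and> z l = of_nat j" by auto
    from bchoice[OF this]
    obtain N where N: "\<And>l. l \<in> Ix \<Longrightarrow> 1 \<le> N l \<and> z l = of_nat (N l)" by blast
    then have "dominant N" by (simp add: dominant_def)
    moreover have "fock.nuN m n N = nuz z"
      unfolding fock.nuN_def nuz_def by (rule ext, rule sum.cong) (simp_all add: N)
    ultimately show ?case using assms(2)[of N] by simp
  next
    case (insert k K)
    have line: "nuz (z(k := w)) = (\<lambda>j. nuz (z(k := 0)) j + w * om k j)" for w
    proof
      fix j
      have k: "k \<in> Ix" using insert by simp
      have "nuz (z(k := w)) j = w * om k j + (\<Sum>l\<in>Ix - {k}. z l * om l j)" for w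
        unfolding nuz_def by (subst sum.remove[OF finite_Ix k]) (auto intro!: sum.cong)
      then show "nuz (z(k := w)) j = nuz (z(k := 0)) j + w * om k j" by simp
    qed
    have inf: "infinite ((of_nat :: nat \<Rightarrow> complex) ` {1..})"
      by (simp add: finite_image_iff inj_on_def infinite_Ici)
    have "f (\<lambda>j. nuz (z(k := 0)) j + z k * om k j) = 0"
    proof (rule linepoly_zero[OF lp inf])
      fix w :: complex assume "w \<in> of_nat ` {1..}"
      then have "f (nuz (z(k := w))) = 0"
        using insert.prems insert.hyps by (intro insert.IH) auto
      then show "f (\<lambda>j. nuz (z(k := 0)) j + w * om k j) = 0" using line[of w] by simp
    qed
    then show ?case using line[of "z k"] by simp
  qed
  obtain z where z: "\<forall>k\<in>Ix. nuz z k = \<nu> k" using nuz_surj by blast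
  have "f \<nu> = f (nuz z)" by (rule hrel_indep[OF x]) (simp add: z)
  then show ?thesis using main[of Ix z] by simp
qed

lemma wtw_outside: "negw ps \<Longrightarrow> k \<notin> Ix \<Longrightarrow> wtw ps k = 0"
  by (induction ps) (auto simp: rt_def)

lemma Z_outside: "Z \<gamma> a \<Longrightarrow> k \<notin> Ix \<Longrightarrow> \<gamma> k \<noteq> 0 \<Longrightarrow> a \<approx> 0"
proof (induction rule: Z.induct)
  case (Z_add a b)
  then show ?case using eqU_add[of a 0 b 0] by simp
next
  case (Z_eq a a')
  then show ?case using eqU_trans by blast
qed (auto simp: wtw_outside)

lemma dec_family_supp:
  assumes "dec L a" "left_ideal L"
  shows "\<exists>G u. finite G \<and> (\<forall>\<gamma>\<in>G. \<forall>k. k \<notin> Ix \<longrightarrow> \<gamma> k = 0) \<and> (\<forall>\<gamma>. Z \<gamma> (u \<gamma>)) \<and> a - (\<Sum>\<gamma>\<in>G. u \<gamma>) \<in> L"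
proof -
  obtain G u where G: "finite G" "\<And>\<gamma>. Z \<gamma> (u \<gamma>)" "a - (\<Sum>\<gamma>\<in>G. u \<gamma>) \<in> L"
    using dec_family[OF assms] by blast
  let ?G = "{\<gamma> \<in> G. \<forall>k. k \<notin> Ix \<longrightarrow> \<gamma> k = 0}"
  have "(\<Sum>\<gamma>\<in>G - ?G. u \<gamma>) \<in> L"
    using Z_outside[OF G(2)] left_ideal_D(1)[OF assms(2)]
    by (intro left_ideal_sum assms) (auto simp: eqU_0)
  moreover have "(\<Sum>\<gamma>\<in>G. u \<gamma>) = (\<Sum>\<gamma>\<in>?G. u \<gamma>) + (\<Sum>\<gamma>\<in>G - ?G. u \<gamma>)"
    using G(1) by (subst sum.subset_diff[of ?G G]) (auto simp: add.commute)
  ultimately have "a - (\<Sum>\<gamma>\<in>?G. u \<gamma>) \<in> L"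
    using left_ideal_D(6)[OF assms(2) G(3)] by fastforce
  then show ?thesis using G by (intro exI[of _ ?G] exI[of _ u]) auto
qed

section \<open>Chains indexed by subsets and their coefficients on the vacua\<close>

abbreviation inner :: "int \<Rightarrow> int \<Rightarrow> int set" where "inner a b \<equiv> {k \<in> Ix. a < k \<and> k < b}"

abbreviation echJ :: "int \<Rightarrow> int \<Rightarrow> int set \<Rightarrow> falg" where
  "echJ b a J \<equiv> ech b a (sorted_list_of_set J)"

lemma finite_inner: "finite (inner a b)"
  by simp

lemma ech_Cf: "a \<in> Ix \<Longrightarrow> b \<in> Ix \<Longrightarrow> set js \<subseteq> Ix \<Longrightarrow> ech b a js \<in> Cf"
  by (induction js arbitrary: a) (auto intro!: Cf_closed)

lemma finite_J: "J \<in> Pow (inner a b) \<Longrightarrow> finite J"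
  using finite_inner finite_subset by blast

lemma echJ_Cf: "a \<in> Ix \<Longrightarrow> b \<in> Ix \<Longrightarrow> J \<in> Pow (inner a b) \<Longrightarrow> echJ b a J \<in> Cf"
  using finite_J[of J a b] by (intro ech_Cf) auto

lemma wtv_ech: "a \<in> Ix \<Longrightarrow> b \<in> Ix \<Longrightarrow> set js \<subseteq> Ix \<Longrightarrow> wtv (rt b a) (ech b a js)"
proof (induction js arbitrary: a)
  case (Cons j js)
  then have "wtv (\<lambda>k. rt b j k + rt j a k) (ech b j js * e j a)"
    by (intro wtv_mult wtv_e) (auto intro: ech_Cf)
  then show ?case by (simp add: rt_add)
qed (auto intro: wtv_e)

lemma wtv_echJ: "a \<in> Ix \<Longrightarrow> b \<in> Ix \<Longrightarrow> J \<in> Pow (inner a b) \<Longrightarrow> wtv (rt b a) (echJ b a J)"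
  using finite_J[of J a b] by (intro wtv_ech) auto

lemma okw_chwJ:
  assumes "a \<in> Ix" "b \<in> Ix" "a < b" "J \<in> Pow (inner a b)"
  shows "okw (chw b a (sorted_list_of_set J))"
  using assms finite_J[OF assms(4)]
  by (intro okw_chw) (auto simp: sorted_wrt_append)

lemma Z_chain:
  assumes "Z \<gamma> z" "\<gamma> = rt b a" "a \<in> Ix" "b \<in> Ix" "a < b"
  shows "\<exists>x f. (\<forall>J\<in>Pow (inner a b). hrel Ix (x J) (f J)) \<and> z \<approx> (\<Sum>J\<in>Pow (inner a b). echJ b a J * x J)"
  using assms(1)
proof (induction rule: Z.induct)
  case (Z_base ps x f)
  have x: "x \<in> Cf" using Z_base hrel_Cf by blast
  have "csp b a (wd ps)" using Z_base assms by (intro straighten) auto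
  then obtain c where "wd ps \<approx> (\<Sum>J\<in>Pow (inner a b). const (c J) * echJ b a J)"
    using csp_sum assms by blast
  from eqU_rmult[OF this x]
  have "wd ps * x \<approx> (\<Sum>J\<in>Pow (inner a b). echJ b a J * (const (c J) * x))"
    by (simp add: sum_distrib_right mult.assoc const_mult_left_comm[of "ech _ _ _"])
  then show ?case using hrel_const_mult[OF Z_base(3)]
    by (intro exI[of _ "\<lambda>J. const (c J) * x"] exI[of _ "\<lambda>J \<nu>. c J * f \<nu>"]) auto
next
  case Z_0
  then show ?case using hrel_0 by (intro exI[of _ "\<lambda>J. 0"] exI[of _ "\<lambda>J \<nu>. 0"]) auto
next
  case (Z_add z z')
  then obtain x f x' f' where
    "\<forall>J\<in>Pow (inner a b). hrel Ix (x J) (f J)" "z \<approx> (\<Sum>J\<in>Pow (inner a b). echJ b a J * x J)"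
    "\<forall>J\<in>Pow (inner a b). hrel Ix (x' J) (f' J)" "z' \<approx> (\<Sum>J\<in>Pow (inner a b). echJ b a J * x' J)"
    by blast
  then show ?case using eqU_add[of z _ z'] hrel_add
    by (intro exI[of _ "\<lambda>J. x J + x' J"] exI[of _ "\<lambda>J \<nu>. f J \<nu> + f' J \<nu>"])
      (auto simp: distrib_left sum.distrib)
next
  case (Z_eq z z')
  then show ?case using eqU_trans by blast
qed

text \<open>The coefficient of \<open>x\<close> applied to the vacuum at the test configuration of
  the chain \<open>K\<close>.\<close>

definition cmat :: "int \<Rightarrow> int \<Rightarrow> (int \<Rightarrow> nat) \<Rightarrow> falg \<Rightarrow> int set \<Rightarrow> complex" where
  "cmat b a N x K = fock.act m n N x vac (fock.Sc (chw b a (sorted_list_of_set K)))"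

text \<open>An index \<open>j\<close> in \<open>K\<close> but not in \<open>J\<close> is a tail of
  the chain for \<open>K\<close> only: the test configuration has emptied the mode
  \<open>((j, 0), j)\<close>, which the chain for \<open>J\<close> cannot do. The diagonal entries
  are nonzero by \<open>Wact_Sc\<close>.\<close>

lemma cmat_triangular:
  assumes "a \<in> Ix" "b \<in> Ix" "a < b" "J \<in> Pow (inner a b)" "K \<in> Pow (inner a b)" "dominant N"
  shows "J = K \<Longrightarrow> cmat b a N (echJ b a J) K \<noteq> 0"
    and "\<not> K \<subseteq> J \<Longrightarrow> cmat b a N (echJ b a J) K = 0"
proof -
  interpret F: fock m n N .
  have J: "set (sorted_list_of_set J) = J" and K: "set (sorted_list_of_set K) = K"
    using finite_J[OF assms(4)] finite_J[OF assms(5)] by simp_all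
  have act: "F.act (echJ b a J) vac = F.Wact (chw b a (sorted_list_of_set J))"
    using assms(1,2,4) J by (intro F.act_ech) auto
  show "cmat b a N (echJ b a J) K \<noteq> 0" if "J = K"
    unfolding cmat_def act using that assms(6)
      F.Wact_Sc[OF okw_chwJ[OF assms(1,2,3,5)]] by (simp add: dominant_def)
  show "cmat b a N (echJ b a J) K = 0" if "\<not> K \<subseteq> J"
  proof -
    obtain j where j: "j \<in> K" "j \<notin> J" using \<open>\<not> K \<subseteq> J\<close> by blast
    have "j \<noteq> a" using j assms by auto
    then have "j \<notin> snd ` set (chw b a (sorted_list_of_set J))"
      "j \<in> snd ` set (chw b a (sorted_list_of_set K))"
      using j J K by (simp_all add: tails_chw)
    then show ?thesis
      unfolding cmat_def act using F.Sc_used[OF okw_chwJ[OF assms(1,2,3,5)]]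
      by (intro F.Wact_tails[of j _ _ 0]) auto
  qed
qed

text \<open>Testing at a maximal element \<open>K\<close> of the support of \<open>g\<close> leaves
  the diagonal term alone.\<close>

lemma cmat_independent:
  assumes "a \<in> Ix" "b \<in> Ix" "a < b" "dominant N"
    and z: "\<And>K. K \<in> Pow (inner a b) \<Longrightarrow> (\<Sum>J\<in>Pow (inner a b). g J * cmat b a N (echJ b a J) K) = 0"
    and "J \<in> Pow (inner a b)"
  shows "g J = 0"
proof (rule ccontr)
  assume "g J \<noteq> 0"
  let ?A = "{J \<in> Pow (inner a b). g J \<noteq> 0}"
  have "finite ?A" by simp
  then obtain K where K: "K \<in> ?A" "\<And>J. J \<in> ?A \<Longrightarrow> K \<subseteq> J \<Longrightarrow> K = J"
  proof -
    have "?A \<noteq> {}" using assms(6) \<open>g J \<noteq> 0\<close> by blast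
    from finite_has_maximal[OF \<open>finite ?A\<close> this] show ?thesis using that by meson
  qed
  have "(\<Sum>J\<in>Pow (inner a b). g J * cmat b a N (echJ b a J) K) = (\<Sum>J\<in>{K}. g J * cmat b a N (echJ b a J) K)"
    using K cmat_triangular(2)[OF assms(1-3) _ _ assms(4)]
    by (intro sum.mono_neutral_right) auto
  then have "g K * cmat b a N (echJ b a K) K = 0" using z K by auto
  then show False using K cmat_triangular(1)[OF assms(1-3) _ _ assms(4), of K K] by auto
qed

text \<open>On the vacua, \<open>x\<close> acts up to other weights like a combination of the \<open>echJ b a J\<close> whose coefficients are
  polynomials in the highest weight. By density of the weights of the vacua, the values of these
  polynomials at an arbitrary \<open>\<nu>\<close> are determined by the class of \<open>x\<close> modulo \<open>Lv \<nu>\<close>.\<close>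

lemma symbol_exists:
  assumes ab: "a \<in> Ix" "b \<in> Ix" "a < b" and x: "x \<in> Cf"
  shows "\<exists>p. (\<forall>J\<in>Pow (inner a b). polyf (p J)) \<and> (\<forall>N K. dominant N \<longrightarrow> K \<in> Pow (inner a b) \<longrightarrow>
     cmat b a N x K = (\<Sum>J\<in>Pow (inner a b). p J (fock.nuN m n N) * cmat b a N (echJ b a J) K))"
proof -
  let ?P = "Pow (inner a b)"
  \<comment> \<open>Taking the annihilator of all vacua at once makes the decomposition, and hence
    the polynomials \<open>p J\<close>, independent of \<open>N\<close>.\<close>
  define L where "L = {x \<in> Cf. \<forall>N S. fock.act m n N x vac S = 0}"
  have L: "left_ideal L"
    unfolding left_ideal_def
  proof (intro conjI ballI subsetI)
    fix x assume "x \<in> Uid" then show "x \<in> L" using fock.act_Uid Uid_Cf by (simp add: L_def)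
  next
    fix x y assume "x \<in> L" "y \<in> L" then show "x - y \<in> L" by (simp add: L_def fock.act_diff Cf_closed)
  next
    fix c x assume c: "c \<in> Cf" "x \<in> L"
    have "fock.act m n N (c * x) vac S = 0" for N S
    proof -
      have "fock.act m n N x vac = (\<lambda>S. 0)" using c by (auto simp: L_def)
      then show ?thesis by (simp add: fock.act_mult lin_zero[OF fock.lin_act])
    qed
    then show "c * x \<in> L" using c by (simp add: L_def Cf_closed)
  qed (simp add: L_def)
  have "dec L x"
  proof (rule dec_all[OF L _ x])
    fix i j x f assume ij: "i \<in> Ix" "j \<in> Ix" "i < j" "hrel Ix x f"
    have "fock.act m n N (e i j * x) vac S = 0" for N S
    proof -
      interpret F: fock m n N .
      show ?thesis
        using ij by (simp add: F.act_mult F.act_hrel F.act_e lin_scale[OF F.lin_Op] F.Op_raise_vac)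
    qed
    then show "e i j * x \<in> L" using ij hrel_Cf[OF ij(4)] by (simp add: L_def Cf_closed)
  qed
  then obtain G u where G: "finite G" "\<And>\<gamma> k. \<gamma> \<in> G \<Longrightarrow> k \<notin> Ix \<Longrightarrow> \<gamma> k = 0" "\<And>\<gamma>. Z \<gamma> (u \<gamma>)"
    "x - (\<Sum>\<gamma>\<in>G. u \<gamma>) \<in> L"
    using dec_family_supp[OF _ L] by metis
  obtain y f where yf: "\<And>J. J \<in> ?P \<Longrightarrow> hrel Ix (y J) (f J)" "u (rt b a) \<approx> (\<Sum>J\<in>?P. echJ b a J * y J)"
    using Z_chain[OF G(3) refl ab] by blast
  define p where "p J = (if rt b a \<in> G then f J else (\<lambda>\<nu>. 0))" for J
  have "polyf (p J)" if "J \<in> ?P" for J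
    using yf(1)[OF that] polyf_const[of 0] by (auto simp: p_def polyf_def)
  moreover have "cmat b a N x K = (\<Sum>J\<in>?P. p J (fock.nuN m n N) * cmat b a N (echJ b a J) K)"
    if N: "dominant N" and K: "K \<in> ?P" for N K
  proof -
    interpret F: fock m n N .
    let ?S = "F.Sc (chw b a (sorted_list_of_set K))"
    \<comment> \<open>The chain for \<open>K\<close> takes the vacuum to a function that is nonzero
      at this configuration, so the weight of the configuration is known. Components of other
      weights vanish there.\<close>
    have wt: "F.cwt ?S k - F.nuN k = of_int (rt b a k)" if "k \<in> Ix" for k
      using F.act_wtv[OF wtv_echJ[OF ab(1,2) K] that, of ?S] cmat_triangular(1)[OF ab K K N refl]
      by (simp add: cmat_def)
    have other: "F.act (u \<gamma>) vac ?S = 0" if \<gamma>: "\<gamma> \<in> G" "\<gamma> \<noteq> rt b a" for \<gamma>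
    proof -
      have "\<exists>k\<in>Ix. \<gamma> k \<noteq> rt b a k"
      proof (rule ccontr)
        assume "\<not> (\<exists>k\<in>Ix. \<gamma> k \<noteq> rt b a k)"
        moreover have "rt b a k = 0" if "k \<notin> Ix" for k using that ab by (auto simp: rt_def)
        ultimately have "\<gamma> = rt b a" using G(2)[OF \<gamma>(1)] by (metis ext)
        then show False using \<gamma> by simp
      qed
      then obtain k where "k \<in> Ix" "\<gamma> k \<noteq> rt b a k" by blast
      then show ?thesis
        using F.act_wtv[OF Z_wtv[OF G(3)], of k ?S \<gamma>] wt by simp
    qed
    have "F.act (x - (\<Sum>\<gamma>\<in>G. u \<gamma>)) vac ?S = 0" using G(4) by (simp add: L_def)
    then have "cmat b a N x K = (\<Sum>\<gamma>\<in>G. F.act (u \<gamma>) vac ?S)"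
      by (simp add: F.act_diff F.act_sum cmat_def)
    also have "\<dots> = (\<Sum>\<gamma>\<in>G. if \<gamma> = rt b a then F.act (u (rt b a)) vac ?S else 0)"
      using other by (intro sum.cong) auto
    also have "\<dots> = (if rt b a \<in> G then F.act (u (rt b a)) vac ?S else 0)" using G(1) by simp
    also have "F.act (u (rt b a)) vac ?S = (\<Sum>J\<in>?P. F.act (echJ b a J * y J) vac ?S)"
      using F.act_cong[OF yf(2)] by (simp add: F.act_sum)
    also have "\<dots> = (\<Sum>J\<in>?P. f J F.nuN * cmat b a N (echJ b a J) K)"
      by (intro sum.cong refl)
        (simp add: F.act_mult F.act_hrel[OF yf(1)] lin_scale[OF F.lin_act] cmat_def)
    finally show ?thesis by (auto simp: p_def)
  qed
  ultimately show ?thesis by blast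
qed

text \<open>\<open>Q\<close> consists of the elements that admit coefficient polynomials vanishing
  at \<nu>; it contains \<open>Lv \<nu>\<close>. A given combination also has the constant
  coefficients \<open>c J\<close>. By triangularity both agree at all dominant vacuum weights, by
  density everywhere, and at \<nu> the polynomial is 0.\<close>

theorem echJ_independent:
  assumes ab: "a \<in> Ix" "b \<in> Ix" "a < b"
    and c: "(\<Sum>J\<in>Pow (inner a b). const (c J) * echJ b a J) \<in> Lv \<nu>" and J: "J \<in> Pow (inner a b)"
  shows "c J = 0"
proof -
  let ?P = "Pow (inner a b)"
  define Q where "Q = {x \<in> Cf. \<exists>p. (\<forall>J\<in>?P. polyf (p J) \<and> p J \<nu> = 0) \<and> (\<forall>N K. dominant N \<longrightarrow> K \<in> ?P \<longrightarrow>
     cmat b a N x K = (\<Sum>J\<in>?P. p J (fock.nuN m n N) * cmat b a N (echJ b a J) K))}"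
  have "(\<Sum>J\<in>?P. const (c J) * echJ b a J) \<in> Q"
  proof (rule Lv_minimal[OF c])
    show "0 \<in> Q"
      unfolding Q_def
      by (auto simp: cmat_def fock.act_0 intro!: Cf_closed exI[of _ "\<lambda>J \<nu>. 0"] polyf_const)
  next
    fix u x assume u: "u \<in> Cf" and x: "x \<in> b_plus m n"
    obtain p where p: "\<And>J. J \<in> ?P \<Longrightarrow> polyf (p J)" "\<And>N K. dominant N \<Longrightarrow> K \<in> ?P \<Longrightarrow>
       cmat b a N u K = (\<Sum>J\<in>?P. p J (fock.nuN m n N) * cmat b a N (echJ b a J) K)"
      using symbol_exists[OF ab u] by blast
    \<comment> \<open>On a vacuum the second factor of a defining relation acts by this polynomial
      in the vacuum weight. It vanishes at \<nu>, and with it the coefficients of the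
      product.\<close>
    define q where "q \<mu> = (\<Sum>k\<in>Ix. x k k * \<mu> k) - wt_eval m n \<nu> x" for \<mu>
    have q: "polyf q" "q \<nu> = 0"
      unfolding q_def
      by (auto intro!: polyf_diff polyf_sum polyf_mult polyf_coord polyf_const simp: wt_eval_def mult.commute)
    have act: "fock.act m n N (u * (gen x - const (wt_eval m n \<nu> x))) vac S
        = q (fock.nuN m n N) * fock.act m n N u vac S" for N S
    proof -
      interpret F: fock m n N .
      have "F.opm x vac = (\<lambda>S. (\<Sum>k\<in>Ix. x k k * F.nuN k) * vac S)"
      proof
        fix S
        have "F.opm x vac S = (\<Sum>i\<in>Ix. \<Sum>j\<in>Ix. if j = i then x i i * F.nuN i * vac S else 0)"
          unfolding F.opm_def
        proof (intro sum.cong refl)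
          fix i j assume ij: "i \<in> Ix" "j \<in> Ix"
          consider "i = j" | "i < j" | "j < i" by linarith
          then show "x i j * F.Op i j vac S = (if j = i then x i i * F.nuN i * vac S else 0)"
          proof cases
            case 3
            then have "x i j = 0" using x by (force simp: b_plus_def)
            then show ?thesis using 3 by simp
          qed (use ij F.Op_raise_vac F.Op_diag_vac in auto)
        qed
        also have "\<dots> = (\<Sum>i\<in>Ix. x i i * F.nuN i * vac S)" by (rule sum.cong[OF refl]) simp
        finally show "F.opm x vac S = (\<Sum>k\<in>Ix. x k k * F.nuN k) * vac S" by (simp add: sum_distrib_right)
      qed
      then have "F.act (gen x - const (wt_eval m n \<nu> x)) vac = (\<lambda>S. q F.nuN * vac S)"
        by (auto simp: F.act_diff F.act_gen q_def left_diff_distrib)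
      then show ?thesis by (simp add: F.act_mult lin_scale[OF F.lin_act])
    qed
    show "u * (gen x - const (wt_eval m n \<nu> x)) \<in> Q"
      unfolding Q_def
    proof (intro CollectI conjI exI allI impI ballI)
      show "u * (gen x - const (wt_eval m n \<nu> x)) \<in> Cf"
        using u x by (intro Cf_closed gen_Cf b_plus_gl)
      fix J assume J: "J \<in> ?P"
      show "polyf (\<lambda>\<mu>. q \<mu> * p J \<mu>)" using p(1)[OF J] q by (intro polyf_mult)
      show "q \<nu> * p J \<nu> = 0" using q by simp
    next
      fix N K assume "dominant N" "K \<in> ?P"
      then show "cmat b a N (u * (gen x - const (wt_eval m n \<nu> x))) K
        = (\<Sum>J\<in>?P. q (fock.nuN m n N) * p J (fock.nuN m n N) * cmat b a N (echJ b a J) K)"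
        using p(2)[of N K] by (simp add: cmat_def act sum_distrib_left mult.assoc)
    qed
  next
    fix x y assume "x \<in> Q" "y \<in> Q"
    then obtain p q where *: "x \<in> Cf" "y \<in> Cf" "\<And>J. J \<in> ?P \<Longrightarrow> polyf (p J) \<and> p J \<nu> = 0"
      "\<And>J. J \<in> ?P \<Longrightarrow> polyf (q J) \<and> q J \<nu> = 0"
      "\<And>N K. dominant N \<Longrightarrow> K \<in> ?P \<Longrightarrow>
       cmat b a N x K = (\<Sum>J\<in>?P. p J (fock.nuN m n N) * cmat b a N (echJ b a J) K)"
      "\<And>N K. dominant N \<Longrightarrow> K \<in> ?P \<Longrightarrow>
       cmat b a N y K = (\<Sum>J\<in>?P. q J (fock.nuN m n N) * cmat b a N (echJ b a J) K)"
      unfolding Q_def by blast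
    show "x + y \<in> Q"
      unfolding Q_def
    proof (intro CollectI conjI exI allI impI ballI)
      show "x + y \<in> Cf" using * by (intro Cf_closed)
      fix J assume J: "J \<in> ?P"
      show "polyf (\<lambda>\<mu>. p J \<mu> + q J \<mu>)" using * J by (intro polyf_add) auto
      show "p J \<nu> + q J \<nu> = 0" using * J by simp
    next
      fix N K assume "dominant N" "K \<in> ?P"
      then show "cmat b a N (x + y) K
        = (\<Sum>J\<in>?P. (p J (fock.nuN m n N) + q J (fock.nuN m n N)) * cmat b a N (echJ b a J) K)"
        using *(5,6)[of N K] by (simp add: cmat_def fock.act_add distrib_right sum.distrib)
    qed
  next
    fix x y assume "x \<in> Q" "y \<in> Cf" "y \<approx> x"
    moreover have "cmat b a N y K = cmat b a N x K" for N K
      unfolding cmat_def using \<open>y \<approx> x\<close> by (rule fock.act_cong)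
    ultimately show "y \<in> Q" by (simp add: Q_def)
  qed (auto simp: Q_def)
  then obtain p where p: "\<And>J. J \<in> ?P \<Longrightarrow> polyf (p J) \<and> p J \<nu> = 0" "\<And>N K. dominant N \<Longrightarrow> K \<in> ?P \<Longrightarrow>
       cmat b a N (\<Sum>J\<in>?P. const (c J) * echJ b a J) K
        = (\<Sum>J\<in>?P. p J (fock.nuN m n N) * cmat b a N (echJ b a J) K)"
    unfolding Q_def by blast
  have "c J - p J (fock.nuN m n N) = 0" if N: "dominant N" for N
  proof (rule cmat_independent[OF ab N _ J])
    fix K assume K: "K \<in> ?P"
    have "cmat b a N (\<Sum>J\<in>?P. const (c J) * echJ b a J) K = (\<Sum>J\<in>?P. c J * cmat b a N (echJ b a J) K)"
      unfolding cmat_def fock.act_sum fock.act_mult fock.act_const ..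
    then show "(\<Sum>J\<in>?P. (c J - p J (fock.nuN m n N)) * cmat b a N (echJ b a J) K) = 0"
      using p(2)[OF N K] by (simp add: left_diff_distrib sum_subtractf)
  qed
  then have "c J - p J \<nu> = 0"
    using p(1)[OF J] by (rule_tac polyf_dense[OF polyf_diff[OF polyf_const]]) simp_all
  then show ?thesis using p(1)[OF J] by simp
qed

end

section \<open>The singular vector\<close>

text \<open>Grouping the nonempty subsets by their largest element is the combinatorial content of
  the recursion \<open>Tv_rec\<close>.\<close>

lemma sum_Pow_Max:
  fixes F :: "int set \<Rightarrow> 'a::comm_monoid_add"
  assumes "finite X"
  shows "(\<Sum>J\<in>Pow X. F J) = F {} + (\<Sum>x\<in>X. \<Sum>J\<in>Pow {y \<in> X. y < x}. F (insert x J))"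
  using assms
proof (induction X rule: finite_linorder_max_induct)
  case (insert b X)
  have b: "b \<notin> X" using insert by auto
  have "(\<Sum>J\<in>Pow (insert b X). F J) = (\<Sum>J\<in>Pow X. F J) + (\<Sum>J\<in>insert b ` Pow X. F J)"
    unfolding Pow_insert using insert b by (intro sum.union_disjoint) auto
  also have "(\<Sum>J\<in>insert b ` Pow X. F J) = (\<Sum>J\<in>Pow X. F (insert b J))"
    using b by (subst sum.reindex) (auto simp: inj_on_def)
  also have "(\<Sum>J\<in>Pow X. F J) = F {} + (\<Sum>x\<in>X. \<Sum>J\<in>Pow {y \<in> insert b X. y < x}. F (insert x J))"
  proof -
    have "{y \<in> insert b X. y < x} = {y \<in> X. y < x}" if "x \<in> X" for x
      using insert that by auto
    then show ?thesis using insert.IH by simp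
  qed
  finally have "(\<Sum>J\<in>Pow (insert b X). F J) =
      F {} + (\<Sum>x\<in>X. \<Sum>J\<in>Pow {y \<in> insert b X. y < x}. F (insert x J)) + (\<Sum>J\<in>Pow X. F (insert b J))" .
  moreover have "{y \<in> insert b X. y < b} = X" using insert by auto
  ultimately show ?case unfolding sum.insert[OF insert.hyps(1) b] by (simp only: add_ac)
qed simp

context super_gl begin

lemma ech_snoc: "ech b a (js @ [x]) = e b x * ech x a js"
  by (induction js arbitrary: a) (auto simp: mult.assoc)

lemma sorted_list_snoc:
  assumes "finite J" "\<And>y. y \<in> J \<Longrightarrow> y < x"
  shows "sorted_list_of_set (insert x J) = sorted_list_of_set J @ [x :: int]"
proof -
  have "x \<notin> J" using assms(2) by blast
  then show ?thesis
    using assms by (intro sorted_list_of_set_unique[THEN iffD1]) (auto simp: sorted_wrt_append)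
qed

text \<open>The sums \<open>S_elt\<close> for a variable upper end \<open>b\<close>, with the value \<open>1\<close> for \<open>b = a\<close>.\<close>

definition Tv :: "(int \<Rightarrow> complex) \<Rightarrow> int \<Rightarrow> int \<Rightarrow> falg" where
  "Tv c a b = (if b = a then 1 else
     (\<Sum>J\<in>Pow (inner a b). const (\<Prod>k\<in>inner a b - J. c k) * echJ b a J))"

lemma Tv_Cf: "a \<in> Ix \<Longrightarrow> b \<in> Ix \<Longrightarrow> Tv c a b \<in> Cf"
  by (auto simp: Tv_def intro!: Cf_closed echJ_Cf)

text \<open>The largest element \<open>x\<close> of \<open>J\<close> is the tail of the leftmost
  factor of the chain, and the indices between \<open>x\<close> and \<open>b\<close> are all outside
  \<open>J\<close>. The empty set corresponds to the summand \<open>x = a\<close>.\<close>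

lemma Tv_rec:
  assumes "a \<in> Ix" "b \<in> Ix" "a < b"
  shows "Tv c a b = (\<Sum>x\<in>{x \<in> Ix. a \<le> x \<and> x < b}. const (\<Prod>k\<in>inner x b. c k) * (e b x * Tv c a x))"
proof -
  let ?F = "\<lambda>J. const (\<Prod>k\<in>inner a b - J. c k) * echJ b a J"
  have step: "(\<Sum>J\<in>Pow {y \<in> inner a b. y < x}. ?F (insert x J)) = const (\<Prod>k\<in>inner x b. c k) * (e b x * Tv c a x)"
    if x: "x \<in> inner a b" for x
  proof -
    have eq: "{y \<in> inner a b. y < x} = inner a x" using x by auto
    have "?F (insert x J) = const (\<Prod>k\<in>inner x b. c k) * (e b x * (const (\<Prod>k\<in>inner a x - J. c k) * echJ x a J))"
      if J: "J \<in> Pow (inner a x)" for J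
    proof -
      have "inner a b - insert x J = inner x b \<union> (inner a x - J)" using x J by auto
      moreover have "inner x b \<inter> (inner a x - J) = {}" by auto
      ultimately have "(\<Prod>k\<in>inner a b - insert x J. c k) = (\<Prod>k\<in>inner x b. c k) * (\<Prod>k\<in>inner a x - J. c k)"
        by (simp add: prod.union_disjoint)
      moreover have "sorted_list_of_set (insert x J) = sorted_list_of_set J @ [x]"
        using J finite_J[OF J] by (intro sorted_list_snoc) auto
      ultimately show ?thesis
        by (simp only: ech_snoc const_mult mult.assoc const_mult_left_comm[of "e b x"])
    qed
    then show ?thesis
      unfolding eq using x by (simp add: Tv_def sum_distrib_left)
  qed
  have set: "{x \<in> Ix. a \<le> x \<and> x < b} = insert a (inner a b)" using assms by auto
  have "Tv c a b = ?F {} + (\<Sum>x\<in>inner a b. \<Sum>J\<in>Pow {y \<in> inner a b. y < x}. ?F (insert x J))"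
    using assms by (simp only: Tv_def sum_Pow_Max[OF finite_inner]) simp
  also have "\<dots> = const (\<Prod>k\<in>inner a b. c k) * (e b a * Tv c a a)
      + (\<Sum>x\<in>inner a b. const (\<Prod>k\<in>inner x b. c k) * (e b x * Tv c a x))"
    using step by (simp add: Tv_def)
  finally show ?thesis unfolding set by simp
qed

lemma wtv_Tv: "a \<in> Ix \<Longrightarrow> b \<in> Ix \<Longrightarrow> wtv (rt b a) (Tv c a b)"
  using wtv_hrel[OF hrel_1]
  by (auto simp: Tv_def rt_def[abs_def] wtv_def[of _ 1] intro!: wtv_sum wtv_const wtv_echJ[unfolded rt_def[abs_def]])

lemma diag_Tv:
  assumes "a \<in> Ix" "b \<in> Ix" "j \<in> Ix"
  shows "e j j * Tv c a b - const (\<nu> j + of_int (rt b a j)) * Tv c a b \<in> Lv \<nu>"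
proof -
  let ?T = "Tv c a b"
  have "e j j * ?T - ?T * e j j - const (of_int (rt b a j)) * ?T \<in> Lv \<nu>"
    using wtv_Tv[OF assms(1,2), of c] assms(3) left_ideal_D(1)[OF left_ideal_Lv]
    by (simp add: wtv_def eqU_def)
  moreover have "?T * (e j j - const (\<nu> j)) \<in> Lv \<nu>"
    using assms by (intro left_ideal_D(4)[OF left_ideal_Lv] Lv_diag Tv_Cf)
  ultimately have "(e j j * ?T - ?T * e j j - const (of_int (rt b a j)) * ?T) + ?T * (e j j - const (\<nu> j)) \<in> Lv \<nu>"
    by (rule left_ideal_D(6)[OF left_ideal_Lv])
  moreover have "(e j j * ?T - ?T * e j j - const (of_int (rt b a j)) * ?T) + ?T * (e j j - const (\<nu> j))
    = e j j * ?T - const (\<nu> j + of_int (rt b a j)) * ?T"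
    by (simp add: const_add distrib_right right_diff_distrib const_mult_comm[of "\<nu> j" ?T])
  ultimately show ?thesis by simp
qed

text \<open>Here \<open>k\<close> is never the tail and \<open>l\<close> never the head of a factor
  \<open>e b x\<close> in the recursion: if \<open>b < l\<close>, then \<open>b \<le> k\<close>
  since no index lies between \<open>k\<close> and \<open>l\<close>. So \<open>e k l\<close> passes
  all factors up to sign and meets the highest weight vector.\<close>

lemma raise_low:
  assumes "a \<in> Ix" "k \<in> Ix" "l \<in> Ix" "k < l" "inner k l = {}"
  shows "b \<in> Ix \<Longrightarrow> a \<le> b \<Longrightarrow> b < l \<or> l \<le> a \<Longrightarrow> e k l * Tv c a b \<in> Lv \<nu>"
proof (induction "nat (b - a)" arbitrary: b rule: less_induct)
  case less
  note LI = left_ideal_D[OF left_ideal_Lv]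
  show ?case
  proof (cases "b = a")
    case True
    then show ?thesis using assms Lv_raise by (simp add: Tv_def)
  next
    case False
    have "e k l * (const p * (e b x * Tv c a x)) \<in> Lv \<nu>" if x: "x \<in> Ix" "a \<le> x" "x < b" for p x
    proof -
      have "k \<noteq> x" using assms less.prems x by auto
      moreover have "l \<noteq> b" using less.prems False by auto
      ultimately have "e k l * e b x \<approx> const (sgn2 k l b x) * (e b x * e k l)"
        using e_swap[of k l b x] assms less.prems x by simp
      from eqU_rmult[OF this Tv_Cf[of a x c]]
      have "(e k l * e b x) * Tv c a x \<approx> const (sgn2 k l b x) * (e b x * (e k l * Tv c a x))"
        using assms x by (simp add: mult.assoc)
      moreover have "e k l * Tv c a x \<in> Lv \<nu>"
        using x less.prems by (intro less.hyps) auto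
      then have "const (sgn2 k l b x) * (e b x * (e k l * Tv c a x)) \<in> Lv \<nu>"
        using less.prems(1) x(1) by (rule_tac LI(4)[OF Cf_closed(5) LI(4)[OF e_Cf]])
      ultimately have "(e k l * e b x) * Tv c a x \<in> Lv \<nu>"
        by (rule left_ideal_eqU[OF left_ideal_Lv])
      then have "const p * ((e k l * e b x) * Tv c a x) \<in> Lv \<nu>" by (rule LI(4)[OF Cf_closed(5)])
      then show ?thesis by (simp add: const_mult_left_comm[of "e k l"] mult.assoc)
    qed
    then show ?thesis
      using False less.prems assms
      by (simp add: Tv_rec sum_distrib_left) (intro left_ideal_sum left_ideal_Lv, auto)
  qed
qed

text \<open>In the recursion for \<open>Tv c a l\<close>, the summand \<open>x = k\<close> gives the
  Cartan element \<open>e k k - sgn2 k l l k * e l l\<close> on \<open>Tv c a k\<close>. In the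
  summands \<open>x < k\<close> the product contains the extra factor \<open>c k\<close>, and by the
  recursion they add up to \<open>c k * Tv c a k\<close>.\<close>

lemma raise_mid:
  assumes "a \<in> Ix" "k \<in> Ix" "l \<in> Ix" "k < l" "inner k l = {}" "a \<le> k"
  shows "e k l * Tv c a l - const (\<nu> k + of_int (rt k a k) - sgn2 k l l k * (\<nu> l + of_int (rt k a l))
    + (if k = a then 0 else c k)) * Tv c a k \<in> Lv \<nu>"
proof -
  note LI = left_ideal_D[OF left_ideal_Lv]
  let ?X = "{x \<in> Ix. a \<le> x \<and> x < l}" and ?Y = "{x \<in> Ix. a \<le> x \<and> x < k}"
  let ?s = "sgn2 k l l k" and ?P = "\<lambda>x. const (\<Prod>j\<in>inner x l. c j) :: falg"
  define h where "h x = (if x = k then e k k * Tv c a k - const ?s * (e l l * Tv c a k)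
    else ?P x * (e k x * Tv c a x))" for x
  have Pk: "?P k = 1" by (simp only: assms(5) prod.empty const_1)
  have "e k l * (?P x * (e l x * Tv c a x)) - h x \<in> Lv \<nu>" if x: "x \<in> ?X" for x
  proof -
    have cf: "Tv c a x \<in> Cf" using x assms by (intro Tv_Cf) auto
    have "e k l * e l x \<approx> const (sgn2 k l l x) * (e l x * e k l)
        + (e k x - (if x = k then const ?s * e l l else 0))"
      using e_swap[of k l l x] x assms by auto
    from eqU_rmult[OF this cf]
    have 1: "e k l * e l x * Tv c a x - (e k x - (if x = k then const ?s * e l l else 0)) * Tv c a x
       \<approx> const (sgn2 k l l x) * (e l x * (e k l * Tv c a x))"
      by (simp add: eqU_def algebra_simps)
    have "const (sgn2 k l l x) * (e l x * (e k l * Tv c a x)) \<in> Lv \<nu>"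
      using x assms by (intro LI(4) Cf_closed raise_low) auto
    from left_ideal_eqU[OF left_ideal_Lv 1 this]
    have "?P x * (e k l * e l x * Tv c a x - (e k x - (if x = k then const ?s * e l l else 0)) * Tv c a x) \<in> Lv \<nu>"
      by (intro LI(4) Cf_closed)
    moreover have "?P x * (e k l * e l x * Tv c a x - (e k x - (if x = k then const ?s * e l l else 0)) * Tv c a x)
      = e k l * (?P x * (e l x * Tv c a x)) - h x"
    proof (cases "x = k")
      case True
      show ?thesis unfolding True Pk by (simp add: h_def mult.assoc left_diff_distrib)
    next
      case False
      then show ?thesis
        by (simp add: h_def const_mult_left_comm[of "e k l"] mult.assoc right_diff_distrib)
    qed
    ultimately show ?thesis by simp
  qed
  then have "(\<Sum>x\<in>?X. e k l * (?P x * (e l x * Tv c a x)) - h x) \<in> Lv \<nu>"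
    by (intro left_ideal_sum left_ideal_Lv)
  then have 1: "e k l * Tv c a l - (\<Sum>x\<in>?X. h x) \<in> Lv \<nu>"
    using assms by (simp add: Tv_rec[of a l] sum_distrib_left sum_subtractf)
  have X: "?X = insert k ?Y" using assms by auto (metis (mono_tags, lifting) empty_iff mem_Collect_eq not_less_iff_gr_or_eq)
  have "(\<Sum>x\<in>?Y. h x) = (\<Sum>x\<in>?Y. const (c k) * (const (\<Prod>j\<in>inner x k. c j) * (e k x * Tv c a x)))"
  proof (rule sum.cong[OF refl])
    fix x assume x: "x \<in> ?Y"
    have "inner x l = insert k (inner x k)"
      using x assms by auto (metis (mono_tags, lifting) empty_iff mem_Collect_eq not_less_iff_gr_or_eq)
    then have "?P x = const (c k) * const (\<Prod>j\<in>inner x k. c j)" by (simp add: const_mult)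
    moreover have "h x = ?P x * (e k x * Tv c a x)" using x by (simp add: h_def)
    ultimately show "h x = const (c k) * (const (\<Prod>j\<in>inner x k. c j) * (e k x * Tv c a x))"
      by (simp only: mult.assoc)
  qed
  also have "\<dots> = const (if k = a then 0 else c k) * Tv c a k"
  proof (cases "k = a")
    case False
    then show ?thesis using assms by (simp add: Tv_rec[of a k] sum_distrib_left)
  next
    case True
    then have "?Y = {}" by auto
    then show ?thesis using True by (simp only: sum.empty) simp
  qed
  finally have 2: "(\<Sum>x\<in>?X. h x) = e k k * Tv c a k - const ?s * (e l l * Tv c a k)
      + const (if k = a then 0 else c k) * Tv c a k"
    unfolding X by (subst sum.insert) (auto simp: h_def)
  let ?u = "\<nu> k + of_int (rt k a k)" and ?v = "\<nu> l + of_int (rt k a l)"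
  have 3: "(e k k * Tv c a k - const ?u * Tv c a k) - const ?s * (e l l * Tv c a k - const ?v * Tv c a k) \<in> Lv \<nu>"
    using assms by (intro LI(3,4) diag_Tv Cf_closed) auto
  have eq: "const (?u - ?s * ?v + (if k = a then 0 else c k)) * Tv c a k
    = const ?u * Tv c a k - const ?s * (const ?v * Tv c a k) + const (if k = a then 0 else c k) * Tv c a k"
    by (simp only: const_add[of "?u - ?s * ?v"] const_diff const_mult distrib_right left_diff_distrib mult.assoc)
  show ?thesis
    using LI(6)[OF 1 3] unfolding 2 eq by (simp add: algebra_simps split del: if_split)
qed

text \<open>Only two summands of the recursion survive: \<open>x = k\<close> through the bracket
  with \<open>e b k\<close>, and \<open>x = l\<close> through \<open>raise_mid\<close>, whose scalar
  is given by the assumption \<kappa>. Both are multiples of \<open>e b l * Tv c a k\<close>, and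
  they cancel. For \<open>x < k\<close> the lemma \<open>raise_low\<close> applies, for
  \<open>l < x\<close> the induction hypothesis.\<close>

lemma raise_high:
  assumes "a \<in> Ix" "k \<in> Ix" "l \<in> Ix" "k < l" "inner k l = {}" "a \<le> k"
    and \<kappa>: "\<nu> k + of_int (rt k a k) - sgn2 k l l k * (\<nu> l + of_int (rt k a l))
      + (if k = a then 0 else c k) = sgn2 k l l k * c l"
  shows "b \<in> Ix \<Longrightarrow> l < b \<Longrightarrow> e k l * Tv c a b \<in> Lv \<nu>"
proof (induction "nat (b - l)" arbitrary: b rule: less_induct)
  case less
  note LI = left_ideal_D[OF left_ideal_Lv]
  let ?X = "{x \<in> Ix. a \<le> x \<and> x < b}" and ?P = "\<lambda>x. const (\<Prod>j\<in>inner x b. c j) :: falg"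
  let ?w = "?P l * (e b l * Tv c a k)"
  \<comment> \<open>The coefficient of \<open>?w\<close> in the summand \<open>x\<close>. The factor
    \<open>c l\<close> for \<open>x = k\<close> comes from the product over the indices above
    \<open>k\<close>, which include \<open>l\<close>.\<close>
  define q where "q x = (if x = k then - sgn2 k l b k * c l else if x = l then sgn2 k l b l * sgn2 k l l k * c l else 0)" for x
  have P: "?P k = const (c l) * ?P l"
  proof -
    have "inner k b = insert l (inner l b)" using assms less.prems by auto
    then show ?thesis by (simp add: const_mult)
  qed
  have "e k l * (?P x * (e b x * Tv c a x)) - const (q x) * ?w \<in> Lv \<nu>" if x: "x \<in> ?X" for x
  proof -
    have cf: "Tv c a x \<in> Cf" using x assms by (intro Tv_Cf) auto
    let ?s = "sgn2 k l b x"
    have "e k l * e b x \<approx> const ?s * (e b x * e k l) - (if x = k then const ?s * e b l else 0)"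
      using e_swap[of k l b x] x assms less.prems by (auto simp: eq_commute)
    from eqU_rmult[OF this cf]
    have "e k l * e b x * Tv c a x \<approx> const ?s * (e b x * (e k l * Tv c a x))
        - (if x = k then const ?s * (e b l * Tv c a x) else 0)"
      by (auto simp: left_diff_distrib mult.assoc)
    from eqU_lmult[OF this, of "?P x"]
    have 1: "e k l * (?P x * (e b x * Tv c a x)) \<approx> ?P x * (const ?s * (e b x * (e k l * Tv c a x)))
        - (if x = k then ?P k * (const ?s * (e b l * Tv c a k)) else 0)"
      by (auto simp: const_mult_left_comm[of "e k l"] mult.assoc right_diff_distrib Cf_closed)
    consider "x = k" | "x = l" | "x \<noteq> k" "x < l" | "l < x" by linarith
    then show ?thesis
    proof cases
      case c1: 1
      have "?P x * (const ?s * (e b x * (e k l * Tv c a x))) \<in> Lv \<nu>"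
        using c1 assms less.prems by (intro LI(4) Cf_closed raise_low) auto
      moreover have "?P k * (const ?s * (e b l * Tv c a k)) = - const (q x) * ?w"
        unfolding P using c1 by (simp add: q_def const_uminus const_mult mult.assoc const_mult_left_comm[of "?P l"]
            const_mult_left_comm[of "const (c l)" "sgn2 k l b k"])
      ultimately show ?thesis
        using left_ideal_eqU[OF left_ideal_Lv, of "e k l * (?P x * (e b x * Tv c a x)) - const (q x) * ?w"
          "?P x * (const ?s * (e b x * (e k l * Tv c a x)))"] 1 c1 by (simp add: eqU_def algebra_simps)
    next
      case 2
      have m: "e k l * Tv c a l - const (sgn2 k l l k * c l) * Tv c a k \<in> Lv \<nu>"
        using raise_mid[OF assms(1-6), of c \<nu>] by (simp only: \<kappa>)
      have "?P l * (const ?s * (e b l * (e k l * Tv c a l - const (sgn2 k l l k * c l) * Tv c a k))) \<in> Lv \<nu>"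
        using assms less.prems by (intro LI(4) Cf_closed m) auto
      moreover have "?P l * (const ?s * (e b l * (e k l * Tv c a l - const (sgn2 k l l k * c l) * Tv c a k)))
        = ?P l * (const ?s * (e b l * (e k l * Tv c a l))) - const (q l) * ?w"
      proof -
        have "?P l * (const ?s * (e b l * (const r * y))) = const (?s * r) * (?P l * (e b l * y))" for r y
          by (simp only: const_mult_left_comm[of "e b l" r] const_mult_left_comm[of "?P l"] const_mult mult.assoc)
        moreover have "q l = ?s * (sgn2 k l l k * c l)" using 2 assms by (simp add: q_def)
        ultimately show ?thesis by (simp only: right_diff_distrib)
      qed
      ultimately show ?thesis
        using left_ideal_eqU[OF left_ideal_Lv, of "e k l * (?P x * (e b x * Tv c a x)) - const (q x) * ?w"
          "?P x * (const ?s * (e b x * (e k l * Tv c a x))) - const (q x) * ?w"] 1 2 assms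
        by (simp add: eqU_def algebra_simps)
    next
      case 3
      have "?P x * (const ?s * (e b x * (e k l * Tv c a x))) \<in> Lv \<nu>"
        using 3 x assms less.prems by (intro LI(4) Cf_closed raise_low) auto
      then show ?thesis using left_ideal_eqU[OF left_ideal_Lv 1] 3 by (simp add: q_def)
    next
      case 4
      have "?P x * (const ?s * (e b x * (e k l * Tv c a x))) \<in> Lv \<nu>"
        using 4 x assms less by (intro LI(4) Cf_closed less.hyps) auto
      then show ?thesis using left_ideal_eqU[OF left_ideal_Lv 1] 4 assms by (simp add: q_def)
    qed
  qed
  then have "(\<Sum>x\<in>?X. e k l * (?P x * (e b x * Tv c a x)) - const (q x) * ?w) \<in> Lv \<nu>"
    by (intro left_ideal_sum left_ideal_Lv)
  then have "e k l * Tv c a b - const (\<Sum>x\<in>?X. q x) * ?w \<in> Lv \<nu>"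
    using assms less.prems by (simp add: Tv_rec[of a b] sum_distrib_left sum_subtractf const_sum sum_distrib_right)
  moreover have "(\<Sum>x\<in>?X. q x) = 0"
  proof -
    have "(\<Sum>x\<in>?X. q x) = (\<Sum>x\<in>{k, l}. q x)"
      using assms less.prems by (intro sum.mono_neutral_right) (auto simp: q_def)
    \<comment> \<open>The cancellation is multiplicativity of the sign along \<open>b\<close>,
      \<open>l\<close>, \<open>k\<close>.\<close>
    also have "\<dots> = 0" using assms(4) by (auto simp: q_def sgn2_def par2_def par_def)
    finally show ?thesis .
  qed
  ultimately show ?case by simp
qed

text \<open>The simple root vectors generate n^+: \<open>e k l\<close> is the superbracket of
  \<open>e k x\<close> and \<open>e x l\<close> for any index \<open>x\<close> in between.\<close>

lemma raise_all:
  assumes T: "T \<in> Cf"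
    and adj: "\<And>k l. k \<in> Ix \<Longrightarrow> l \<in> Ix \<Longrightarrow> k < l \<Longrightarrow> inner k l = {} \<Longrightarrow> e k l * T \<in> Lv \<nu>"
  shows "k \<in> Ix \<Longrightarrow> l \<in> Ix \<Longrightarrow> k < l \<Longrightarrow> e k l * T \<in> Lv \<nu>"
proof (induction "nat (l - k)" arbitrary: k l rule: less_induct)
  case less
  note LI = left_ideal_D[OF left_ideal_Lv]
  show ?case
  proof (cases "inner k l = {}")
    case False
    then obtain x where x: "x \<in> Ix" "k < x" "x < l" by auto
    have "e k x * e x l \<approx> const (sgn2 k x x l) * (e x l * e k x) + e k l"
      using e_swap[of k x x l] x less.prems by simp
    then have "- (e k x * e x l - (const (sgn2 k x x l) * (e x l * e k x) + e k l)) \<in> Uid"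
      unfolding eqU_def by (rule Uid_uminus)
    then have "e k l \<approx> e k x * e x l - const (sgn2 k x x l) * (e x l * e k x)"
      by (simp add: eqU_def algebra_simps)
    from eqU_rmult[OF this T]
    have 1: "e k l * T \<approx> e k x * (e x l * T) - const (sgn2 k x x l) * (e x l * (e k x * T))"
      by (simp add: left_diff_distrib mult.assoc)
    have "e k x * (e x l * T) - const (sgn2 k x x l) * (e x l * (e k x * T)) \<in> Lv \<nu>"
      using less.prems x
      by (intro LI(3) LI(4)[OF e_Cf less.hyps] LI(4)[OF Cf_closed(5) LI(4)[OF e_Cf less.hyps]]) auto
    then show ?thesis by (rule left_ideal_eqU[OF left_ideal_Lv 1])
  qed (use adj less in auto)
qed

text \<open>For \<open>k = -1\<close>, \<open>l = 1\<close> this is where atypicality enters.\<close>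

lemma raise_scalar:
  assumes s: "1 \<le> s" "- int s \<in> Ix" and t: "1 \<le> t" "int t \<in> Ix"
    and at: "\<nu> (- int s) + \<nu> (int t) + of_nat s - of_nat t = 0"
    and kl: "k \<in> Ix" "l \<in> Ix" "k < l" "inner k l = {}" "- int s \<le> k" "l \<le> int t"
  shows "\<nu> k + of_int (rt k (- int s) k) - sgn2 k l l k * (\<nu> l + of_int (rt k (- int s) l))
      + (if k = - int s then 0 else c_scal \<nu> s t k) = sgn2 k l l k * c_scal \<nu> s t l"
proof -
  have "k \<noteq> 0" "l \<noteq> 0" using kl by (auto simp: idx_def)
  moreover have "l = k + 1 \<or> k = -1 \<and> l = 1"
  proof (rule ccontr)
    assume *: "\<not> (l = k + 1 \<or> k = -1 \<and> l = 1)"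
    \<comment> \<open>The successor of \<open>k\<close> in the index set, which omits 0.\<close>
    let ?x = "if k = -1 then 1 else k + 1"
    have "?x \<in> inner k l" using * kl \<open>k \<noteq> 0\<close> \<open>l \<noteq> 0\<close> by (auto simp: idx_def)
    then show False using kl by blast
  qed
  moreover have "\<nu> (int t) = of_nat t - of_nat s - \<nu> (- int s)"
    using at by (simp add: algebra_simps eq_neg_iff_add_eq_0)
  ultimately show ?thesis
    using kl(3,5,6) s t by (auto simp: c_scal_def rt_def sgn2_def par2_def par_def algebra_simps)
qed

lemma raise_Tv:
  assumes s: "1 \<le> s" "- int s \<in> Ix" and t: "1 \<le> t" "int t \<in> Ix"
    and at: "\<nu> (- int s) + \<nu> (int t) + of_nat s - of_nat t = 0"
    and "i \<in> Ix" "j \<in> Ix" "i < j"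
  shows "e i j * Tv (c_scal \<nu> s t) (- int s) (int t) \<in> Lv \<nu>"
proof (rule raise_all[OF Tv_Cf[OF s(2) t(2)] _ assms(6-8)])
  let ?a = "- int s" and ?b = "int t" and ?c = "c_scal \<nu> s t"
  fix k l assume kl: "k \<in> Ix" "l \<in> Ix" "k < l" "inner k l = {}"
  show "e k l * Tv ?c ?a ?b \<in> Lv \<nu>"
  proof (cases "?b < l \<or> l \<le> ?a")
    case True
    then show ?thesis using raise_low[OF s(2) kl t(2)] by auto
  next
    case False
    then have l: "?a < l" "l \<le> ?b" by auto
    have k: "?a \<le> k"
    proof (rule ccontr)
      assume "\<not> ?a \<le> k"
      then have "?a \<in> inner k l" using l s by auto
      then show False using kl by blast
    qed
    note \<kappa> = raise_scalar[OF s t at kl k l(2)]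
    show ?thesis
    proof (cases "l = ?b")
      case True
      \<comment> \<open>At the upper end the scalar of \<open>raise_mid\<close> is a sign times this
        value.\<close>
      have "?c ?b = 0" using t by (simp add: c_scal_def)
      then show ?thesis using raise_mid[OF s(2) kl k, of ?c \<nu>] \<kappa> True by simp
    next
      case False
      then show ?thesis using raise_high[OF s(2) kl k \<kappa> t(2)] l by auto
    qed
  qed
qed

end

section \<open>The enveloping algebra of the lower triangular subalgebra\<close>

context super_gl begin

definition ub :: "falg \<Rightarrow> bool" where "ub a \<longleftrightarrow> a \<in> Cf \<and> cls a \<in> Ub_minus m n"

lemma ub_Cf: "ub a \<Longrightarrow> a \<in> Cf"
  by (simp add: ub_def)

lemma ub_const: "ub (const c)"
  unfolding ub_def Ub_minus_def
  by (auto simp: scal_cls[symmetric] intro!: Cf_closed generate_ring.incl)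

lemma ub_e:
  assumes "i \<in> Ix" "j \<in> Ix" "j \<le> i"
  shows "ub (e i j)"
proof -
  have "munit i j \<in> b_minus m n"
    using assms by (auto simp: b_minus_def gl_munit) (auto simp: munit_def split: if_splits)
  moreover have "cls (e i j) = emb m n (munit i j)" by (simp add: emb_cls e_def)
  ultimately show ?thesis
    using assms unfolding ub_def Ub_minus_def by (auto intro!: generate_ring.incl)
qed

lemma ub_add: "ub a \<Longrightarrow> ub b \<Longrightarrow> ub (a + b)"
  unfolding ub_def Ub_minus_def by (auto simp: cls_add[symmetric] intro!: Cf_closed generate_ring.eng_add)

lemma ub_mult: "ub a \<Longrightarrow> ub b \<Longrightarrow> ub (a * b)"
  unfolding ub_def Ub_minus_def by (auto simp: cls_mult[symmetric] intro!: Cf_closed generate_ring.eng_mult)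

lemma ub_diff: "ub a \<Longrightarrow> ub b \<Longrightarrow> ub (a - b)"
  using ub_add[OF _ ub_mult[OF ub_const[of "-1"]], of a b] by (simp add: const_uminus)

lemma ub_sum: "(\<And>x. x \<in> S \<Longrightarrow> ub (f x)) \<Longrightarrow> ub (sum f S)"
  using ub_const[of 0] by (induction S rule: infinite_finite_induct) (auto intro: ub_add)

lemma ub_hrel: "hrel Ix x f \<Longrightarrow> ub x"
  by (induction rule: hrel.induct) (auto intro: ub_const ub_add ub_mult ub_e)

lemma ub_ech: "sorted_wrt (<) (a # js @ [b]) \<Longrightarrow> a \<in> Ix \<Longrightarrow> b \<in> Ix \<Longrightarrow> set js \<subseteq> Ix \<Longrightarrow> ub (ech b a js)"
  by (induction js arbitrary: a) (auto intro!: ub_mult ub_e)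

lemma ub_echJ: "a \<in> Ix \<Longrightarrow> b \<in> Ix \<Longrightarrow> a < b \<Longrightarrow> J \<in> Pow (inner a b) \<Longrightarrow> ub (echJ b a J)"
  using finite_J[of J a b] by (intro ub_ech) (auto simp: sorted_wrt_append)

text \<open>The property is formulated for left multiplication by a lift, so that it passes to
  products; applied to 1 it yields the decomposition of the element itself in
  \<open>ub_dec\<close>.\<close>

lemma Ub_minus_dec:
  assumes "X \<in> Ub_minus m n"
  shows "\<exists>a\<in>Cf. X = cls a \<and> (\<forall>z. dec Uid z \<longrightarrow> dec Uid (a * z))"
  using assms unfolding Ub_minus_def
proof (induction rule: generate_ring.induct)
  case one
  show ?case by (intro bexI[of _ 1]) (auto simp: cls_one Cf_closed)
next
  case (incl h)
  then consider c where "h = scal m n c" | X where "X \<in> b_minus m n" "h = emb m n X" by blast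
  then show ?case
  proof cases
    case 1
    then show ?thesis
      by (intro bexI[of _ "const c"]) (auto simp: scal_cls Cf_closed intro: dec_const left_ideal_Uid)
  next
    case 2
    have "dec Uid (gen X * z)" if "dec Uid z" for z
    proof (rule dec_gen_mult[OF b_minus_gl[OF 2(1)] left_ideal_Uid that])
      fix i j assume "i \<in> Ix" "j \<in> Ix" "X i j \<noteq> 0"
      then show "dec Uid (e i j * z)"
        using 2 by (intro dec_e_low left_ideal_Uid that) (auto simp: b_minus_def)
    qed
    then show ?thesis using 2 by (intro bexI[of _ "gen X"]) (auto simp: emb_cls gen_Cf b_minus_gl)
  qed
next
  case (a_inv h)
  then obtain a where a: "a \<in> Cf" "h = cls a" "\<And>z. dec Uid z \<Longrightarrow> dec Uid (a * z)" by blast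
  have "dec Uid (- a * z)" if "dec Uid z" for z
    using dec_const[OF a(3)[OF that] left_ideal_Uid, of "-1"] by (simp add: const_uminus)
  then show ?case using a by (intro bexI[of _ "- a"]) (auto simp: cls_uminus Cf_closed)
next
  case (eng_add h1 h2)
  then obtain a b where ab: "a \<in> Cf" "h1 = cls a" "\<And>z. dec Uid z \<Longrightarrow> dec Uid (a * z)"
    "b \<in> Cf" "h2 = cls b" "\<And>z. dec Uid z \<Longrightarrow> dec Uid (b * z)" by blast
  then show ?case
    by (intro bexI[of _ "a + b"]) (auto simp: cls_add Cf_closed distrib_right intro: dec_add)
next
  case (eng_mult h1 h2)
  then obtain a b where ab: "a \<in> Cf" "h1 = cls a" "\<And>z. dec Uid z \<Longrightarrow> dec Uid (a * z)"
    "b \<in> Cf" "h2 = cls b" "\<And>z. dec Uid z \<Longrightarrow> dec Uid (b * z)" by blast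
  then show ?case
    by (intro bexI[of _ "a * b"]) (auto simp: cls_mult Cf_closed mult.assoc)
qed

lemma dec_Uid_const: "dec Uid (const c)"
  using hrel_const by (intro dec_Z[of "wtw []"] Z_base[of "[]", simplified]) auto

lemma ub_dec:
  assumes "ub a"
  shows "dec Uid a"
proof -
  obtain a' where a': "a' \<in> Cf" "cls a = cls a'" "\<And>z. dec Uid z \<Longrightarrow> dec Uid (a' * z)"
    using Ub_minus_dec assms unfolding ub_def by blast
  have "dec Uid a'" using a'(3)[OF dec_Uid_const[of 1]] by simp
  moreover have "a \<approx> a'" using a' cls_eq ub_Cf[OF assms] by blast
  ultimately show ?thesis using ub_Cf[OF assms] by (rule_tac dec_eq) (auto simp: eqU_def)
qed

lemma cartan_expand:
  assumes "h \<in> cartan m n"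
  shows "gen h \<approx> (\<Sum>k\<in>Ix. const (h k k) * e k k)"
proof -
  have off: "h i j = 0" if "i \<noteq> j" for i j
    using assms that by (auto simp: cartan_def)
  have "(\<Sum>i\<in>Ix. \<Sum>j\<in>Ix. const (h i j) * e i j) = (\<Sum>i\<in>Ix. const (h i i) * e i i)"
  proof (rule sum.cong[OF refl])
    fix i assume i: "i \<in> Ix"
    have "(\<Sum>j\<in>Ix. const (h i j) * e i j) = (\<Sum>j\<in>{i}. const (h i j) * e i j)"
      using i off by (intro sum.mono_neutral_right) auto
    then show "(\<Sum>j\<in>Ix. const (h i j) * e i j) = const (h i i) * e i i" by simp
  qed
  then show ?thesis using gen_expand[OF cartan_gl[OF assms]] by (simp add: eqU_def)
qed

lemma cartan_munit: "k \<in> Ix \<Longrightarrow> munit k k \<in> cartan m n"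
  by (auto simp: cartan_def gl_munit) (auto simp: munit_def split: if_splits)

text \<open>The Cartan subalgebra is spanned by the diagonal matrix units, so the weight condition
  can be tested on them, with integer weights.\<close>

lemma cls_weight_iff:
  assumes a: "a \<in> Cf" and \<mu>: "\<And>k. k \<in> Ix \<Longrightarrow> \<mu> k = of_int (\<gamma> k)"
  shows "cls a \<in> Ub_minus_wt m n \<mu> \<longleftrightarrow> ub a \<and> wtv \<gamma> a"
proof -
  have eq: "emb m n h \<otimes>\<^bsub>U m n\<^esub> cls a \<ominus>\<^bsub>U m n\<^esub> cls a \<otimes>\<^bsub>U m n\<^esub> emb m n h
       = scal m n (wt_eval m n \<mu> h) \<otimes>\<^bsub>U m n\<^esub> cls a
     \<longleftrightarrow> gen h * a - a * gen h \<approx> const (wt_eval m n \<mu> h) * a" if "h \<in> cartan m n" for h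
    using a that by (simp add: emb_cls scal_cls cls_mult cls_minus cls_eq Cf_closed gen_Cf cartan_gl)
  have "gen h * a - a * gen h \<approx> const (wt_eval m n \<mu> h) * a" if w: "wtv \<gamma> a" and h: "h \<in> cartan m n" for h
  proof -
    let ?H = "\<Sum>k\<in>Ix. const (h k k) * e k k"
    have "gen h * a - a * gen h \<approx> ?H * a - a * ?H"
      using cartan_expand[OF h] a by (intro eqU_diff eqU_rmult eqU_lmult)
    also have "\<dots> = (\<Sum>k\<in>Ix. const (h k k) * (e k k * a - a * e k k))"
      by (simp add: sum_distrib_left sum_distrib_right sum_subtractf right_diff_distrib mult.assoc
          const_mult_left_comm[of a])
    also have "\<dots> \<approx> (\<Sum>k\<in>Ix. const (h k k) * (const (of_int (\<gamma> k)) * a))"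
      using w unfolding wtv_def by (intro eqU_sum eqU_lmult Cf_closed) auto
    also have "\<dots> = const (wt_eval m n \<mu> h) * a"
    proof -
      have "wt_eval m n \<mu> h = (\<Sum>k\<in>Ix. h k k * of_int (\<gamma> k))"
        unfolding wt_eval_def by (intro sum.cong refl) (simp add: \<mu>)
      then show ?thesis by (simp add: const_sum const_mult sum_distrib_right mult.assoc)
    qed
    finally show ?thesis .
  qed
  moreover have "wtv \<gamma> a" if "\<forall>h\<in>cartan m n. gen h * a - a * gen h \<approx> const (wt_eval m n \<mu> h) * a"
    unfolding wtv_def
  proof
    fix k assume k: "k \<in> Ix"
    then show "e k k * a - a * e k k \<approx> const (of_int (\<gamma> k)) * a"
      using that[rule_format, OF cartan_munit[OF k]] \<mu> by (simp add: e_def wt_eval_munit)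
  qed
  ultimately have "(\<forall>h\<in>cartan m n. gen h * a - a * gen h \<approx> const (wt_eval m n \<mu> h) * a) \<longleftrightarrow> wtv \<gamma> a"
    by blast
  then show ?thesis using eq a unfolding Ub_minus_wt_def ub_def by simp
qed

text \<open>A normal form for the weight space of U(b^-): the decomposition of \<open>D\<close> is
  compared with \<open>D\<close> itself by independence of weights, and the component that remains
  is straightened into chains.\<close>

lemma chain_form:
  assumes ab: "a \<in> Ix" "b \<in> Ix" "a < b" and D: "ub D" "wtv (rt b a) D"
  shows "\<exists>x f. (\<forall>J\<in>Pow (inner a b). hrel Ix (x J) (f J)) \<and> D \<approx> (\<Sum>J\<in>Pow (inner a b). echJ b a J * x J)"
proof -
  let ?g = "rt b a"
  obtain G u where G: "finite G" "\<And>\<gamma> k. \<gamma> \<in> G \<Longrightarrow> k \<notin> Ix \<Longrightarrow> \<gamma> k = 0" "\<And>\<gamma>. Z \<gamma> (u \<gamma>)"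
    "D - (\<Sum>\<gamma>\<in>G. u \<gamma>) \<in> Uid"
    using dec_family_supp[OF ub_dec[OF D(1)] left_ideal_Uid] by metis
  define v where "v \<gamma> = (if \<gamma> \<in> G then u \<gamma> else 0)" for \<gamma>
  \<comment> \<open>Subtracting \<open>D\<close> in its own weight turns the decomposition into a
    relation of sum zero. The component \<open>v\<close> covers the possibility that this weight is
    absent from \<open>G\<close>.\<close>
  define w where "w \<gamma> = v \<gamma> - (if \<gamma> = ?g then D else 0)" for \<gamma>
  have Zv: "Z \<gamma> (v \<gamma>)" for \<gamma> using G(3) by (auto simp: v_def intro: Z_0)
  have "w ?g \<approx> 0"
  proof (rule wtv_indep[where G = "insert ?g G" and u = w])
    show "wtv \<gamma> (w \<gamma>) \<and> w \<gamma> \<in> Cf" for \<gamma>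
      using Z_wtv[OF Zv] Z_Cf[OF Zv] D ub_Cf
      by (auto simp: w_def intro!: wtv_diff wtv_0 Cf_closed)
    have "(\<Sum>\<gamma>\<in>insert ?g G. v \<gamma>) = (\<Sum>\<gamma>\<in>G. u \<gamma>)"
      using G(1) by (cases "?g \<in> G") (auto simp: v_def insert_absorb)
    moreover have "(\<Sum>\<gamma>\<in>insert ?g G. if \<gamma> = ?g then D else 0) = D"
      using G(1) by (simp add: sum.delta)
    ultimately have "(\<Sum>\<gamma>\<in>insert ?g G. w \<gamma>) = - (D - (\<Sum>\<gamma>\<in>G. u \<gamma>))"
      unfolding w_def sum_subtractf by simp
    then show "(\<Sum>\<gamma>\<in>insert ?g G. w \<gamma>) \<approx> 0" unfolding eqU_0 using Uid_uminus[OF G(4)] by simp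
    have out: "\<gamma> k = 0" if "\<gamma> \<in> insert ?g G" "k \<notin> Ix" for \<gamma> k
      using that G(2) ab by (auto simp: rt_def)
    show "\<gamma> = \<gamma>'" if "\<gamma> \<in> insert ?g G" "\<gamma>' \<in> insert ?g G" "\<And>k. k \<in> Ix \<Longrightarrow> \<gamma> k = \<gamma>' k" for \<gamma> \<gamma>'
    proof
      fix k show "\<gamma> k = \<gamma>' k"
        using that(3)[of k] out[OF that(1), of k] out[OF that(2), of k] by (cases "k \<in> Ix") auto
    qed
  qed (use G(1) in auto)
  then have "D \<approx> v ?g" using eqU_sym[of "v ?g" D] by (simp add: w_def eqU_def)
  then show ?thesis using Z_chain[OF Zv refl ab] eqU_trans by blast
qed

text \<open>The Cartan factors stand on the right and can be replaced by their values at \<nu>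
  modulo \<open>Lv \<nu>\<close>; independence of the chains then applies to these values.\<close>

lemma chain_form_Lv:
  assumes ab: "a \<in> Ix" "b \<in> Ix" "a < b"
    and x: "\<And>J. J \<in> Pow (inner a b) \<Longrightarrow> hrel Ix (x J) (f J)"
    and D: "D \<approx> (\<Sum>J\<in>Pow (inner a b). echJ b a J * x J)" "D \<in> Lv \<nu>"
    and J: "J \<in> Pow (inner a b)"
  shows "f J \<nu> = 0"
proof -
  note LI = left_ideal_D[OF left_ideal_Lv]
  have "(\<Sum>J\<in>Pow (inner a b). echJ b a J * (x J - const (f J \<nu>))) \<in> Lv \<nu>"
    using ab x by (intro left_ideal_sum left_ideal_Lv LI(4) echJ_Cf Lv_hrel) auto
  moreover have "(\<Sum>J\<in>Pow (inner a b). echJ b a J * x J) \<in> Lv \<nu>"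
    using left_ideal_eqU[OF left_ideal_Lv eqU_sym[OF D(1)] D(2)] .
  ultimately have "(\<Sum>J\<in>Pow (inner a b). echJ b a J * x J)
      - (\<Sum>J\<in>Pow (inner a b). echJ b a J * (x J - const (f J \<nu>))) \<in> Lv \<nu>" by (intro LI(3))
  then have "(\<Sum>J\<in>Pow (inner a b). const (f J \<nu>) * echJ b a J) \<in> Lv \<nu>"
    by (simp add: sum_subtractf[symmetric] right_diff_distrib const_mult_comm)
  from echJ_independent[OF ab this J] show ?thesis .
qed

section \<open>The Shapovalov element\<close>

lemma E_chain_cls: "a \<in> Ix \<Longrightarrow> b \<in> Ix \<Longrightarrow> set js \<subseteq> Ix \<Longrightarrow> E_chain m n b a js = cls (ech b a js)"
  by (induction js arbitrary: a) (auto simp: E_cls cls_mult ech_Cf)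

definition Ct :: "nat \<Rightarrow> nat \<Rightarrow> int \<Rightarrow> falg" where
  "Ct s t k = (if k < 0 then e (- int s) (- int s) - e k k + const (of_int (int s - 1 + k))
      else e (int t) (int t) - e k k - const (of_int (int t - k)))"

definition Cp :: "nat \<Rightarrow> nat \<Rightarrow> int list \<Rightarrow> falg" where
  "Cp s t js = foldr (\<lambda>k u. Ct s t k * u) js 1"

definition Theta :: "nat \<Rightarrow> nat \<Rightarrow> falg" where
  "Theta s t = (\<Sum>J\<in>Pow (inner (- int s) (int t)). echJ (int t) (- int s) J
     * Cp s t (sorted_list_of_set (inner (- int s) (int t) - J)))"

text \<open>Written as a difference to match the divisor of \<open>hrel_div\<close>: the subtracted
  part does not involve \<open>e (- int s) (- int s)\<close>.\<close>

definition Atyp :: "nat \<Rightarrow> nat \<Rightarrow> falg" where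
  "Atyp s t = e (- int s) (- int s) - (- e (int t) (int t) - const (of_int (int s - int t)))"

end

section \<open>A fixed odd root: lifts of the defined elements, uniqueness and singularity\<close>

locale odd_pair = super_gl +
  fixes s t :: nat
  assumes st: "1 \<le> s" "s \<le> m" "1 \<le> t" "t \<le> n"
begin

abbreviation "sa \<equiv> - int s"
abbreviation "tb \<equiv> int t"
abbreviation "PJ \<equiv> Pow (inner sa tb)"

lemma ab: "sa \<in> Ix" "tb \<in> Ix" "sa < tb"
  using st by (auto simp: idx_def)

lemma between_eq: "between s t = inner sa tb"
  using st by (auto simp: between_def idx_def)

lemma hrel_Ct: "k \<in> Ix \<Longrightarrow> hrel Ix (Ct s t k) (\<lambda>\<nu>. c_scal \<nu> s t k)"
  unfolding Ct_def c_scal_def using ab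
  by (cases "k < 0") (auto intro!: hrel_add hrel_diff hrel_gen hrel_const)

lemma C_elt_cls: "k \<in> Ix \<Longrightarrow> C_elt m n s t k = cls (Ct s t k)"
  using ab by (simp add: C_elt_def Ct_def E_cls scal_cls cls_add cls_minus Cf_closed)

lemma hrel_Cp: "set js \<subseteq> Ix \<Longrightarrow> hrel Ix (Cp s t js) (\<lambda>\<nu>. \<Prod>k\<leftarrow>js. c_scal \<nu> s t k)"
  by (induction js) (auto simp: Cp_def intro: hrel_1 hrel_mult hrel_Ct)

lemma C_prod_cls:
  assumes "K \<subseteq> Ix"
  shows "C_prod m n s t K = cls (Cp s t (sorted_list_of_set K))"
proof -
  have "foldr (\<lambda>k u. C_elt m n s t k \<otimes>\<^bsub>U m n\<^esub> u) js \<one>\<^bsub>U m n\<^esub> = cls (Cp s t js)" if "set js \<subseteq> Ix" for js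
    using that
  proof (induction js)
    case (Cons k js)
    have "Ct s t k \<in> Cf" "Cp s t js \<in> Cf"
      using Cons.prems hrel_Cf[OF hrel_Ct] hrel_Cf[OF hrel_Cp] by auto
    then show ?case using Cons by (simp add: Cp_def C_elt_cls cls_mult)
  qed (simp add: Cp_def cls_one)
  moreover have "finite K" using assms finite_Ix by (rule finite_subset)
  ultimately show ?thesis using assms by (simp add: C_prod_def)
qed

lemma hrel_CpJ:
  "J \<in> PJ \<Longrightarrow> hrel Ix (Cp s t (sorted_list_of_set (inner sa tb - J))) (\<lambda>\<nu>. \<Prod>k\<in>inner sa tb - J. c_scal \<nu> s t k)"
proof -
  let ?js = "sorted_list_of_set (inner sa tb - J)"
  have "set ?js = inner sa tb - J" by simp
  moreover have "(\<Prod>k\<leftarrow>?js. c_scal \<nu> s t k) = (\<Prod>k\<in>inner sa tb - J. c_scal \<nu> s t k)" for \<nu>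
    by (subst prod.distinct_set_conv_list[symmetric]) auto
  ultimately show ?thesis using hrel_Cp[of ?js] by auto
qed

lemma CpJ_Cf: "J \<in> PJ \<Longrightarrow> Cp s t (sorted_list_of_set (inner sa tb - J)) \<in> Cf"
  using hrel_CpJ hrel_Cf by blast

lemma E_J_cls: "J \<in> PJ \<Longrightarrow> E_J m n s t J = cls (echJ tb sa J)"
  unfolding E_J_def using finite_J[of J sa tb] ab by (intro E_chain_cls) auto

lemma Theta_Cf: "Theta s t \<in> Cf"
  unfolding Theta_def using ab by (intro Cf_closed echJ_Cf CpJ_Cf) auto

lemma theta_cls: "theta m n s t = cls (Theta s t)"
proof -
  interpret ring "U m n" by (rule ring_U)
  have "theta m n s t = (\<Oplus>\<^bsub>U m n\<^esub>J\<in>PJ. cls (echJ tb sa J * Cp s t (sorted_list_of_set (inner sa tb - J))))"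
    unfolding theta_def between_eq
  proof (rule finsum_cong')
    fix J assume J: "J \<in> PJ"
    have K: "inner sa tb - J \<subseteq> Ix" by auto
    show "E_J m n s t J \<otimes>\<^bsub>U m n\<^esub> C_prod m n s t (inner sa tb - J)
        = cls (echJ tb sa J * Cp s t (sorted_list_of_set (inner sa tb - J)))"
      using J K echJ_Cf[OF ab(1,2) J] CpJ_Cf[OF J] by (simp add: E_J_cls C_prod_cls cls_mult)
  qed (use ab echJ_Cf CpJ_Cf in \<open>auto intro!: cls_closed Cf_closed\<close>)
  also have "\<dots> = cls (Theta s t)"
    unfolding Theta_def using ab by (intro cls_finsum Cf_closed echJ_Cf CpJ_Cf) auto
  finally show ?thesis .
qed

lemma S_elt_cls: "S_elt m n s t \<nu> = cls (Tv (c_scal \<nu> s t) sa tb)"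
proof -
  interpret ring "U m n" by (rule ring_U)
  have "S_elt m n s t \<nu> = (\<Oplus>\<^bsub>U m n\<^esub>J\<in>PJ. cls (const (\<Prod>k\<in>inner sa tb - J. c_scal \<nu> s t k) * echJ tb sa J))"
    unfolding S_elt_def between_eq
  proof (rule finsum_cong')
    fix J assume J: "J \<in> PJ"
    show "scal m n (d_coeff \<nu> s t J) \<otimes>\<^bsub>U m n\<^esub> E_J m n s t J
        = cls (const (\<Prod>k\<in>inner sa tb - J. c_scal \<nu> s t k) * echJ tb sa J)"
      using J echJ_Cf[OF ab(1,2) J]
      by (simp add: E_J_cls scal_cls cls_mult d_coeff_def between_eq Cf_closed)
  qed (use ab echJ_Cf in \<open>auto intro!: cls_closed Cf_closed\<close>)
  also have "\<dots> = cls (\<Sum>J\<in>PJ. const (\<Prod>k\<in>inner sa tb - J. c_scal \<nu> s t k) * echJ tb sa J)"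
    using ab by (intro cls_finsum Cf_closed echJ_Cf) auto
  finally show ?thesis using ab by (simp add: Tv_def)
qed

lemma Atyp_Cf: "Atyp s t \<in> Cf"
  unfolding Atyp_def using ab by (intro Cf_closed) auto

lemma atyp_elt_cls: "atyp_elt m n s t = cls (Atyp s t)"
proof -
  have "Atyp s t = e sa sa + e tb tb + const (of_int (int s - int t))"
    unfolding Atyp_def by (simp only: diff_minus_eq_add minus_diff_eq diff_diff_eq2 add.assoc) (simp add: add_ac)
  then show ?thesis using ab by (simp add: atyp_elt_def E_cls scal_cls cls_add Cf_closed)
qed

lemma hrel_Atyp: "hrel Ix (Atyp s t) (\<lambda>\<nu>. \<nu> sa - (- \<nu> tb - of_int (int s - int t)))"
  unfolding Atyp_def using ab by (intro hrel_diff hrel_uminus hrel_gen hrel_const)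

text \<open>In every summand the Cartan factor stands to the right of the chain, so it acts directly
  on the highest weight vector by its value.\<close>

lemma Theta_Tv: "Theta s t - Tv (c_scal \<nu> s t) sa tb \<in> Lv \<nu>"
proof -
  have "(\<Sum>J\<in>PJ. echJ tb sa J * (Cp s t (sorted_list_of_set (inner sa tb - J))
      - const (\<Prod>k\<in>inner sa tb - J. c_scal \<nu> s t k))) \<in> Lv \<nu>"
    using ab by (intro left_ideal_sum left_ideal_Lv left_ideal_D(4)[OF left_ideal_Lv] echJ_Cf Lv_hrel[OF hrel_CpJ]) auto
  then show ?thesis
    using ab by (simp add: Theta_def Tv_def sum_subtractf[symmetric] right_diff_distrib const_mult_comm)
qed

lemma weight_iff:
  "a \<in> Cf \<Longrightarrow> cls a \<in> Ub_minus_wt m n (\<lambda>k. - odd_root s t k) \<longleftrightarrow> ub a \<and> wtv (rt tb sa) a"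
  by (rule cls_weight_iff) (auto simp: odd_root_def wt_root_def rt_def)

lemma chain_weight:
  assumes "\<And>J. J \<in> PJ \<Longrightarrow> hrel Ix (x J) (f J)"
  shows "ub (\<Sum>J\<in>PJ. echJ tb sa J * x J) \<and> wtv (rt tb sa) (\<Sum>J\<in>PJ. echJ tb sa J * x J)"
proof -
  have "wtv (rt tb sa) (echJ tb sa J * x J)" if J: "J \<in> PJ" for J
    using wtv_mult[OF wtv_echJ[OF ab(1,2) J] wtv_hrel[OF assms[OF J]] echJ_Cf[OF ab(1,2) J]
        hrel_Cf[OF assms[OF J]]] by (simp add: wtv_def)
  then show ?thesis
    using assms ab by (intro conjI ub_sum wtv_sum ub_mult ub_echJ) (auto intro: ub_hrel)
qed

lemma Theta_weight: "ub (Theta s t)" "wtv (rt tb sa) (Theta s t)"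
  using chain_weight[OF hrel_CpJ] by (simp_all add: Theta_def)

text \<open>The weight-dependent \<open>S_elt\<close> is traded for the fixed element
  \<open>Theta\<close>, so that uniqueness concerns a single difference
  \<open>a - Theta s t\<close>.\<close>

lemma verma_S_iff:
  assumes "a \<in> Cf"
  shows "verma_act m n \<nu> (cls a) (verma_hw m n \<nu>) = verma_act m n \<nu> (S_elt m n s t \<nu>) (verma_hw m n \<nu>)
    \<longleftrightarrow> a - Theta s t \<in> Lv \<nu>"
proof -
  let ?T = "Tv (c_scal \<nu> s t) sa tb"
  have "a - ?T \<in> Lv \<nu> \<longleftrightarrow> a - Theta s t \<in> Lv \<nu>"
    using left_ideal_D(3)[OF left_ideal_Lv _ Theta_Tv, of "a - ?T" \<nu>]
      left_ideal_D(6)[OF left_ideal_Lv _ Theta_Tv, of "a - Theta s t" \<nu>] by auto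
  then show ?thesis
    unfolding S_elt_cls using assms Tv_Cf[OF ab(1,2)] by (simp add: verma_act_hw vcls_eq)
qed

lemma atypical_Lv:
  assumes "atypical m n (odd_root s t) \<nu>"
  shows "Atyp s t \<in> Lv \<nu>"
proof -
  have "\<nu> sa - (- \<nu> tb - of_int (int s - int t)) = 0"
    using assms st atypical_iff[of s m t n \<nu>] by (simp add: algebra_simps)
  then show ?thesis using Lv_hrel[OF hrel_Atyp, of \<nu>] by simp
qed

text \<open>The Cartan coefficients of the chains vanish as functions of the weight, hence as
  polynomials by \<open>hrel_zero\<close>.\<close>

lemma unique_all:
  assumes "ub D" "wtv (rt tb sa) D" "\<And>\<nu>. D \<in> Lv \<nu>"
  shows "D \<approx> 0"
proof -
  obtain x f where xf: "\<And>J. J \<in> PJ \<Longrightarrow> hrel Ix (x J) (f J)" "D \<approx> (\<Sum>J\<in>PJ. echJ tb sa J * x J)"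
    using chain_form[OF ab assms(1,2)] by blast
  have "x J \<approx> 0" if J: "J \<in> PJ" for J
    using chain_form_Lv[OF ab xf assms(3) J] by (intro hrel_zero[OF xf(1)[OF J]]) auto
  then have "(\<Sum>J\<in>PJ. echJ tb sa J * x J) \<approx> (\<Sum>J\<in>PJ. echJ tb sa J * 0)"
    using ab by (intro eqU_sum eqU_lmult echJ_Cf) auto
  then show ?thesis using eqU_trans[OF xf(2)] by simp
qed

text \<open>The Cartan coefficients vanish on the atypical hyperplane only. Division by
  \<open>Atyp\<close> leaves a remainder without the coordinate \<open>sa\<close>, and every weight
  becomes atypical after changing this coordinate alone; so the remainder is zero.\<close>

lemma unique_atypical:
  assumes "ub D" "wtv (rt tb sa) D" "\<And>\<nu>. atypical m n (odd_root s t) \<nu> \<Longrightarrow> D \<in> Lv \<nu>"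
  shows "\<exists>w. ub w \<and> wtv (rt tb sa) w \<and> D \<approx> w * Atyp s t"
proof -
  obtain x f where xf: "\<And>J. J \<in> PJ \<Longrightarrow> hrel Ix (x J) (f J)" "D \<approx> (\<Sum>J\<in>PJ. echJ tb sa J * x J)"
    using chain_form[OF ab assms(1,2)] by blast
  let ?K = "Ix - {sa}" and ?y = "- e tb tb - const (of_int (int s - int t))"
    and ?g = "\<lambda>\<nu>. - \<nu> tb - of_int (int s - int t) :: complex"
  have K: "insert sa ?K = Ix" using ab by auto
  have y: "hrel ?K ?y ?g" using ab by (intro hrel_diff hrel_uminus hrel_gen hrel_const) auto
  have "\<exists>x1 f1. hrel Ix x1 f1 \<and> x J \<approx> x1 * Atyp s t" if J: "J \<in> PJ" for J
  proof -
    obtain x1 f1 x0 f0 where d: "hrel Ix x1 f1" "hrel ?K x0 f0" "x J \<approx> x1 * (e sa sa - ?y) + x0"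
      "\<And>\<nu>. f J \<nu> = f1 \<nu> * (\<nu> sa - ?g \<nu>) + f0 \<nu>"
      using hrel_div[of sa ?K "x J" "f J" ?y ?g] xf(1)[OF J] y ab K by auto
    have "f0 \<nu> = 0" for \<nu>
    proof -
      \<comment> \<open>The atypical weight that agrees with \<nu> away from
        \<open>sa\<close>.\<close>
      let ?\<nu> = "\<nu>(sa := ?g \<nu>)"
      have ne: "sa \<noteq> tb" "tb \<noteq> sa" using ab(3) by (auto simp del: zless_iff_Suc_zadd of_nat_0_less_iff)
      have "f0 \<nu> = f0 ?\<nu>" by (rule hrel_indep[OF d(2)]) auto
      moreover have at: "atypical m n (odd_root s t) ?\<nu>"
        using st ne atypical_iff[of s m t n ?\<nu>] by simp
      then have "f J ?\<nu> = 0" using chain_form_Lv[OF ab xf assms(3)[OF at] J] by simp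
      moreover have "?\<nu> sa - ?g ?\<nu> = 0" using ne by simp
      ultimately show ?thesis using d(4)[of ?\<nu>] by simp
    qed
    then have "x0 \<approx> 0" using hrel_zero[OF d(2)] by simp
    then have "x1 * (e sa sa - ?y) + x0 \<approx> x1 * (e sa sa - ?y) + 0" by (intro eqU_add) auto
    then have "x J \<approx> x1 * Atyp s t" using eqU_trans[OF d(3)] by (simp add: Atyp_def)
    then show ?thesis using d(1) by blast
  qed
  then have "\<forall>J\<in>PJ. \<exists>x1. \<exists>f1. hrel Ix x1 f1 \<and> x J \<approx> x1 * Atyp s t" by blast
  from bchoice[OF this] obtain x1
    where "\<forall>J\<in>PJ. \<exists>f1. hrel Ix (x1 J) f1 \<and> x J \<approx> x1 J * Atyp s t" by blast
  from bchoice[OF this] obtain f1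
    where f1: "\<forall>J\<in>PJ. hrel Ix (x1 J) (f1 J) \<and> x J \<approx> x1 J * Atyp s t" by (elim exE)
  have x1: "hrel Ix (x1 J) (f1 J)" "x J \<approx> x1 J * Atyp s t" if "J \<in> PJ" for J
    using bspec[OF f1 that] by simp_all
  let ?w = "\<Sum>J\<in>PJ. echJ tb sa J * x1 J"
  have "(\<Sum>J\<in>PJ. echJ tb sa J * x J) \<approx> (\<Sum>J\<in>PJ. echJ tb sa J * (x1 J * Atyp s t))"
    using ab x1 by (intro eqU_sum eqU_lmult echJ_Cf) auto
  also have "\<dots> = ?w * Atyp s t" by (simp add: sum_distrib_right mult.assoc)
  finally have "D \<approx> ?w * Atyp s t" by (rule eqU_trans[OF xf(2)])
  moreover have "ub ?w \<and> wtv (rt tb sa) ?w" by (rule chain_weight[OF x1(1)])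
  ultimately show ?thesis by (intro exI[of _ ?w]) simp
qed

text \<open>The chain through all intermediate indices has the empty product as its
  coefficient.\<close>

lemma Tv_nonzero: "Tv (c_scal \<nu> s t) sa tb \<notin> Lv \<nu>"
proof
  assume "Tv (c_scal \<nu> s t) sa tb \<in> Lv \<nu>"
  then have "(\<Sum>J\<in>PJ. const (\<Prod>k\<in>inner sa tb - J. c_scal \<nu> s t k) * echJ tb sa J) \<in> Lv \<nu>"
    using ab by (simp add: Tv_def)
  from echJ_independent[OF ab this, of "inner sa tb"] show False by simp
qed

lemma shapovalov_Theta: "shapovalov_element m n (odd_root s t) (theta m n s t)"
  unfolding shapovalov_element_def
proof (intro conjI allI impI)
  show "theta m n s t \<in> Ub_minus_wt m n (\<lambda>k. - odd_root s t k)"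
    unfolding theta_cls using weight_iff[OF Theta_Cf] Theta_weight by blast
next
  fix \<nu> assume at: "atypical m n (odd_root s t) \<nu>"
  let ?T = "Tv (c_scal \<nu> s t) sa tb"
  have T: "?T \<in> Cf" using Tv_Cf ab by blast
  have v: "verma_act m n \<nu> (theta m n s t) (verma_hw m n \<nu>) = vcls \<nu> ?T"
    unfolding theta_cls verma_act_hw[OF Theta_Cf] using vcls_eq[OF Theta_Cf T] Theta_Tv by blast
  have at': "\<nu> sa + \<nu> tb + of_nat s - of_nat t = 0"
    using at st atypical_iff[of s m t n \<nu>] by simp
  note LI = left_ideal_D[OF left_ideal_Lv]
  show "singular m n \<nu> (verma_act m n \<nu> (theta m n s t) (verma_hw m n \<nu>))"
    unfolding singular_def v verma_one
  proof (intro conjI ballI)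
    show "vcls \<nu> ?T \<in> carrier (verma m n \<nu>)" using T by (rule verma_carrier)
    show "vcls \<nu> ?T \<noteq> vcls \<nu> 0" using vcls_eq[OF T Cf_closed(6)] Tv_nonzero by simp
    fix x assume x: "x \<in> n_plus m n"
    have "gen x * ?T \<approx> (\<Sum>i\<in>Ix. \<Sum>j\<in>Ix. const (x i j) * e i j) * ?T"
      using gen_expand[OF n_plus_gl[OF x]] T by (intro eqU_rmult) (simp_all add: eqU_def)
    also have "\<dots> = (\<Sum>i\<in>Ix. \<Sum>j\<in>Ix. const (x i j) * (e i j * ?T))"
      by (simp add: sum_distrib_right mult.assoc)
    finally have "gen x * ?T \<approx> (\<Sum>i\<in>Ix. \<Sum>j\<in>Ix. const (x i j) * (e i j * ?T))" .
    moreover have "const (x i j) * (e i j * ?T) \<in> Lv \<nu>" if "i \<in> Ix" "j \<in> Ix" for i j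
    proof (cases "i < j")
      case True
      show ?thesis
        by (intro LI(4)[OF Cf_closed(5)] raise_Tv[OF st(1) ab(1) st(3) ab(2) at' that True])
    next
      case False
      then have "x i j = 0" using x by (force simp: n_plus_def)
      then show ?thesis using LI(5) by simp
    qed
    ultimately have "gen x * ?T \<in> Lv \<nu>"
      by (rule_tac left_ideal_eqU[OF left_ideal_Lv]) (auto intro!: left_ideal_sum left_ideal_Lv)
    moreover have "gen x \<in> Cf" using x by (intro gen_Cf n_plus_gl)
    ultimately show "verma_act m n \<nu> (emb m n x) (vcls \<nu> ?T) = vcls \<nu> 0"
      using T by (simp add: emb_cls verma_act_vcls vcls_eq Cf_closed)
  qed
  show "has_weight m n \<nu> (\<lambda>k. \<nu> k - odd_root s t k) (verma_act m n \<nu> (theta m n s t) (verma_hw m n \<nu>))"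
    unfolding has_weight_def v
  proof
    fix h assume h: "h \<in> cartan m n"
    let ?w = "wt_eval m n (\<lambda>k. \<nu> k - odd_root s t k) h"
    have "gen h * ?T \<approx> (\<Sum>k\<in>Ix. const (h k k) * e k k) * ?T"
      using cartan_expand[OF h] T by (rule eqU_rmult)
    then have "gen h * ?T - const ?w * ?T \<approx> (\<Sum>k\<in>Ix. const (h k k) * e k k) * ?T - const ?w * ?T"
      by (intro eqU_diff) auto
    moreover have "(\<Sum>k\<in>Ix. const (h k k) * e k k) * ?T - const ?w * ?T
      = (\<Sum>k\<in>Ix. const (h k k) * (e k k * ?T - const (\<nu> k + of_int (rt tb sa k)) * ?T))"
    proof -
      have "?w = (\<Sum>k\<in>Ix. h k k * (\<nu> k + of_int (rt tb sa k)))"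
        unfolding wt_eval_def by (intro sum.cong refl) (simp add: odd_root_def wt_root_def rt_def)
      then show ?thesis
        by (simp add: const_sum const_mult sum_distrib_right right_diff_distrib sum_subtractf mult.assoc)
    qed
    moreover have "(\<Sum>k\<in>Ix. const (h k k) * (e k k * ?T - const (\<nu> k + of_int (rt tb sa k)) * ?T)) \<in> Lv \<nu>"
      using ab by (intro left_ideal_sum left_ideal_Lv LI(4)[OF Cf_closed(5)] diag_Tv)
    ultimately have "gen h * ?T - const ?w * ?T \<in> Lv \<nu>"
      using left_ideal_eqU[OF left_ideal_Lv] by simp
    moreover have "gen h \<in> Cf" using h by (intro gen_Cf cartan_gl)
    ultimately show "verma_act m n \<nu> (emb m n h) (vcls \<nu> ?T) = verma_act m n \<nu> (scal m n ?w) (vcls \<nu> ?T)"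
      using T by (simp add: emb_cls scal_cls verma_act_vcls vcls_eq Cf_closed)
  qed
qed

lemma weight_cases:
  assumes "\<theta> \<in> Ub_minus_wt m n (\<lambda>k. - odd_root s t k)"
  obtains a where "\<theta> = cls a" "a \<in> Cf" "ub a" "wtv (rt tb sa) a"
proof -
  have "\<theta> \<in> Ub_minus m n" using assms by (simp add: Ub_minus_wt_def)
  then obtain a where "a \<in> Cf" "\<theta> = cls a" using Ub_minus_dec by blast
  then show ?thesis using that weight_iff assms by blast
qed

lemma theta_unique_all:
  assumes "\<theta> \<in> Ub_minus_wt m n (\<lambda>k. - odd_root s t k)"
  shows "(\<forall>\<nu>. verma_act m n \<nu> \<theta> (verma_hw m n \<nu>) = verma_act m n \<nu> (S_elt m n s t \<nu>) (verma_hw m n \<nu>))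
    \<longleftrightarrow> \<theta> = theta m n s t"
proof -
  obtain a where a: "\<theta> = cls a" "a \<in> Cf" "ub a" "wtv (rt tb sa) a" using assms by (rule weight_cases)
  have "(\<forall>\<nu>. a - Theta s t \<in> Lv \<nu>) \<longleftrightarrow> a \<approx> Theta s t"
    using unique_all[of "a - Theta s t"] a Theta_weight left_ideal_D(1)[OF left_ideal_Lv]
    by (auto simp: eqU_def intro: ub_diff wtv_diff)
  then show ?thesis
    unfolding a(1) theta_cls verma_S_iff[OF a(2)] cls_eq[OF a(2) Theta_Cf] .
qed

lemma theta_unique_atypical:
  assumes "\<theta> \<in> Ub_minus_wt m n (\<lambda>k. - odd_root s t k)"
  shows "(\<forall>\<nu>. atypical m n (odd_root s t) \<nu> \<longrightarrow>
      verma_act m n \<nu> \<theta> (verma_hw m n \<nu>) = verma_act m n \<nu> (S_elt m n s t \<nu>) (verma_hw m n \<nu>))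
    \<longleftrightarrow> (\<exists>u\<in>Ub_minus_wt m n (\<lambda>k. - odd_root s t k).
      \<theta> = theta m n s t \<oplus>\<^bsub>U m n\<^esub> u \<otimes>\<^bsub>U m n\<^esub> atyp_elt m n s t)"
    (is "?l \<longleftrightarrow> ?r")
proof -
  obtain a where a: "\<theta> = cls a" "a \<in> Cf" "ub a" "wtv (rt tb sa) a" using assms by (rule weight_cases)
  have eq: "\<theta> = theta m n s t \<oplus>\<^bsub>U m n\<^esub> cls w \<otimes>\<^bsub>U m n\<^esub> atyp_elt m n s t
      \<longleftrightarrow> a - Theta s t \<approx> w * Atyp s t" if "w \<in> Cf" for w
  proof -
    have "\<theta> = theta m n s t \<oplus>\<^bsub>U m n\<^esub> cls w \<otimes>\<^bsub>U m n\<^esub> atyp_elt m n s t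
      \<longleftrightarrow> a \<approx> Theta s t + w * Atyp s t"
      unfolding a(1) theta_cls atyp_elt_cls using a(2) that Theta_Cf Atyp_Cf
      by (simp add: cls_mult cls_add cls_eq Cf_closed)
    then show ?thesis by (simp add: eqU_def algebra_simps)
  qed
  have l: "?l \<longleftrightarrow> (\<forall>\<nu>. atypical m n (odd_root s t) \<nu> \<longrightarrow> a - Theta s t \<in> Lv \<nu>)"
    unfolding a(1) verma_S_iff[OF a(2)] ..
  show ?thesis
  proof
    assume ?l
    then obtain w where "ub w" "wtv (rt tb sa) w" "a - Theta s t \<approx> w * Atyp s t"
      using unique_atypical[of "a - Theta s t"] a Theta_weight unfolding l
      by (auto intro: ub_diff wtv_diff)
    then show ?r using weight_iff[OF ub_Cf] eq[OF ub_Cf] by blast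
  next
    assume ?r
    then obtain u where u: "u \<in> Ub_minus_wt m n (\<lambda>k. - odd_root s t k)"
      "\<theta> = theta m n s t \<oplus>\<^bsub>U m n\<^esub> u \<otimes>\<^bsub>U m n\<^esub> atyp_elt m n s t" by blast
    obtain w where w: "u = cls w" "w \<in> Cf" using u(1) by (rule weight_cases)
    have "a - Theta s t \<approx> w * Atyp s t" using eq[OF w(2)] u(2) w(1) by simp
    moreover have "w * Atyp s t \<in> Lv \<nu>" if "atypical m n (odd_root s t) \<nu>" for \<nu>
      using atypical_Lv[OF that] w(2) by (rule_tac left_ideal_D(4)[OF left_ideal_Lv])
    ultimately show ?l unfolding l using left_ideal_eqU[OF left_ideal_Lv] by blast
  qed
qed

end

text \<open>Uniqueness is stated in two strengths. Multiples of \<open>atyp_elt\<close> from the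
  left act by zero on highest weight vectors of atypical weight, so atypical weights determine the
  element exactly up to such multiples; the action at all weights determines it completely.\<close>

theorem corollary3:
  fixes m n s t :: nat
  assumes "1 \<le> m" and "1 \<le> n" and "1 \<le> s" and "s \<le> m" and "1 \<le> t" and "t \<le> n"
  defines "\<beta> \<equiv> odd_root s t"
  shows "theta m n s t \<in> Ub_minus_wt m n (\<lambda>k. - \<beta> k) \<and>
    (\<forall>\<nu>. atypical m n \<beta> \<nu> \<longrightarrow>
       verma_act m n \<nu> (theta m n s t) (verma_hw m n \<nu>)
         = verma_act m n \<nu> (S_elt m n s t \<nu>) (verma_hw m n \<nu>)) \<and>
    (\<forall>\<theta> \<in> Ub_minus_wt m n (\<lambda>k. - \<beta> k).
       (\<forall>\<nu>. atypical m n \<beta> \<nu> \<longrightarrow>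
          verma_act m n \<nu> \<theta> (verma_hw m n \<nu>)
            = verma_act m n \<nu> (S_elt m n s t \<nu>) (verma_hw m n \<nu>)) \<longleftrightarrow>
       (\<exists>u \<in> Ub_minus_wt m n (\<lambda>k. - \<beta> k).
          \<theta> = theta m n s t \<oplus>\<^bsub>U m n\<^esub> u \<otimes>\<^bsub>U m n\<^esub> atyp_elt m n s t)) \<and>
    (\<forall>\<theta> \<in> Ub_minus_wt m n (\<lambda>k. - \<beta> k).
       (\<forall>\<nu>. verma_act m n \<nu> \<theta> (verma_hw m n \<nu>)
            = verma_act m n \<nu> (S_elt m n s t \<nu>) (verma_hw m n \<nu>)) \<longleftrightarrow>
       \<theta> = theta m n s t) \<and>
    shapovalov_element m n \<beta> (theta m n s t)"
proof -
  interpret odd_pair m n s t by unfold_locales (use assms in auto)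
  have w: "theta m n s t \<in> Ub_minus_wt m n (\<lambda>k. - odd_root s t k)"
    using shapovalov_Theta by (simp add: shapovalov_element_def)
  then show ?thesis
    unfolding \<beta>_def using shapovalov_Theta theta_unique_all[OF w] theta_unique_all theta_unique_atypical
    by blast
qed

end
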